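(* Let $n\ge 2$, let $-1\le d_0\le d_\infty<\frac{1}{n-1}$, and let $\kappa_i>0$, $\theta_i>0$ ($i=1,\dots,n$) be arbitrary. Let $f=f_0+\nu$ be a Lebesgue-measurable signal on $[0,\infty)$ with $f_0$ $n$-times differentiable, and assume there is no noise, i.e. $\nu(t)\equiv 0$. Assume that $|f_0^{(n)}(t)|\le\Delta$ for all $t\geq 0$, where $\Delta\ge 0$ is a constant, with $\Delta=0$ if $d_0>-1$ (and $\Delta\geq 0$ arbitrary if $d_0=-1$). Then there exist gains $k_i>0$, $i=1,\dots,n$, such that all solutions of the differentiator $$\dot x_i=-k_i\phi_i(x_1-f)+x_{i+1}\quad(i=1,\dots,n-1),\qquad \dot x_n=-k_n\phi_n(x_1-f)$$ converge globally (i.e. from every initial condition) and asymptotically to the derivatives of the signal: $x_i(t)\to f_0^{(i-1)}(t)$, i.e. $x_i(t)-f_0^{(i-1)}(t)\to 0$, as $t\to\infty$, for $i=1,\dots,n$. In particular, the convergence is in Fixed-Time, i.e. there is a constant $\bar T>0$ independent of the initial condition such that $x_i(t)=f_0^{(i-1)}(t)$ for all $t\ge\bar T$ and $i=1,\dots,n$, if either (a) $-1<d_0<0<d_\infty<\frac1{n-1}$ and $f\in\mathscr S_0^n$, or (b) $-1=d_0<0<d_\infty<\frac1{n-1}$ and $f\in\mathscr S_\Delta^n$.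
   Context: For real $z$ and $p$, $\lceil z\rfloor^{p}=|z|^{p}\,\mathrm{sign}(z)$. For given $n$, $d_0$, $d_\infty$ define, for $i=1,\dots,n+1$, $$r_{0,i}=1-(n-i)d_0,\qquad r_{\infty,i}=1-(n-i)d_\infty .$$ For $i=1,\dots,n$ let $$\varphi_i(s)=\kappa_i\lceil s\rfloor^{\frac{r_{0,i+1}}{r_{0,i}}}+\theta_i\lceil s\rfloor^{\frac{r_{\infty,i+1}}{r_{\infty,i}}},\qquad \phi_i=\varphi_i\circ\cdots\circ\varphi_2\circ\varphi_1 .$$ When $d_0=-1$ the function $\phi_n$ is discontinuous (it contains the term $\kappa_n\lceil\cdot\rfloor^0=\kappa_n\,\mathrm{sign}(\cdot)$), and solutions are understood in the sense of Filippov, with $\lceil 0\rfloor^0=[-1,1]$. Signal classes: $\mathscr S_0^n=\{f: f^{(n)}(t)\equiv 0\}$ (polynomial signals) and $\mathscr S_\Delta^n=\{f:|f^{(n)}(t)|\le\Delta\}$ ($n$-Lipschitz signals). *)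

theory Defs
  imports "HOL-Analysis.Analysis"
begin

section \<open>Signals and their derivatives on the half-line\<close>

text \<open>The derivative at 0 is the one-sided one; only the values of the signal on
  \<open>{0..}\<close> matter for \<open>nderiv j f t\<close> with \<open>t \<ge> 0\<close>.\<close>

fun nderiv :: "nat \<Rightarrow> (real \<Rightarrow> real) \<Rightarrow> real \<Rightarrow> real" where
  "nderiv 0 f t = f t"
| "nderiv (Suc j) f t = vector_derivative (nderiv j f) (at t within {0..})"

definition n_times_differentiable :: "nat \<Rightarrow> (real \<Rightarrow> real) \<Rightarrow> bool" where
  "n_times_differentiable n f \<longleftrightarrow> (\<forall>j<n. nderiv j f differentiable_on {0..})"

definition poly_signals :: "nat \<Rightarrow> (real \<Rightarrow> real) set" where
  "poly_signals n = {f. n_times_differentiable n f \<and> (\<forall>t\<ge>0. nderiv n f t = 0)}"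

definition lipschitz_signals :: "nat \<Rightarrow> real \<Rightarrow> (real \<Rightarrow> real) set" where
  "lipschitz_signals n \<Delta> = {f. n_times_differentiable n f \<and> (\<forall>t\<ge>0. \<bar>nderiv n f t\<bar> \<le> \<Delta>)}"

section \<open>The output injection terms\<close>

text \<open>The signed power is set-valued: a singleton except for \<open>0\<close> to the power \<open>0\<close>, where it is
  Filippov's regularisation \<open>[-1, 1]\<close> of \<open>sgn\<close>.\<close>

definition spow :: "real \<Rightarrow> real \<Rightarrow> real set" where
  "spow z p = (if z = 0 \<and> p = 0 then {-1..1} else {\<bar>z\<bar> powr p * sgn z})"

definition hweight :: "nat \<Rightarrow> real \<Rightarrow> nat \<Rightarrow> real" where
  "hweight n d i = 1 - (real n - real i) * d"

definition inj_term ::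
  "nat \<Rightarrow> real \<Rightarrow> real \<Rightarrow> (nat \<Rightarrow> real) \<Rightarrow> (nat \<Rightarrow> real) \<Rightarrow> nat \<Rightarrow> real \<Rightarrow> real set" where
  "inj_term n d0 dinf \<kappa> \<theta> i s =
     {\<kappa> i * a + \<theta> i * b | a b.
        a \<in> spow s (hweight n d0 (i + 1) / hweight n d0 i) \<and>
        b \<in> spow s (hweight n dinf (i + 1) / hweight n dinf i)}"

text \<open>The composition of the terms \<open>1, \<dots>, i\<close>, as set-valued maps. For \<open>-1 \<le> d < 1 / (n - 1)\<close>
  all exponents with \<open>i < n\<close> are positive, so that only the outermost term of the full composition
  can be multi-valued, and this happens only for \<open>d = -1\<close>.\<close>

fun inj_comp ::
  "nat \<Rightarrow> real \<Rightarrow> real \<Rightarrow> (nat \<Rightarrow> real) \<Rightarrow> (nat \<Rightarrow> real) \<Rightarrow> nat \<Rightarrow> real \<Rightarrow> real set" where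
  "inj_comp n d0 dinf \<kappa> \<theta> 0 s = {s}"
| "inj_comp n d0 dinf \<kappa> \<theta> (Suc i) s =
     (\<Union>u \<in> inj_comp n d0 dinf \<kappa> \<theta> i s. inj_term n d0 dinf \<kappa> \<theta> (Suc i) u)"

section \<open>Filippov solutions of the differentiator\<close>

text \<open>A finite family of non-overlapping subintervals \<open>[u, v]\<close> is given as a finite set of pairs.\<close>

definition abs_continuous_on :: "real \<Rightarrow> real \<Rightarrow> (real \<Rightarrow> real) \<Rightarrow> bool" where
  "abs_continuous_on a b g \<longleftrightarrow>
     (\<forall>\<epsilon>>0. \<exists>\<delta>>0. \<forall>P. finite P \<longrightarrow>
        (\<forall>(u, v)\<in>P. a \<le> u \<and> u \<le> v \<and> v \<le> b) \<longrightarrow>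
        pairwise (\<lambda>p q. {fst p<..<snd p} \<inter> {fst q<..<snd q} = {}) P \<longrightarrow>
        (\<Sum>(u, v)\<in>P. v - u) < \<delta> \<longrightarrow>
        (\<Sum>(u, v)\<in>P. \<bar>g v - g u\<bar>) < \<epsilon>)"

text \<open>The differentiator's right-hand side at state \<open>y\<close> and signal value \<open>w\<close>, as the set of
  admissible velocities of the \<open>i\<close>-th component. The only component that can be discontinuous is
  the last one, and there the Filippov set is the one given by the convention for \<open>spow\<close>.\<close>

definition differentiator_rhs ::
  "nat \<Rightarrow> real \<Rightarrow> real \<Rightarrow> (nat \<Rightarrow> real) \<Rightarrow> (nat \<Rightarrow> real) \<Rightarrow> (nat \<Rightarrow> real) \<Rightarrow>
   real \<Rightarrow> (nat \<Rightarrow> real) \<Rightarrow> nat \<Rightarrow> real set" where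
  "differentiator_rhs n d0 dinf \<kappa> \<theta> k w y i =
     (\<lambda>p. - k i * p + (if i < n then y (i + 1) else 0)) `
       inj_comp n d0 dinf \<kappa> \<theta> i (y 1 - w)"

text \<open>Solutions on \<open>[0, \<tau>)\<close>, where \<open>\<tau>\<close> may be \<open>\<infinity>\<close>; the state \<open>x\<close> has the components
  \<open>x 1, \<dots>, x n\<close>, and its values outside \<open>[0, \<tau>)\<close> are irrelevant.\<close>

definition filippov_solution ::
  "nat \<Rightarrow> real \<Rightarrow> real \<Rightarrow> (nat \<Rightarrow> real) \<Rightarrow> (nat \<Rightarrow> real) \<Rightarrow> (nat \<Rightarrow> real) \<Rightarrow>
   (real \<Rightarrow> real) \<Rightarrow> ereal \<Rightarrow> (nat \<Rightarrow> real \<Rightarrow> real) \<Rightarrow> bool" where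
  "filippov_solution n d0 dinf \<kappa> \<theta> k f \<tau> x \<longleftrightarrow>
     0 < \<tau> \<and>
     (\<forall>i\<in>{1..n}. \<forall>b\<ge>0. ereal b < \<tau> \<longrightarrow> abs_continuous_on 0 b (x i)) \<and>
     (AE t in lebesgue. 0 < t \<and> ereal t < \<tau> \<longrightarrow>
        (\<forall>i\<in>{1..n}. \<exists>v \<in> differentiator_rhs n d0 dinf \<kappa> \<theta> k (f t) (\<lambda>j. x j t) i.
            (x i has_real_derivative v) (at t)))"

text \<open>A solution is maximal if it has no continuation to a longer interval. In particular, a
  solution that escapes to infinity in finite time is maximal with \<open>\<tau> < \<infinity>\<close>.\<close>

definition maximal_filippov_solution ::
  "nat \<Rightarrow> real \<Rightarrow> real \<Rightarrow> (nat \<Rightarrow> real) \<Rightarrow> (nat \<Rightarrow> real) \<Rightarrow> (nat \<Rightarrow> real) \<Rightarrow>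
   (real \<Rightarrow> real) \<Rightarrow> ereal \<Rightarrow> (nat \<Rightarrow> real \<Rightarrow> real) \<Rightarrow> bool" where
  "maximal_filippov_solution n d0 dinf \<kappa> \<theta> k f \<tau> x \<longleftrightarrow>
     filippov_solution n d0 dinf \<kappa> \<theta> k f \<tau> x \<and>
     \<not> (\<exists>\<tau>' y. \<tau> < \<tau>' \<and> filippov_solution n d0 dinf \<kappa> \<theta> k f \<tau>' y \<and>
          (\<forall>i\<in>{1..n}. \<forall>t\<ge>0. ereal t < \<tau> \<longrightarrow> y i t = x i t))"

end

(* Write the error as e_i = k_(i-1) phi_(i-1)(u_i), where phi_i is the composition of the first i
   injection terms and k_0 = 1, u_(n+1) = 0. With K_i = k_i / k_(i-1) the error dynamics become
     d/dt phi_(i-1)(u_i) = - K_i (phi_i(u_1) - phi_i(u_(i+1))),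
   up to a disturbance of the last equation that the term kappa_n sign dominates. So u_1 tends to
   u_2, and u_i moves in the direction of u_(i+1) - u_1.
   Fix a scale l and consider the box of all states with |u_i - u_(i+1)| <= 32^i l. If the i-th gap
   is at least 32^i l / 8, then u_1 lies beyond u_(i+1) by a multiple of l, hence u_i moves towards
   u_(i+1) at a rate of order K_i. A gap that doubles would require u_(i+1) to travel a distance of
   order l, which takes so long that, if K_i is much larger than K_(i+1), u_i would have left its
   range. So from the box at scale l / 2 the box at scale l is never left, and after a time of order
   sum_i phi_(i-1)(l) / phi_i(l) the state is in the box at scale l / 4. The gains can be chosen
   independently of l since phi_(i-1)(l) phi_(i+1)(l) <= const * phi_i(l)^2, which is the
   bi-homogeneity. Iterating gives convergence, and if d0 < 0 < dinf the times for l = 2^j are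
   summable over all integers j, which gives a fixed time.
   A maximal solution is global because a bounded solution can be continued: by the signal itself if
   its error is zero, and otherwise by a limit of Euler polygons. *)

theory Submission
  imports Defs "HOL-Complex_Analysis.Great_Picard"
begin

section \<open>Absolutely continuous functions\<close>

text \<open>No Lyapunov function is formed. The coordinates arise by inverting powers, so they are
  compared through monotonicity only; all dynamics enters through increments of phi_(i-1)(u_i),
  which absolute continuity supplies although the inclusion holds only almost everywhere. The
  fractions fit together because inside the box a gap cannot double its value once it is at least
  1/8 of its weight: from 1/2 it stays below 1, and from 1/8, once reached, below 1/4, which is
  again half of the next scale 1/2. The base 32 keeps the gaps of index below i, taken together,
  within 1/16 of the i-th weight, half of the threshold 1/8, so the other half is left for the
  descent. The last equation differs: its gap is measured from the constant 0, and for d0 = -1 its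
  map jumps at 0. The jump absorbs the disturbance, but it rules out Peano's theorem for the
  continuation. The limit of Euler polygons satisfies the inclusion nevertheless, since near a state
  with nonzero error x_1 - f vanishes on a countable set only; at zero error the signal is a
  solution because the Filippov set at 0 is wide enough.\<close>

definition subintervals :: "real \<Rightarrow> real \<Rightarrow> (real \<times> real) set \<Rightarrow> bool" where
  "subintervals a b P \<longleftrightarrow> finite P \<and> (\<forall>(u, v)\<in>P. a \<le> u \<and> u \<le> v \<and> v \<le> b) \<and>
     pairwise (\<lambda>p q. {fst p<..<snd p} \<inter> {fst q<..<snd q} = {}) P"

lemma abs_continuous_on_iff:
  "abs_continuous_on a b g \<longleftrightarrow> (\<forall>e>0. \<exists>d>0. \<forall>P. subintervals a b P \<longrightarrow>
    (\<Sum>(u, v)\<in>P. v - u) < d \<longrightarrow> (\<Sum>(u, v)\<in>P. \<bar>g v - g u\<bar>) < e)"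
  unfolding abs_continuous_on_def subintervals_def by (simp only: imp_conjL)

lemma abs_continuous_on_diff:
  assumes "abs_continuous_on a b g" and "abs_continuous_on a b h"
  shows "abs_continuous_on a b (\<lambda>t. g t - h t)"
  unfolding abs_continuous_on_iff
proof (intro allI impI)
  fix e :: real assume "e > 0"
  then have e2: "e / 2 > 0" by simp
  obtain d1 where d1: "d1 > 0" "\<And>P. subintervals a b P \<Longrightarrow> (\<Sum>(u, v)\<in>P. v - u) < d1 \<Longrightarrow>
      (\<Sum>(u, v)\<in>P. \<bar>g v - g u\<bar>) < e / 2"
    using assms(1) e2 unfolding abs_continuous_on_iff by meson
  obtain d2 where d2: "d2 > 0" "\<And>P. subintervals a b P \<Longrightarrow> (\<Sum>(u, v)\<in>P. v - u) < d2 \<Longrightarrow>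
      (\<Sum>(u, v)\<in>P. \<bar>h v - h u\<bar>) < e / 2"
    using assms(2) e2 unfolding abs_continuous_on_iff by meson
  show "\<exists>d>0. \<forall>P. subintervals a b P \<longrightarrow> (\<Sum>(u, v)\<in>P. v - u) < d \<longrightarrow>
      (\<Sum>(u, v)\<in>P. \<bar>(g v - h v) - (g u - h u)\<bar>) < e"
  proof (intro exI[of _ "min d1 d2"] conjI allI impI)
    show "0 < min d1 d2" using d1(1) d2(1) by simp
    fix P assume P: "subintervals a b P" "(\<Sum>(u, v)\<in>P. v - u) < min d1 d2"
    have "(\<Sum>(u, v)\<in>P. \<bar>(g v - h v) - (g u - h u)\<bar>)
        \<le> (\<Sum>(u, v)\<in>P. \<bar>g v - g u\<bar> + \<bar>h v - h u\<bar>)"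
      by (intro sum_mono) auto
    also have "\<dots> = (\<Sum>(u, v)\<in>P. \<bar>g v - g u\<bar>) + (\<Sum>(u, v)\<in>P. \<bar>h v - h u\<bar>)"
      by (simp add: sum.distrib case_prod_unfold)
    also have "\<dots> < e / 2 + e / 2"
      using P by (intro add_strict_mono d1(2) d2(2)) auto
    finally show "(\<Sum>(u, v)\<in>P. \<bar>(g v - h v) - (g u - h u)\<bar>) < e" by simp
  qed
qed

lemma abs_continuous_on_lipschitz:
  assumes "\<And>u v. a \<le> u \<Longrightarrow> u \<le> v \<Longrightarrow> v \<le> b \<Longrightarrow> \<bar>g v - g u\<bar> \<le> L * (v - u)"
  shows "abs_continuous_on a b g"
  unfolding abs_continuous_on_iff
proof (intro allI impI)
  fix e :: real assume "e > 0"
  show "\<exists>d>0. \<forall>P. subintervals a b P \<longrightarrow> (\<Sum>(u, v)\<in>P. v - u) < d \<longrightarrow> (\<Sum>(u, v)\<in>P. \<bar>g v - g u\<bar>) < e"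
  proof (intro exI[of _ "e / (\<bar>L\<bar> + 1)"] conjI allI impI)
    show "0 < e / (\<bar>L\<bar> + 1)" using \<open>e > 0\<close> by simp
    fix P assume P: "subintervals a b P" "(\<Sum>(u, v)\<in>P. v - u) < e / (\<bar>L\<bar> + 1)"
    have "(\<Sum>(u, v)\<in>P. \<bar>g v - g u\<bar>) \<le> (\<Sum>(u, v)\<in>P. (\<bar>L\<bar> + 1) * (v - u))"
    proof (intro sum_mono, clarify)
      fix u v assume "(u, v) \<in> P"
      then have uv: "a \<le> u" "u \<le> v" "v \<le> b" using P(1) by (auto simp: subintervals_def)
      have "\<bar>g v - g u\<bar> \<le> L * (v - u)" using uv by (rule assms)
      also have "\<dots> \<le> (\<bar>L\<bar> + 1) * (v - u)" using uv by (intro mult_right_mono) auto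
      finally show "\<bar>g v - g u\<bar> \<le> (\<bar>L\<bar> + 1) * (v - u)" .
    qed
    also have "\<dots> = (\<bar>L\<bar> + 1) * (\<Sum>(u, v)\<in>P. v - u)"
      by (simp add: sum_distrib_left case_prod_unfold)
    also have "\<dots> < (\<bar>L\<bar> + 1) * (e / (\<bar>L\<bar> + 1))"
      using P(2) by (intro mult_strict_left_mono) auto
    finally show "(\<Sum>(u, v)\<in>P. \<bar>g v - g u\<bar>) < e" by simp
  qed
qed

lemma abs_continuous_on_subinterval:
  assumes "abs_continuous_on a b g" "a \<le> c" "d \<le> b"
  shows "abs_continuous_on c d g"
proof -
  have "subintervals a b P" if "subintervals c d P" for P
    using that assms(2,3) unfolding subintervals_def by fastforce
  then show ?thesis using assms(1) unfolding abs_continuous_on_iff by meson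
qed

lemma abs_continuous_on_imp_continuous_on:
  assumes "abs_continuous_on a b g"
  shows "continuous_on {a..b} g"
  unfolding continuous_on_iff
proof (intro ballI allI impI)
  fix x e :: real assume x: "x \<in> {a..b}" and "e > 0"
  then obtain dl where "dl > 0" and dl: "\<And>P. subintervals a b P \<Longrightarrow> (\<Sum>(u, v)\<in>P. v - u) < dl \<Longrightarrow>
      (\<Sum>(u, v)\<in>P. \<bar>g v - g u\<bar>) < e"
    using assms unfolding abs_continuous_on_iff by meson
  have "dist (g y) (g x) < e" if y: "y \<in> {a..b}" "dist y x < dl" for y
    using dl[of "{(min x y, max x y)}"] x y by (cases "x \<le> y")
      (auto simp: subintervals_def dist_real_def min_def max_def abs_minus_commute split: if_splits)
  then show "\<exists>d>0. \<forall>x'\<in>{a..b}. dist x' x < d \<longrightarrow> dist (g x') (g x) < e"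
    using \<open>dl > 0\<close> by blast
qed

text \<open>A gauge confines the cells tagged in the exceptional null set to an open set of small
  measure, where absolute continuity bounds the increments of \<open>g\<close>; every other cell
  obeys the straddle estimate at its tag. The sum over a fine division telescopes to
  \<open>g b - g a\<close>.\<close>

lemma abs_continuous_on_antimono_AE:
  assumes "a \<le> b" and ac: "abs_continuous_on a b g" and "negligible N"
    and der: "\<And>t. t \<in> {a<..<b} - N \<Longrightarrow> \<exists>v\<le>0. (g has_real_derivative v) (at t)"
  shows "g b \<le> g a"
proof (rule field_le_epsilon)
  fix e0 :: real assume "e0 > 0"
  \<comment> \<open>The slope error \<open>e * (b - a)\<close> and the contribution \<open>e\<close>
    of the exceptional cells add up to \<open>e0\<close>.\<close>
  define e where "e = e0 / (b - a + 1)"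
  have "e > 0" using \<open>e0 > 0\<close> \<open>a \<le> b\<close> by (simp add: e_def)
  then obtain dl where "dl > 0" and dl: "\<And>P. subintervals a b P \<Longrightarrow> (\<Sum>(u, v)\<in>P. v - u) < dl \<Longrightarrow>
      (\<Sum>(u, v)\<in>P. \<bar>g v - g u\<bar>) < e"
    using ac unfolding abs_continuous_on_iff by meson
  \<comment> \<open>The endpoints join the exceptional set, since derivatives are controlled in the
    interior only.\<close>
  define M where "M = N \<union> {a, b}"
  have M: "negligible M" using \<open>negligible N\<close> by (auto simp: M_def)
  obtain G where G: "open G" "M \<subseteq> G" "G - M \<in> lmeasurable" "emeasure lebesgue (G - M) < ennreal dl"
    using sets_lebesgue_outer_open[of M dl] M \<open>dl > 0\<close> negligible_iff_null_sets by blast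
  have MG: "M \<in> lmeasurable" "measure lebesgue M = 0"
    using M negligible_imp_measurable negligible_imp_measure0 by auto
  have "G = (G - M) \<union> M" using G(2) by auto
  then have Gm: "G \<in> lmeasurable" using G(3) MG(1) by (metis fmeasurable.Un)
  have "measure lebesgue G \<le> measure lebesgue (G - M) + measure lebesgue M"
    using \<open>G = (G - M) \<union> M\<close> measure_Un_le[of "G - M" lebesgue M] G(3) MG(1) by (metis fmeasurableD)
  also have "\<dots> < dl"
    using G(4) MG(2) \<open>dl > 0\<close> emeasure_eq_measure2[OF G(3)] by (simp add: ennreal_less_iff)
  finally have Gdl: "measure lebesgue G < dl" .
  have "\<exists>r>0. \<forall>y. \<bar>y - x\<bar> < r \<longrightarrow> \<bar>g y - g x - v * (y - x)\<bar> \<le> e * \<bar>y - x\<bar>"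
    if "(g has_real_derivative v) (at x)" for x v
  proof -
    have "(g has_derivative (\<lambda>h. v * h)) (at x)"
      using that by (simp add: has_field_derivative_def)
    then show ?thesis
      unfolding has_derivative_at_alt using \<open>e > 0\<close> by (auto simp: real_norm_def)
  qed
  note approx = this
  have "\<exists>r>0. \<forall>u w. u \<le> x \<longrightarrow> x \<le> w \<longrightarrow> x - u < r \<longrightarrow> w - x < r \<longrightarrow> g w - g u \<le> e * (w - u)"
    if x: "x \<in> {a<..<b} - N" for x
  proof -
    obtain v where v: "v \<le> 0" "(g has_real_derivative v) (at x)" using der[OF x] by auto
    from approx[OF v(2)] obtain r where r: "r > 0"
      "\<And>y. \<bar>y - x\<bar> < r \<Longrightarrow> \<bar>g y - g x - v * (y - x)\<bar> \<le> e * \<bar>y - x\<bar>" by auto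
    have "g w - g u \<le> e * (w - u)" if "u \<le> x" "x \<le> w" "x - u < r" "w - x < r" for u w
    proof -
      have "\<bar>g w - g x - v * (w - x)\<bar> \<le> e * (w - x)" "\<bar>g u - g x - v * (u - x)\<bar> \<le> e * (x - u)"
        using r(2)[of w] r(2)[of u] that by auto
      moreover have "v * (w - x) \<le> 0" "v * (u - x) \<ge> 0"
        using v(1) that by (auto simp: mult_nonpos_nonneg mult_nonpos_nonpos)
      ultimately show ?thesis by (simp add: algebra_simps)
    qed
    then show ?thesis using r(1) by blast
  qed
  then obtain r where r: "\<And>x. x \<in> {a<..<b} - N \<Longrightarrow> r x > 0"
    "\<And>x u w. x \<in> {a<..<b} - N \<Longrightarrow> u \<le> x \<Longrightarrow> x \<le> w \<Longrightarrow> x - u < r x \<Longrightarrow> w - x < r x \<Longrightarrow> g w - g u \<le> e * (w - u)"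
    by metis
  define \<gamma> where "\<gamma> x = (if x \<in> M then G else if x \<in> {a<..<b} then ball x (r x) else UNIV)" for x
  have "gauge \<gamma>"
    unfolding gauge_def \<gamma>_def using G(1,2) r(1) by (auto simp: M_def)
  then obtain p where p: "p tagged_division_of {a..b}" "\<gamma> fine p"
    using fine_division_exists_real by blast
  have finp: "finite p" using p(1) by blast
  define q where "q = {xk \<in> p. fst xk \<in> M}"
  have q: "q tagged_partial_division_of {a..b}"
    using p(1) unfolding tagged_division_of_def
    by (auto simp: q_def intro: tagged_partial_division_subset)
  \<comment> \<open>Absolute continuity speaks of a set of intervals, so the tags are dropped. Cells
    that coincide after this are degenerate and carry no increment.\<close>
  define D where "D = snd ` q"
  have Ddiv: "D division_of (\<Union>D)"
    unfolding D_def using partial_division_of_tagged_division[OF q] .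
  have K: "\<exists>u w. K = {u..w} \<and> x \<in> K \<and> u \<le> x \<and> x \<le> w \<and> a \<le> u \<and> w \<le> b \<and> Inf K = u \<and> Sup K = w"
    if "(x, K) \<in> p" for x K
  proof -
    have 1: "x \<in> K" "K \<subseteq> {a..b}" "\<exists>u w. K = cbox u w" using tagged_division_ofD(2-4)[OF p(1) that] by auto
    then obtain u w where "K = {u..w}" by auto
    with 1 show ?thesis by (intro exI[of _ u] exI[of _ w]) auto
  qed
  have good: "g (Sup K) - g (Inf K) \<le> e * (Sup K - Inf K)" if xk: "(x, K) \<in> p - q" for x K
  proof -
    obtain u w where uw: "K = {u..w}" "x \<in> K" "u \<le> x" "x \<le> w" "a \<le> u" "w \<le> b" "Inf K = u" "Sup K = w"
      using K[of x K] xk by auto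
    have xM: "x \<notin> M" using xk by (auto simp: q_def)
    then have x: "x \<in> {a<..<b} - N" using uw by (auto simp: M_def)
    have "K \<subseteq> \<gamma> x" using p(2) xk by (auto simp: fine_def)
    then have "K \<subseteq> ball x (r x)" using xM x by (auto simp: \<gamma>_def)
    moreover have "u \<in> K" "w \<in> K" using uw by auto
    ultimately have "u \<in> ball x (r x)" "w \<in> ball x (r x)" by blast+
    then have "x - u < r x" "w - x < r x" using uw by (auto simp: dist_real_def)
    with r(2)[OF x uw(3,4)] uw show ?thesis by simp
  qed
  have Dlen: "(\<Sum>K\<in>D. Sup K - Inf K) < dl"
  proof -
    have "(\<Sum>K\<in>D. Sup K - Inf K) = (\<Sum>K\<in>D. measure lebesgue K)"
    proof (intro sum.cong refl)
      fix K assume "K \<in> D"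
      then obtain x where "(x, K) \<in> p" by (auto simp: D_def q_def)
      then obtain u w where "K = {u..w}" "u \<le> w" "Inf K = u" "Sup K = w" using K by force
      then show "Sup K - Inf K = measure lebesgue K" by simp
    qed
    also have "\<dots> = measure lebesgue (\<Union>D)" using content_division[OF Ddiv] .
    also have "\<dots> \<le> measure lebesgue G"
    proof (intro measure_mono_fmeasurable Gm)
      show "\<Union>D \<subseteq> G"
      proof
        fix y assume "y \<in> \<Union>D"
        then obtain x K where xk: "(x, K) \<in> p" "x \<in> M" "y \<in> K" by (auto simp: D_def q_def)
        then have "K \<subseteq> \<gamma> x" using p(2) by (auto simp: fine_def)
        then show "y \<in> G" using xk by (auto simp: \<gamma>_def)
      qed
      show "\<Union>D \<in> sets lebesgue"
        using Ddiv by (meson fmeasurableD lmeasurable_division)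
    qed
    finally show ?thesis using Gdl by simp
  qed
  have Dmem: "\<exists>x. (x, K) \<in> p" if "K \<in> D" for K using that by (auto simp: D_def q_def)
  have inj: "inj_on (\<lambda>K. (Inf K, Sup K)) D"
  proof (rule inj_onI)
    fix K L assume "K \<in> D" "L \<in> D" "(Inf K, Sup K) = (Inf L, Sup L)"
    with Dmem K show "K = L" by (metis Pair_inject)
  qed
  have "(\<Sum>(u, v)\<in>(\<lambda>K. (Inf K, Sup K)) ` D. \<bar>g v - g u\<bar>) < e"
  proof (rule dl, unfold subintervals_def, intro conjI)
    show "finite ((\<lambda>K. (Inf K, Sup K)) ` D)" using Ddiv by blast
    show "\<forall>(u, v)\<in>(\<lambda>K. (Inf K, Sup K)) ` D. a \<le> u \<and> u \<le> v \<and> v \<le> b"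
      using Dmem K by fastforce
    show "(\<Sum>(u, v)\<in>(\<lambda>K. (Inf K, Sup K)) ` D. v - u) < dl"
      using Dlen by (simp add: sum.reindex[OF inj])
    show "pairwise (\<lambda>p q. {fst p<..<snd p} \<inter> {fst q<..<snd q} = {}) ((\<lambda>K. (Inf K, Sup K)) ` D)"
    proof (rule pairwiseI)
      fix i j assume ij: "i \<in> (\<lambda>K. (Inf K, Sup K)) ` D" "j \<in> (\<lambda>K. (Inf K, Sup K)) ` D" "i \<noteq> j"
      then obtain K L where KL: "K \<in> D" "L \<in> D" "i = (Inf K, Sup K)" "j = (Inf L, Sup L)" by auto
      then have "interior K \<inter> interior L = {}" using division_ofD(5)[OF Ddiv KL(1,2)] ij(3) by auto
      moreover have "interior K = {Inf K<..<Sup K}" "interior L = {Inf L<..<Sup L}"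
        using KL Dmem K by (metis interior_atLeastAtMost_real)+
      ultimately show "{fst i<..<snd i} \<inter> {fst j<..<snd j} = {}" using KL by simp
    qed
  qed
  then have AC: "(\<Sum>K\<in>D. \<bar>g (Sup K) - g (Inf K)\<bar>) < e"
    by (simp add: sum.reindex[OF inj])
  have "g b - g a = (\<Sum>(x,K)\<in>p. g (Sup K) - g (Inf K))"
    using additive_tagged_division_1[OF \<open>a \<le> b\<close> p(1), of g] by simp
  also have "\<dots> = (\<Sum>(x,K)\<in>p - q. g (Sup K) - g (Inf K)) + (\<Sum>(x,K)\<in>q. g (Sup K) - g (Inf K))"
    using sum.subset_diff[of q p "\<lambda>(x,K). g (Sup K) - g (Inf K)"] finp by (auto simp: q_def)
  also have "(\<Sum>(x,K)\<in>q. g (Sup K) - g (Inf K)) = (\<Sum>K\<in>D. g (Sup K) - g (Inf K))"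
  proof -
    \<comment> \<open>The passage from tagged cells to intervals wants the value 0 on every
      \<open>cbox\<close> with empty interior; this includes the empty set, where \<open>Sup\<close>
      and \<open>Inf\<close> are unspecified.\<close>
    define d where "d K = (if K = {} then 0 else g (Sup K) - g (Inf K))" for K
    have "(\<Sum>(x,K)\<in>q. g (Sup K) - g (Inf K)) = (\<Sum>(x,K)\<in>q. d K)"
      using K by (intro sum.cong) (fastforce simp: q_def d_def)+
    also have "\<dots> = (\<Sum>K\<in>D. d K)"
      unfolding D_def
    proof (rule sum.over_tagged_division_lemma[OF tagged_partial_division_of_Union_self[OF q]])
      show "d (cbox u v) = 0" if "box u v = {}" for u v
        using that by (cases "u = v") (auto simp: d_def)
    qed
    also have "\<dots> = (\<Sum>K\<in>D. g (Sup K) - g (Inf K))"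
      using Dmem K by (intro sum.cong) (fastforce simp: d_def)+
    finally show ?thesis .
  qed
  also have "\<dots> \<le> (\<Sum>K\<in>D. \<bar>g (Sup K) - g (Inf K)\<bar>)" by (intro sum_mono) simp
  also have "\<dots> \<le> e" using AC by simp
  also have "(\<Sum>(x,K)\<in>p - q. g (Sup K) - g (Inf K)) \<le> (\<Sum>(x,K)\<in>p - q. e * (Sup K - Inf K))"
    using good by (intro sum_mono) auto
  also have "\<dots> \<le> (\<Sum>(x,K)\<in>p. e * (Sup K - Inf K))"
  proof (intro sum_mono2 finp)
    fix xk assume "xk \<in> p - (p - q)"
    then obtain x K where "xk = (x, K)" "(x, K) \<in> p" by (cases xk) auto
    with K[of x K] \<open>e > 0\<close> show "0 \<le> (case xk of (x, K) \<Rightarrow> e * (Sup K - Inf K))" by force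
  qed auto
  also have "\<dots> = e * (b - a)"
    using additive_tagged_division_1[OF \<open>a \<le> b\<close> p(1), of "\<lambda>x. e * x"] by (simp add: algebra_simps case_prod_unfold)
  finally have "g b - g a \<le> e * (b - a + 1)" by (simp add: algebra_simps)
  also have "\<dots> = e0" using \<open>a \<le> b\<close> by (simp add: e_def)
  finally show "g b \<le> g a + e0" by simp
qed

lemma abs_continuous_on_increment_le:
  assumes "a \<le> b" and "abs_continuous_on a b g" and "negligible N"
    and der: "\<And>t. t \<in> {a<..<b} - N \<Longrightarrow> \<exists>v\<le>c. (g has_real_derivative v) (at t)"
  shows "g b - g a \<le> c * (b - a)"
proof -
  have "g b - c * b \<le> g a - c * a"
  proof (rule abs_continuous_on_antimono_AE[where g = "\<lambda>t. g t - c * t"])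
    show "abs_continuous_on a b (\<lambda>t. g t - c * t)"
    proof (rule abs_continuous_on_diff[OF assms(2)])
      show "abs_continuous_on a b ((*) c)"
        by (rule abs_continuous_on_lipschitz[where L = "\<bar>c\<bar>"])
           (auto simp: abs_mult simp flip: right_diff_distrib)
    qed
    show "\<exists>v\<le>0. ((\<lambda>t. g t - c * t) has_real_derivative v) (at t)" if t: "t \<in> {a<..<b} - N" for t
    proof -
      obtain v where "v \<le> c" "(g has_real_derivative v) (at t)" using der[OF t] by auto
      then show ?thesis by (intro exI[of _ "v - c"]) (auto intro!: derivative_eq_intros)
    qed
  qed (use assms in auto)
  then show ?thesis by (simp add: algebra_simps)
qed

lemma abs_continuous_on_increment_ge:
  assumes "a \<le> b" and "abs_continuous_on a b g" and "negligible N"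
    and der: "\<And>t. t \<in> {a<..<b} - N \<Longrightarrow> \<exists>v\<ge>c. (g has_real_derivative v) (at t)"
  shows "c * (b - a) \<le> g b - g a"
proof -
  have "(0 - g b) - (0 - g a) \<le> (- c) * (b - a)"
  proof (rule abs_continuous_on_increment_le[where g = "\<lambda>t. 0 - g t", OF assms(1) _ assms(3)])
    show "abs_continuous_on a b (\<lambda>t. 0 - g t)"
      by (rule abs_continuous_on_diff[OF abs_continuous_on_lipschitz[where L = 0] assms(2)]) simp
    show "\<exists>v\<le>- c. ((\<lambda>t. 0 - g t) has_real_derivative v) (at t)" if t: "t \<in> {a<..<b} - N" for t
    proof -
      obtain v where "c \<le> v" "(g has_real_derivative v) (at t)" using der[OF t] by auto
      then show ?thesis by (intro exI[of _ "- v"]) (auto intro!: derivative_eq_intros)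
    qed
  qed
  then show ?thesis by simp
qed

section \<open>Contraction of chains\<close>

text \<open>The last crossing and not the first, so that the gap stays above the level on all of the
  remaining interval, where the descent estimate is then applied.\<close>

lemma last_crossing:
  fixes g :: "real \<Rightarrow> real"
  assumes "s \<le> t" "continuous_on {s..t} g" "g s \<le> b" "b \<le> g t"
  obtains r where "s \<le> r" "r \<le> t" "g r = b" "\<And>q. r \<le> q \<Longrightarrow> q \<le> t \<Longrightarrow> b \<le> g q"
proof -
  define S where "S = {q \<in> {s..t}. g q \<le> b}"
  have "closed S" unfolding S_def
    by (rule continuous_on_closed_Collect_le[OF assms(2)]) auto
  moreover have "bounded S" by (rule bounded_subset[of "{s..t}"]) (auto simp: S_def)
  ultimately have "compact S" by (simp add: compact_eq_bounded_closed)
  moreover have "S \<noteq> {}" using assms by (auto simp: S_def)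
  ultimately obtain r where r: "r \<in> S" "\<And>q. q \<in> S \<Longrightarrow> q \<le> r" using compact_attains_sup by metis
  have rst: "s \<le> r" "r \<le> t" "g r \<le> b" using r(1) by (auto simp: S_def)
  obtain q where q: "r \<le> q" "q \<le> t" "g q = b"
    using IVT'[of g r b t] rst assms continuous_on_subset[OF assms(2), of "{r..t}"] by auto
  have "q \<in> S" using q rst by (auto simp: S_def)
  then have "q = r" using r(2) q(1) by force
  show ?thesis
  proof
    show "s \<le> r" "r \<le> t" "g r = b" using rst q \<open>q = r\<close> by auto
    show "b \<le> g q'" if "r \<le> q'" "q' \<le> t" for q'
    proof (rule ccontr)
      assume "\<not> b \<le> g q'"
      then have "q' \<in> S" using that rst by (auto simp: S_def)
      then have "q' = r" using r(2) that by force
      then show False using \<open>\<not> b \<le> g q'\<close> q \<open>q = r\<close> by simp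
    qed
  qed
qed

text \<open>What the contraction argument uses of the composed injection terms. The constants in
  \<open>doubling\<close>, \<open>increment\<close> and \<open>log_concave\<close> do not depend on
  \<open>s\<close>, so one choice of gains can serve all scales. The last map is only monotone and
  has no \<open>increment\<close>, because it may jump at 0; its increments are needed from 0
  only.\<close>

locale injection_chain =
  fixes n :: nat and \<phi> :: "nat \<Rightarrow> real \<Rightarrow> real"
  assumes n_pos: "1 \<le> n"
    and strict_mono: "\<And>i. i < n \<Longrightarrow> strict_mono (\<phi> i)"
    and mono_last: "mono (\<phi> n)"
    and odd: "\<And>i s. i \<le> n \<Longrightarrow> \<phi> i (- s) = - \<phi> i s"
    and pos: "\<And>i s. i \<le> n \<Longrightarrow> 0 < s \<Longrightarrow> 0 < \<phi> i s"
    and doubling: "\<And>i a. i \<le> n \<Longrightarrow> 0 < a \<Longrightarrow> \<exists>C>0. \<forall>s>0. \<phi> i (a * s) \<le> C * \<phi> i s"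
    and increment: "\<And>i a b. i < n \<Longrightarrow> 0 < a \<Longrightarrow> 0 < b \<Longrightarrow>
      \<exists>c>0. \<forall>s>0. \<forall>v. \<bar>v\<bar> \<le> a * s \<longrightarrow> \<phi> i v + c * \<phi> i s \<le> \<phi> i (v + b * s)"
    and log_concave: "\<exists>D>0. \<forall>i\<in>{1..<n}. \<forall>s>0. \<phi> (i + 1) s * \<phi> (i - 1) s \<le> D * (\<phi> i s)\<^sup>2"
begin

lemma mono: "i \<le> n \<Longrightarrow> mono (\<phi> i)"
  using strict_mono[of i] mono_last strict_mono_mono[of "\<phi> i"] by (cases "i = n") auto

lemma monoD: "i \<le> n \<Longrightarrow> x \<le> y \<Longrightarrow> \<phi> i x \<le> \<phi> i y"
  using mono[of i] unfolding mono_def by blast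

lemma zero: "i \<le> n \<Longrightarrow> \<phi> i 0 = 0"
  using odd[of i 0] by simp

text \<open>The differential inclusions for the \<open>\<phi> (i - 1) (u i)\<close> in integrated form; the \<open>u i\<close>
  themselves need not be differentiable. The factors \<open>1 / 2\<close> and \<open>4\<close> leave room for the disturbance.\<close>

definition trajectory :: "(nat \<Rightarrow> real) \<Rightarrow> ereal \<Rightarrow> (nat \<Rightarrow> real \<Rightarrow> real) \<Rightarrow> bool" where
  "trajectory K \<tau> u \<longleftrightarrow>
     (\<forall>i\<in>{1..n}. \<forall>t. ereal t < \<tau> \<longrightarrow> continuous_on {0..t} (u i)) \<and>
     (\<forall>t. u (n + 1) t = 0) \<and>
     (\<forall>i\<in>{1..n}. \<forall>s t m. 0 \<le> s \<longrightarrow> s \<le> t \<longrightarrow> ereal t < \<tau> \<longrightarrow>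
        (\<forall>r\<in>{s..t}. u (i + 1) r < u 1 r \<and> m \<le> \<phi> i (u 1 r) - \<phi> i (u (i + 1) r)) \<longrightarrow>
        \<phi> (i - 1) (u i t) + K i / 2 * m * (t - s) \<le> \<phi> (i - 1) (u i s)) \<and>
     (\<forall>i\<in>{1..n}. \<forall>s t m. 0 \<le> s \<longrightarrow> s \<le> t \<longrightarrow> ereal t < \<tau> \<longrightarrow>
        (\<forall>r\<in>{s..t}. u 1 r < u (i + 1) r \<and> m \<le> \<phi> i (u (i + 1) r) - \<phi> i (u 1 r)) \<longrightarrow>
        \<phi> (i - 1) (u i s) + K i / 2 * m * (t - s) \<le> \<phi> (i - 1) (u i t)) \<and>
     (\<forall>i\<in>{1..n}. \<forall>s t B. 0 \<le> s \<longrightarrow> s \<le> t \<longrightarrow> ereal t < \<tau> \<longrightarrow> 0 < B \<longrightarrow>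
        (\<forall>r\<in>{s..t}. \<bar>u 1 r\<bar> \<le> B \<and> \<bar>u (i + 1) r\<bar> \<le> B) \<longrightarrow>
        \<bar>\<phi> (i - 1) (u i t) - \<phi> (i - 1) (u i s)\<bar> \<le> 4 * K i * \<phi> i B * (t - s))"

lemma trajectory_continuous:
  assumes "trajectory K \<tau> u" "i \<in> {1..n + 1}" "ereal t < \<tau>" "0 \<le> s"
  shows "continuous_on {s..t} (u i)"
proof (cases "i = n + 1")
  case True
  then have "u i = (\<lambda>t. 0)" using assms by (auto simp: trajectory_def)
  then show ?thesis by simp
next
  case False
  then have "continuous_on {0..t} (u i)" using assms by (auto simp: trajectory_def)
  then show ?thesis using assms(4) by (auto intro: continuous_on_subset)
qed

lemma trajectory_gap_continuous:
  assumes "trajectory K \<tau> u" "i \<in> {1..n}" "ereal t < \<tau>" "0 \<le> s"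
  shows "continuous_on {s..t} (\<lambda>r. u i r - u (i + 1) r)"
proof -
  have "continuous_on {s..t} (u i)" "continuous_on {s..t} (u (i + 1))"
    using assms(2) by (auto intro!: trajectory_continuous[OF assms(1) _ assms(3,4)])
  then show ?thesis by (rule continuous_on_diff)
qed

lemma trajectory_descent:
  assumes "trajectory K \<tau> u" "i \<in> {1..n}" "0 \<le> s" "s \<le> t" "ereal t < \<tau>"
    and "\<And>r. s \<le> r \<Longrightarrow> r \<le> t \<Longrightarrow> u (i + 1) r < u 1 r"
    and "\<And>r. s \<le> r \<Longrightarrow> r \<le> t \<Longrightarrow> m \<le> \<phi> i (u 1 r) - \<phi> i (u (i + 1) r)"
  shows "\<phi> (i - 1) (u i t) + K i / 2 * m * (t - s) \<le> \<phi> (i - 1) (u i s)"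
proof -
  have "\<forall>r\<in>{s..t}. u (i + 1) r < u 1 r \<and> m \<le> \<phi> i (u 1 r) - \<phi> i (u (i + 1) r)"
    using assms(6,7) by simp
  with assms(2-5) show ?thesis
    by (intro assms(1)[unfolded trajectory_def, THEN conjunct2, THEN conjunct2, THEN conjunct1, rule_format])
       simp_all
qed

lemma trajectory_speed:
  assumes "trajectory K \<tau> u" "i \<in> {1..n}" "0 \<le> s" "s \<le> t" "ereal t < \<tau>" "0 < B"
    and "\<And>r. s \<le> r \<Longrightarrow> r \<le> t \<Longrightarrow> \<bar>u 1 r\<bar> \<le> B"
    and "\<And>r. s \<le> r \<Longrightarrow> r \<le> t \<Longrightarrow> \<bar>u (i + 1) r\<bar> \<le> B"
  shows "\<bar>\<phi> (i - 1) (u i t) - \<phi> (i - 1) (u i s)\<bar> \<le> 4 * K i * \<phi> i B * (t - s)"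
proof -
  have "\<forall>r\<in>{s..t}. \<bar>u 1 r\<bar> \<le> B \<and> \<bar>u (i + 1) r\<bar> \<le> B"
    using assms(7,8) by simp
  with assms(2-6) show ?thesis
    by (intro assms(1)[unfolded trajectory_def, THEN conjunct2, THEN conjunct2, THEN conjunct2, THEN conjunct2, rule_format])
       simp_all
qed

text \<open>By oddness it suffices to bound gaps from above. The ascent clause of
  \<open>trajectory\<close> becomes the descent clause of the reflected trajectory.\<close>

lemma trajectory_uminus:
  assumes "trajectory K \<tau> u"
  shows "trajectory K \<tau> (\<lambda>i t. - u i t)"
  unfolding trajectory_def
proof (intro conjI ballI allI impI)
  fix i t assume "i \<in> {1..n}" "ereal t < \<tau>"
  then show "continuous_on {0..t} (\<lambda>t. - u i t)"
    using assms by (intro continuous_intros) (auto simp: trajectory_def)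
next
  show "- u (n + 1) t = 0" for t using assms by (auto simp: trajectory_def)
next
  fix i s t m assume *: "i \<in> {1..n}" "0 \<le> s" "s \<le> t" "ereal t < \<tau>"
    "\<forall>r\<in>{s..t}. - u (i + 1) r < - u 1 r \<and> m \<le> \<phi> i (- u 1 r) - \<phi> i (- u (i + 1) r)"
  have "\<phi> (i - 1) (u i s) + K i / 2 * m * (t - s) \<le> \<phi> (i - 1) (u i t)"
    using assms * unfolding trajectory_def by (auto simp: odd)
  then show "\<phi> (i - 1) (- u i t) + K i / 2 * m * (t - s) \<le> \<phi> (i - 1) (- u i s)"
    using * by (subst (1 2) odd) auto
next
  fix i s t m assume *: "i \<in> {1..n}" "0 \<le> s" "s \<le> t" "ereal t < \<tau>"
    "\<forall>r\<in>{s..t}. - u 1 r < - u (i + 1) r \<and> m \<le> \<phi> i (- u (i + 1) r) - \<phi> i (- u 1 r)"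
  have "\<phi> (i - 1) (u i t) + K i / 2 * m * (t - s) \<le> \<phi> (i - 1) (u i s)"
    using assms * unfolding trajectory_def by (auto simp: odd)
  then show "\<phi> (i - 1) (- u i s) + K i / 2 * m * (t - s) \<le> \<phi> (i - 1) (- u i t)"
    using * by (subst (1 2) odd) auto
next
  fix i s t B assume *: "i \<in> {1..n}" "0 \<le> s" "s \<le> t" "ereal t < \<tau>" "0 < B"
    "\<forall>r\<in>{s..t}. \<bar>- u 1 r\<bar> \<le> B \<and> \<bar>- u (i + 1) r\<bar> \<le> B"
  have "\<bar>\<phi> (i - 1) (u i t) - \<phi> (i - 1) (u i s)\<bar> \<le> 4 * K i * \<phi> i B * (t - s)"
    using assms * unfolding trajectory_def by auto
  then show "\<bar>\<phi> (i - 1) (- u i t) - \<phi> (i - 1) (- u i s)\<bar> \<le> 4 * K i * \<phi> i B * (t - s)"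
    using * by (subst (1 2) odd) auto
qed

text \<open>The weights grow so fast that the gaps of index below \<open>i\<close> add up to less than half of
  the smallest gap \<open>32 ^ i / 8 * l\<close> at which the descent of \<open>u i\<close> is used.\<close>

definition in_box :: "(nat \<Rightarrow> real \<Rightarrow> real) \<Rightarrow> real \<Rightarrow> real \<Rightarrow> bool" where
  "in_box u l t \<longleftrightarrow> (\<forall>i\<in>{1..n}. \<bar>u i t - u (i + 1) t\<bar> \<le> 32 ^ i * l)"

text \<open>A bound, in units of the scale, for every coordinate of a state in the box:
  \<open>u 1\<close> and \<open>u 1 - u i\<close> each contribute at most
  \<open>32 ^ (n + 1) / 16\<close>, as \<open>u (n + 1) = 0\<close>.\<close>

definition radius :: real where "radius = 32 ^ (n + 1)"

lemma radius_pos: "0 < radius" by (simp add: radius_def)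

lemma in_box_uminus: "in_box (\<lambda>i t. - u i t) l t \<longleftrightarrow> in_box u l t"
  by (simp add: in_box_def abs_minus_commute)

text \<open>\<open>u 1 - u i\<close> telescopes into the gaps of index below \<open>i\<close>; the
  induction closes because 1/16 + 1 <= 32/16.\<close>

lemma in_box_first:
  assumes "in_box u l t" "0 \<le> l" "i \<in> {1..n + 1}"
  shows "\<bar>u 1 t - u i t\<bar> \<le> 32 ^ i / 16 * l"
proof -
  have "1 \<le> i" using assms(3) by simp
  then have "i \<le> n + 1 \<Longrightarrow> \<bar>u 1 t - u i t\<bar> \<le> 32 ^ i / 16 * l"
  proof (induction i rule: dec_induct)
    case base then show ?case using assms(2) by simp
  next
    case (step i)
    then have "\<bar>u 1 t - u i t\<bar> \<le> 32 ^ i / 16 * l" by simp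
    moreover have "\<bar>u i t - u (Suc i) t\<bar> \<le> 32 ^ i * l" using assms step by (auto simp: in_box_def)
    moreover have "32 ^ i / 16 * l + 32 ^ i * l \<le> 32 ^ Suc i / 16 * l"
      using assms(2) by (simp add: field_simps)
    ultimately show ?case by linarith
  qed
  then show ?thesis using assms(3) by simp
qed

lemma in_box_bound:
  assumes "in_box u l t" "0 \<le> l" "i \<in> {1..n + 1}" "u (n + 1) t = 0"
  shows "\<bar>u i t\<bar> \<le> radius * l"
proof -
  have "\<bar>u 1 t - u i t\<bar> \<le> 32 ^ i / 16 * l" "\<bar>u 1 t\<bar> \<le> 32 ^ (n + 1) / 16 * l"
    using in_box_first[OF assms(1,2), of i] in_box_first[OF assms(1,2), of "n + 1"] assms by auto
  moreover have "(32::real) ^ i / 16 * l \<le> 32 ^ (n + 1) / 16 * l"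
    using assms by (intro mult_right_mono divide_right_mono power_increasing) auto
  moreover have "(32::real) ^ (n + 1) * l \<ge> 0" "32 ^ (n + 1) / 16 * l = (32 ^ (n + 1) * l) / 16" using assms by auto
  ultimately show ?thesis unfolding radius_def by linarith
qed

text \<open>Range over speed: at scale \<open>l\<close> the quantity
  \<open>\<phi> (i - 1) (u i)\<close> ranges over an interval of length of order
  \<open>\<phi> (i - 1) l\<close> and moves at a rate of order at least
  \<open>\<phi> i l\<close>.\<close>

definition scale_time :: "real \<Rightarrow> real" where
  "scale_time l = (\<Sum>i=1..n. \<phi> (i - 1) l / \<phi> i l)"

lemma scale_time_nonneg: "0 < l \<Longrightarrow> 0 \<le> scale_time l"
  unfolding scale_time_def by (intro sum_nonneg divide_nonneg_pos pos less_imp_le[OF pos]) auto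

end

text \<open>The constants made uniform in the index. The step \<open>2 * s\<close> is the smallest
  surplus \<open>32 ^ i / 16 * s\<close> with \<open>i\<close> at least 1; in \<open>c_last\<close>
  it starts at 0, because \<open>u (n + 1) = 0\<close>.\<close>

locale injection_chain_constants = injection_chain +
  fixes c C D :: real
  assumes c_pos: "0 < c" and C_pos: "0 < C" and D_pos: "0 < D"
    and c: "\<And>i s v. i < n \<Longrightarrow> 0 < s \<Longrightarrow> \<bar>v\<bar> \<le> radius * s \<Longrightarrow> \<phi> i v + c * \<phi> i s \<le> \<phi> i (v + 2 * s)"
    and c_last: "\<And>s. 0 < s \<Longrightarrow> c * \<phi> n s \<le> \<phi> n (2 * s)"
    and C: "\<And>i s. i \<le> n \<Longrightarrow> 0 < s \<Longrightarrow> \<phi> i (radius * s) \<le> C * \<phi> i s"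
    and D: "\<And>i s. i \<in> {1..<n} \<Longrightarrow> 0 < s \<Longrightarrow> \<phi> (i + 1) s * \<phi> (i - 1) s \<le> D * (\<phi> i s)\<^sup>2"
begin

text \<open>Just above the value \<open>16 * C^2 * D / c^2\<close> at which the two time bounds in
  \<open>crossing\<close> become contradictory.\<close>

definition gain_ratio :: real where "gain_ratio = 1 + 16 * C\<^sup>2 * D / c\<^sup>2"
text \<open>Descent at rate at least \<open>c * \<phi> i l / 2\<close> exhausts the range
  \<open>2 * C * \<phi> (i - 1) l\<close> within \<open>4 * C / c\<close> units of time; 5 makes the
  excess strict.\<close>

definition time_factor :: real where "time_factor = 5 * C / c"

lemma time_factor_pos: "0 < time_factor" using c_pos C_pos by (simp add: time_factor_def)

lemma increment_step:
  assumes "i \<in> {1..n}" "0 < l" "\<bar>v\<bar> \<le> radius * l" "i = n \<Longrightarrow> v = 0" "v + 32 ^ i / 16 * l \<le> w"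
  shows "\<phi> i v + c * \<phi> i l \<le> \<phi> i w"
proof -
  have "(32::real) ^ 1 \<le> 32 ^ i" using assms(1) by (intro power_increasing) auto
  then have "(2::real) * l \<le> 32 ^ i / 16 * l" using \<open>0 < l\<close> by (intro mult_right_mono) auto
  then have "v + 2 * l \<le> w" using assms(5) by linarith
  then have "\<phi> i (v + 2 * l) \<le> \<phi> i w" using assms(1) by (intro monoD) auto
  moreover have "\<phi> i v + c * \<phi> i l \<le> \<phi> i (v + 2 * l)"
    using c[of i l v] c_last[of l] zero[of n] assms by (cases "i = n") auto
  ultimately show ?thesis by simp
qed

section \<open>Motion inside the box at a fixed scale\<close>

context
  fixes K :: "nat \<Rightarrow> real" and \<tau> :: ereal and l :: real
  assumes K_ge: "\<And>i. i \<in> {1..n} \<Longrightarrow> 1 \<le> K i"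
    and K_ratio: "\<And>i. i \<in> {1..<n} \<Longrightarrow> gain_ratio * K (i + 1) \<le> K i"
    and l_pos: "0 < l"
begin

text \<open>By \<open>in_box_first\<close>, \<open>u 1\<close> differs from \<open>u i\<close> by at
  most half of the assumed gap, so it exceeds \<open>u (i + 1)\<close> by the other half. This
  surplus turns into the rate \<open>c * \<phi> i l\<close>.\<close>

lemma box_descent:
  assumes u: "trajectory K \<tau> u" and i: "i \<in> {1..n}" and st: "0 \<le> s" "s \<le> t" "ereal t < \<tau>"
    and box: "\<And>r. s \<le> r \<Longrightarrow> r \<le> t \<Longrightarrow> in_box u l r"
    and gap: "\<And>r. s \<le> r \<Longrightarrow> r \<le> t \<Longrightarrow> 32 ^ i / 8 * l \<le> u i r - u (i + 1) r"
  shows "\<phi> (i - 1) (u i t) + K i / 2 * (c * \<phi> i l) * (t - s) \<le> \<phi> (i - 1) (u i s)"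
proof (rule trajectory_descent[OF u i st])
  fix r assume r: "s \<le> r" "r \<le> t"
  have "\<bar>u 1 r - u i r\<bar> \<le> 32 ^ i / 16 * l"
    using box[OF r] l_pos i by (intro in_box_first) auto
  moreover have "32 ^ i / 8 * l = 32 ^ i / 16 * l + 32 ^ i / 16 * l" by simp
  ultimately have *: "u (i + 1) r + 32 ^ i / 16 * l \<le> u 1 r" using gap[OF r] by linarith
  moreover have "(32::real) ^ i / 16 * l > 0" using l_pos by simp
  ultimately show "u (i + 1) r < u 1 r" by linarith
  have z: "u (n + 1) r = 0" using u by (auto simp: trajectory_def)
  have "\<bar>u (i + 1) r\<bar> \<le> radius * l"
    using box[OF r] l_pos i z by (intro in_box_bound) auto
  with increment_step[OF i l_pos _ _ *] z
  show "c * \<phi> i l \<le> \<phi> i (u 1 r) - \<phi> i (u (i + 1) r)" by auto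
qed

lemma box_range:
  assumes u: "trajectory K \<tau> u" and i: "i \<in> {1..n}" and "in_box u l s" "in_box u l t"
  shows "\<phi> (i - 1) (u i s) - \<phi> (i - 1) (u i t) \<le> 2 * C * \<phi> (i - 1) l"
proof -
  have "u (n + 1) r = 0" for r using u by (auto simp: trajectory_def)
  then have "\<bar>u i s\<bar> \<le> radius * l" "\<bar>u i t\<bar> \<le> radius * l"
    using assms(2-4) l_pos by (auto intro!: in_box_bound[of u])
  then have "\<phi> (i - 1) (u i s) \<le> \<phi> (i - 1) (radius * l)"
    "\<phi> (i - 1) (- (radius * l)) \<le> \<phi> (i - 1) (u i t)"
    using i by (auto intro!: monoD)
  moreover have "\<phi> (i - 1) (radius * l) \<le> C * \<phi> (i - 1) l" using i l_pos by (intro C) auto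
  ultimately show ?thesis using odd[of "i - 1" "radius * l"] i by auto
qed

text \<open>Let \<open>h\<close> be the time from the last moment with gap \<open>b * l\<close>. The
  speed of \<open>u (i + 1)\<close> gives \<open>c * \<phi> i l \<le> 4 * K (i + 1) * C * \<phi> (i
  + 1) l * h\<close>, and the range of \<open>u i\<close> gives
  \<open>K i / 2 * c * \<phi> i l * h \<le> 2 * C * \<phi> (i - 1) l\<close>. Eliminating
  \<open>h\<close> contradicts \<open>gain_ratio\<close> by log-concavity.\<close>

lemma crossing:
  assumes u: "trajectory K \<tau> u" and i: "i \<in> {1..n}" and st: "0 \<le> s" "s \<le> t" "ereal t < \<tau>"
    and box: "\<And>r. s \<le> r \<Longrightarrow> r \<le> t \<Longrightarrow> in_box u l r"
    and b: "32 ^ i / 8 \<le> b" and gs: "u i s - u (i + 1) s \<le> b * l"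
  shows "u i t - u (i + 1) t < 2 * b * l"
proof (rule ccontr)
  assume "\<not> ?thesis"
  then have gt: "2 * b * l \<le> u i t - u (i + 1) t" by simp
  have bl: "(32::real) ^ i / 8 * l \<le> b * l" "0 < b * l"
  proof -
    show "(32::real) ^ i / 8 * l \<le> b * l" using b l_pos by simp
    have "(0::real) < 32 ^ i / 8" by simp
    then show "0 < b * l" using b l_pos by (intro mult_pos_pos) linarith+
  qed
  have "continuous_on {s..t} (\<lambda>r. u i r - u (i + 1) r)"
    using trajectory_gap_continuous[OF u i st(3,1)] .
  then obtain s' where s': "s \<le> s'" "s' \<le> t" "u i s' - u (i + 1) s' = b * l"
    "\<And>q. s' \<le> q \<Longrightarrow> q \<le> t \<Longrightarrow> b * l \<le> u i q - u (i + 1) q"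
  proof (rule last_crossing[OF st(2)])
    show "b * l \<le> u i t - u (i + 1) t" using gt bl(2) by linarith
  qed (use gs in auto)
  have desc: "\<phi> (i - 1) (u i t) + K i / 2 * (c * \<phi> i l) * (t - s') \<le> \<phi> (i - 1) (u i s')"
  proof (rule box_descent[OF u i _ s'(2) st(3)])
    show "32 ^ i / 8 * l \<le> u i r - u (i + 1) r" if "s' \<le> r" "r \<le> t" for r
      using s'(4)[OF that] bl(1) by linarith
  qed (use st s' box in auto)
  have Kpos: "K j > 0" if "j \<in> {1..n}" for j using K_ge[OF that] by linarith
  have nonneg: "0 \<le> K i / 2 * (c * \<phi> i l) * (t - s')"
    using Kpos[OF i] c_pos pos[of i l] l_pos i s' by (intro mult_nonneg_nonneg) auto
  have "u i t \<le> u i s'"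
  proof (rule ccontr)
    assume "\<not> ?thesis"
    then have "\<phi> (i - 1) (u i s') < \<phi> (i - 1) (u i t)"
      using strict_mono[of "i - 1"] i by (intro strict_monoD[of "\<phi> (i - 1)"]) auto
    then show False using desc nonneg by linarith
  qed
  \<comment> \<open>Since \<open>u i\<close> has not increased, the whole growth of the gap is a
    displacement of \<open>u (i + 1)\<close>. For \<open>i = n\<close> that is already absurd, as
    \<open>u (n + 1)\<close> is constant.\<close>
  then have drop: "u (i + 1) t + b * l \<le> u (i + 1) s'" using s'(3) gt by simp
  have z: "u (n + 1) r = 0" for r using u by (auto simp: trajectory_def)
  show False
  proof (cases "i = n")
    case True then show False using drop z bl by simp
  next
    case False
    then have i': "i \<in> {1..<n}" using i by auto
    have "\<bar>u (i + 1) t\<bar> \<le> radius * l"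
      using box[of t] l_pos i z st by (intro in_box_bound) auto
    moreover have "u (i + 1) t + 32 ^ i / 16 * l \<le> u (i + 1) s'" 
    proof -
      have "(32::real) ^ i / 8 * l = 2 * (32 ^ i / 16 * l)" "0 < 32 ^ i / 16 * l" using l_pos by auto
      then show ?thesis using drop bl(1) by linarith
    qed
    ultimately have "c * \<phi> i l \<le> \<phi> i (u (i + 1) s') - \<phi> i (u (i + 1) t)"
      using increment_step[OF i l_pos, of "u (i + 1) t" "u (i + 1) s'"] False by simp
    also have "\<dots> \<le> \<bar>\<phi> (i + 1 - 1) (u (i + 1) t) - \<phi> (i + 1 - 1) (u (i + 1) s')\<bar>" by simp
    also have "\<dots> \<le> 4 * K (i + 1) * \<phi> (i + 1) (radius * l) * (t - s')"
    proof (rule trajectory_speed[OF u])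
      show "\<bar>u 1 r\<bar> \<le> radius * l" "\<bar>u (i + 1 + 1) r\<bar> \<le> radius * l" if "s' \<le> r" "r \<le> t" for r
        using box[of r] l_pos i' z that s' by (auto intro!: in_box_bound[of u])
    qed (use i' st s' radius_pos l_pos in auto)
    also have "\<dots> \<le> 4 * K (i + 1) * (C * \<phi> (i + 1) l) * (t - s')"
      using C[of "i + 1" l] Kpos[of "i + 1"] i' l_pos s' by (intro mult_right_mono mult_left_mono) auto
    finally have 1: "c * \<phi> i l \<le> 4 * K (i + 1) * (C * \<phi> (i + 1) l) * (t - s')" .
    have 2: "K i / 2 * (c * \<phi> i l) * (t - s') \<le> 2 * C * \<phi> (i - 1) l"
        using desc box_range[OF u i box[OF s'(1,2)] box[OF st(2) order_refl]] by linarith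
    let ?p = "\<phi> i l" and ?m = "\<phi> (i - 1) l" and ?q = "\<phi> (i + 1) l" and ?h = "t - s'"
    have P: "?p > 0" "?m > 0" "?q > 0" using pos i' l_pos by auto
    \<comment> \<open>The first bound is multiplied by \<open>K i * (c * ?p)\<close> so that its
      right-hand side contains the left-hand side of the second one as a factor; this eliminates
      \<open>?h\<close>.\<close>
    have "c * ?p * (K i * (c * ?p)) \<le> 4 * K (i + 1) * (C * ?q) * ?h * (K i * (c * ?p))"
      using 1 P c_pos Kpos[OF i] by (intro mult_right_mono) auto
    also have "\<dots> = 8 * K (i + 1) * C * ?q * (K i / 2 * (c * ?p) * ?h)" by (simp add: field_simps)
    also have "\<dots> \<le> 8 * K (i + 1) * C * ?q * (2 * C * ?m)"
      using 2 P C_pos Kpos[of "i + 1"] i' by (intro mult_left_mono mult_nonneg_nonneg) auto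
    also have "\<dots> = 16 * K (i + 1) * C\<^sup>2 * (?q * ?m)" by (simp add: power2_eq_square field_simps)
    also have "\<dots> \<le> 16 * K (i + 1) * C\<^sup>2 * (D * ?p\<^sup>2)"
      using D[OF i' l_pos] Kpos[of "i + 1"] i' by (intro mult_left_mono) auto
    finally have "K i * (c\<^sup>2 * ?p\<^sup>2) \<le> (16 * C\<^sup>2 * D) * K (i + 1) * ?p\<^sup>2"
      by (simp add: power2_eq_square field_simps)
    then have "K i * c\<^sup>2 \<le> (16 * C\<^sup>2 * D) * K (i + 1)" using P by simp
    moreover have "(16 * C\<^sup>2 * D) * K (i + 1) < gain_ratio * K (i + 1) * c\<^sup>2"
      using c_pos Kpos[of "i + 1"] i' by (simp add: gain_ratio_def field_simps)
    moreover have "gain_ratio * K (i + 1) * c\<^sup>2 \<le> K i * c\<^sup>2" using K_ratio[OF i'] by (intro mult_right_mono) auto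
    ultimately show False by simp
  qed
qed

lemma crossing_abs:
  assumes u: "trajectory K \<tau> u" and i: "i \<in> {1..n}" and st: "0 \<le> s" "s \<le> t" "ereal t < \<tau>"
    and box: "\<And>r. s \<le> r \<Longrightarrow> r \<le> t \<Longrightarrow> in_box u l r"
    and b: "32 ^ i / 8 \<le> b" and gs: "\<bar>u i s - u (i + 1) s\<bar> \<le> b * l"
  shows "\<bar>u i t - u (i + 1) t\<bar> < 2 * b * l"
proof -
  have "u i t - u (i + 1) t < 2 * b * l" using crossing[OF u i st box b] gs by simp
  moreover have "(- u i t) - (- u (i + 1) t) < 2 * b * l"
    using crossing[OF trajectory_uminus[OF u] i st _ b] gs box by (simp add: in_box_uminus)
  ultimately show ?thesis by simp
qed

text \<open>Stop at the first time at which some gap reaches its full weight. Up to then the state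
  is in the box, so \<open>crossing_abs\<close> with half the weight shows that this gap is still
  strictly smaller.\<close>

lemma box_invariant:
  assumes u: "trajectory K \<tau> u" and st: "0 \<le> s" "s \<le> t" "ereal t < \<tau>" and start: "in_box u (l / 2) s"
  shows "in_box u l t"
proof (rule ccontr)
  assume neg: "\<not> in_box u l t"
  define g where "g i r = \<bar>u i r - u (i + 1) r\<bar>" for i r
  have cont: "continuous_on {s..t} (g i)" if "i \<in> {1..n}" for i
    unfolding g_def using trajectory_gap_continuous[OF u that st(3,1)] by (rule continuous_on_rabs)
  define S where "S = (\<Union>i\<in>{1..n}. {r \<in> {s..t}. 32 ^ i * l \<le> g i r})"
  have "closed {r \<in> {s..t}. 32 ^ i * l \<le> g i r}" if "i \<in> {1..n}" for i
    by (rule continuous_on_closed_Collect_le[OF continuous_on_const cont[OF that]]) simp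
  then have "closed S" unfolding S_def by (intro closed_UN finite_atLeastAtMost ballI)
  moreover have "bounded S" by (rule bounded_subset[of "{s..t}"]) (auto simp: S_def)
  ultimately have "compact S" by (simp add: compact_eq_bounded_closed)
  moreover have "S \<noteq> {}"
  proof -
    obtain i where "i \<in> {1..n}" "32 ^ i * l < g i t"
      using neg by (auto simp: in_box_def g_def not_le)
    then have "t \<in> {r \<in> {s..t}. 32 ^ i * l \<le> g i r}" using st by simp
    with \<open>i \<in> {1..n}\<close> show ?thesis unfolding S_def by blast
  qed
  ultimately obtain t0 where t0: "t0 \<in> S" "\<And>r. r \<in> S \<Longrightarrow> t0 \<le> r" using compact_attains_inf by metis
  then obtain i where i: "i \<in> {1..n}" "s \<le> t0" "t0 \<le> t" "32 ^ i * l \<le> g i t0" by (auto simp: S_def)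
  have before: "g j r < 32 ^ j * l" if "s \<le> r" "r < t0" "j \<in> {1..n}" for j r
  proof (rule ccontr)
    assume "\<not> ?thesis"
    then have "r \<in> {r \<in> {s..t}. 32 ^ j * l \<le> g j r}" using that i by simp
    then have "r \<in> S" using that(3) unfolding S_def by blast
    then show False using t0(2)[of r] that by linarith
  qed
  have gs: "g j s \<le> 32 ^ j * l / 2" if "j \<in> {1..n}" for j
    using start that by (auto simp: in_box_def g_def)
  \<comment> \<open>\<open>crossing_abs\<close> needs the box at \<open>t0\<close> itself, where
    only the gaps before \<open>t0\<close> are controlled: a gap beyond its weight would have
    equalled it earlier, by continuity.\<close>
  have box: "in_box u l r" if "s \<le> r" "r \<le> t0" for r
    unfolding in_box_def
  proof (intro ballI, rule ccontr)
    fix j assume j: "j \<in> {1..n}" "\<not> \<bar>u j r - u (j + 1) r\<bar> \<le> 32 ^ j * l"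
    then have "32 ^ j * l < g j r" by (simp add: g_def)
    moreover have "g j s < 32 ^ j * l"
    proof -
      have "(0::real) < 32 ^ j * l" using l_pos by simp
      then show ?thesis using gs[OF j(1)] by linarith
    qed
    moreover have "continuous_on {s..r} (g j)"
      using cont[OF j(1)] that i by (auto intro: continuous_on_subset)
    ultimately have "\<exists>q\<ge>s. q \<le> r \<and> g j q = 32 ^ j * l"
      using that by (intro IVT') auto
    then obtain q where q: "s \<le> q" "q \<le> r" "g j q = 32 ^ j * l" by blast
    moreover have "q \<noteq> r" using \<open>32 ^ j * l < g j r\<close> q(3) by auto
    ultimately have "g j q < 32 ^ j * l" using before[of q j] j(1) that by simp
    then show False using q(3) by simp
  qed
  have "ereal t0 < \<tau>" using i(3) st(3) by (meson ereal_less_eq(3) le_less_trans)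
  then have "\<bar>u i t0 - u (i + 1) t0\<bar> < 2 * (32 ^ i / 2) * l"
    using gs[OF i(1)] by (intro crossing_abs[OF u i(1) st(1) i(2) _ box]) (auto simp: g_def)
  then show False using i(4) by (simp add: g_def)
qed

text \<open>Otherwise the descent during the whole time would be at least
  \<open>5 / 2 * C * \<phi> (i - 1) l\<close>, more than the range
  \<open>2 * C * \<phi> (i - 1) l\<close> of the box.\<close>

lemma box_gap_reached:
  assumes u: "trajectory K \<tau> u" and i: "i \<in> {1..n}" and st: "0 \<le> s" "ereal t < \<tau>"
    and box: "\<And>r. s \<le> r \<Longrightarrow> r \<le> t \<Longrightarrow> in_box u l r"
    and t: "s + time_factor * scale_time l \<le> t"
  shows "\<exists>r\<ge>s. r \<le> t \<and> u i r - u (i + 1) r \<le> 32 ^ i / 8 * l"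
proof (rule ccontr)
  assume "\<not> ?thesis"
  then have gap: "\<And>r. s \<le> r \<Longrightarrow> r \<le> t \<Longrightarrow> 32 ^ i / 8 * l \<le> u i r - u (i + 1) r"
    by (meson linorder_le_cases)
  have P: "\<phi> i l > 0" "\<phi> (i - 1) l > 0" using pos i l_pos by auto
  have nn: "0 \<le> \<phi> (j - 1) l / \<phi> j l" if "j \<in> {1..n}" for j
    using that l_pos less_imp_le[OF pos[of "j - 1" l]] less_imp_le[OF pos[of j l]] by auto
  have "\<phi> (i - 1) l / \<phi> i l \<le> scale_time l"
    unfolding scale_time_def by (rule member_le_sum[OF i]) (use nn in auto)
  then have "time_factor * (\<phi> (i - 1) l / \<phi> i l) \<le> time_factor * scale_time l"
    using time_factor_pos by (intro mult_left_mono) auto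
  then have ts: "time_factor * (\<phi> (i - 1) l / \<phi> i l) \<le> t - s" using t by simp
  moreover have "0 \<le> time_factor * (\<phi> (i - 1) l / \<phi> i l)" using P time_factor_pos by simp
  ultimately have "s \<le> t" by simp
  have "K i / 2 * (c * \<phi> i l) * (t - s) \<le> 2 * C * \<phi> (i - 1) l"
    using box_descent[OF u i st(1) \<open>s \<le> t\<close> st(2) box gap]
      box_range[OF u i box[OF order_refl \<open>s \<le> t\<close>] box[OF \<open>s \<le> t\<close> order_refl]] by linarith
  moreover have "1 / 2 * (c * \<phi> i l) * (time_factor * (\<phi> (i - 1) l / \<phi> i l)) \<le> K i / 2 * (c * \<phi> i l) * (t - s)"
    using K_ge[OF i] P c_pos ts time_factor_pos by (intro mult_mono mult_right_mono) auto
  moreover have "1 / 2 * (c * \<phi> i l) * (time_factor * (\<phi> (i - 1) l / \<phi> i l)) = 5 / 2 * C * \<phi> (i - 1) l"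
    using P c_pos by (simp add: time_factor_def)
  moreover have "C * \<phi> (i - 1) l > 0" using C_pos P by simp
  ultimately show False by linarith
qed

text \<open>Each gap falls to 1/8 of its weight at a time of its own and remains below twice that
  level by \<open>crossing\<close>, so at time \<open>t\<close> all of them are below a
  quarter.\<close>

lemma box_contraction:
  assumes u: "trajectory K \<tau> u" and st: "0 \<le> s" "ereal t < \<tau>" and start: "in_box u (l / 2) s"
    and t: "s + time_factor * scale_time l \<le> t"
  shows "in_box u (l / 4) t"
  unfolding in_box_def
proof
  fix i assume i: "i \<in> {1..n}"
  have box: "in_box u l r" if "s \<le> r" "r \<le> t" for r
  proof (rule box_invariant[OF u st(1) that(1) _ start])
    show "ereal r < \<tau>" using that(2) st(2) by (meson ereal_less_eq(3) le_less_trans)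
  qed
  have *: "v i t - v (i + 1) t \<le> 32 ^ i * (l / 4)"
    if v: "trajectory K \<tau> v" and box: "\<And>r. s \<le> r \<Longrightarrow> r \<le> t \<Longrightarrow> in_box v l r" for v
  proof -
    obtain r where r: "s \<le> r" "r \<le> t" "v i r - v (i + 1) r \<le> 32 ^ i / 8 * l"
      using box_gap_reached[OF v i st box t] by auto
    have "v i t - v (i + 1) t < 2 * (32 ^ i / 8) * l"
      by (rule crossing[OF v i _ r(2) st(2) _ _ r(3)]) (use r st box in auto)
    then show ?thesis by simp
  qed
  have "u i t - u (i + 1) t \<le> 32 ^ i * (l / 4)" using *[OF u box] by blast
  moreover have "(- u i t) - (- u (i + 1) t) \<le> 32 ^ i * (l / 4)"
    using *[OF trajectory_uminus[OF u]] box by (simp add: in_box_uminus)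
  ultimately show "\<bar>u i t - u (i + 1) t\<bar> \<le> 32 ^ i * (l / 4)" by linarith
qed

end

text \<open>A quarter of one scale is half of the next, which is what the next round starts from.
  The solution is not assumed to be global; already \<open>j = 0\<close>, with waiting time 0,
  bounds it on its whole interval of existence.\<close>

lemma box_iterate:
  assumes K: "\<And>i. i \<in> {1..n} \<Longrightarrow> 1 \<le> K i" "\<And>i. i \<in> {1..<n} \<Longrightarrow> gain_ratio * K (i + 1) \<le> K i"
    and u: "trajectory K \<tau> u" and l: "0 < l" and start: "in_box u (l / 2) 0"
    and t: "ereal t < \<tau>" "time_factor * (\<Sum>m<j. scale_time (l / 2 ^ m)) \<le> t"
  shows "in_box u (l / 2 ^ j) t"
proof -
  define S where "S j = time_factor * (\<Sum>m<j. scale_time (l / 2 ^ m))" for j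
  have S_nonneg: "0 \<le> S j" for j
    unfolding S_def using time_factor_pos l
    by (intro mult_nonneg_nonneg sum_nonneg scale_time_nonneg) auto
  have "in_box u (l / 2 ^ j / 2) (S j)" if "ereal (S j) < \<tau>" for j
    using that
  proof (induction j)
    case 0
    then show ?case using start by (simp add: S_def)
  next
    case (Suc j)
    have "S (Suc j) = S j + time_factor * scale_time (l / 2 ^ j)" by (simp add: S_def algebra_simps)
    moreover have "0 \<le> time_factor * scale_time (l / 2 ^ j)"
      using time_factor_pos l scale_time_nonneg by simp
    ultimately have le: "S j \<le> S (Suc j)" "S j + time_factor * scale_time (l / 2 ^ j) \<le> S (Suc j)" by auto
    then have "ereal (S j) < \<tau>" using Suc.prems by (meson ereal_less_eq(3) le_less_trans)
    then have "in_box u (l / 2 ^ j / 2) (S j)" by (rule Suc.IH)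
    then have "in_box u (l / 2 ^ j / 4) (S (Suc j))"
      by (intro box_contraction[OF K _ u S_nonneg Suc.prems _ le(2)]) (use l in auto)
    then show ?case by (simp add: mult.commute)
  qed
  moreover have "ereal (S j) < \<tau>" using t by (metis S_def ereal_less_eq(3) le_less_trans)
  ultimately have start_j: "in_box u (l / 2 ^ j / 2) (S j)" by blast
  have "S j \<le> t" using t(2) by (simp add: S_def)
  then show ?thesis
    by (intro box_invariant[OF K _ u S_nonneg _ t(1) start_j]) (use l in auto)
qed

end

lemma (in injection_chain) constants_exist:
  obtains c C D where "injection_chain_constants n \<phi> c C D"
proof -
  have "\<exists>c>0. \<forall>s>0. \<forall>v. \<bar>v\<bar> \<le> radius * s \<longrightarrow> \<phi> i v + c * \<phi> i s \<le> \<phi> i (v + 2 * s)" if "i < n" for i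
    using increment[OF that radius_pos] by simp
  then obtain c where c: "\<And>i. i < n \<Longrightarrow> c i > 0"
    "\<And>i s v. i < n \<Longrightarrow> 0 < s \<Longrightarrow> \<bar>v\<bar> \<le> radius * s \<Longrightarrow> \<phi> i v + c i * \<phi> i s \<le> \<phi> i (v + 2 * s)"
    by metis
  have "\<exists>C>0. \<forall>s>0. \<phi> i (radius * s) \<le> C * \<phi> i s" if "i \<le> n" for i
    using doubling[OF that radius_pos] .
  then obtain C where C: "\<And>i. i \<le> n \<Longrightarrow> C i > 0"
    "\<And>i s. i \<le> n \<Longrightarrow> 0 < s \<Longrightarrow> \<phi> i (radius * s) \<le> C i * \<phi> i s"
    by metis
  obtain D where D: "D > 0" "\<And>i s. i \<in> {1..<n} \<Longrightarrow> s > 0 \<Longrightarrow> \<phi> (i + 1) s * \<phi> (i - 1) s \<le> D * (\<phi> i s)\<^sup>2"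
    using log_concave by blast
  \<comment> \<open>The element 1 ensures \<open>c0 \<le> 1\<close>, so the bound for the last map
    follows from its monotonicity alone.\<close>
  define c0 where "c0 = Min (insert 1 (c ` {..<n}))"
  define C0 where "C0 = Max (C ` {..n})"
  have c0: "0 < c0" "c0 \<le> 1" "\<And>i. i < n \<Longrightarrow> c0 \<le> c i"
    unfolding c0_def using c(1) by (auto simp: Min_gr_iff)
  have C0: "\<And>i. i \<le> n \<Longrightarrow> C i \<le> C0" unfolding C0_def by auto
  have "injection_chain_constants n \<phi> c0 C0 D"
  proof
    show "0 < c0" "0 < D" using c0 D by auto
    show "0 < C0" using C(1)[of 0] C0[of 0] by simp
    show "\<phi> i v + c0 * \<phi> i s \<le> \<phi> i (v + 2 * s)" if "i < n" "0 < s" "\<bar>v\<bar> \<le> radius * s" for i s v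
    proof -
      have "c0 * \<phi> i s \<le> c i * \<phi> i s" using that c0(3) pos[of i s] by (intro mult_right_mono) auto
      then show ?thesis using c(2)[OF that] by simp
    qed
    show "c0 * \<phi> n s \<le> \<phi> n (2 * s)" if "0 < s" for s
    proof -
      have "c0 * \<phi> n s \<le> 1 * \<phi> n s" using that c0 pos[of n s] by (intro mult_right_mono) auto
      also have "\<dots> \<le> \<phi> n (2 * s)" using that by (auto intro: monoD)
      finally show ?thesis .
    qed
    show "\<phi> i (radius * s) \<le> C0 * \<phi> i s" if "i \<le> n" "0 < s" for i s
    proof -
      have "C i * \<phi> i s \<le> C0 * \<phi> i s" using that C0 pos[of i s] by (intro mult_right_mono) auto
      then show ?thesis using C(2)[OF that] by simp
    qed
    show "\<phi> (i + 1) s * \<phi> (i - 1) s \<le> D * (\<phi> i s)\<^sup>2" if "i \<in> {1..<n}" "0 < s" for i s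
      using D(2)[OF that] .
  qed
  then show ?thesis by (rule that)
qed

section \<open>Sums of two signed powers\<close>

text \<open>A single-valued selection from \<open>spow\<close>. The two differ only at base 0 and
  exponent 0, where the value 0 is selected from \<open>[-1, 1]\<close>.\<close>

definition signed_powr :: "real \<Rightarrow> real \<Rightarrow> real" where
  "signed_powr z p = \<bar>z\<bar> powr p * sgn z"

lemma signed_powr_0 [simp]: "signed_powr 0 p = 0"
  by (simp add: signed_powr_def)

lemma signed_powr_pos_eq: "0 < z \<Longrightarrow> signed_powr z p = z powr p"
  by (simp add: signed_powr_def)

lemma signed_powr_minus: "signed_powr (- z) p = - signed_powr z p"
  by (simp add: signed_powr_def sgn_minus)

lemma signed_powr_mult: "0 < c \<Longrightarrow> signed_powr (c * z) p = c powr p * signed_powr z p"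
  by (simp add: signed_powr_def abs_mult powr_mult sgn_mult)

lemma signed_powr_strict_mono:
  assumes "0 < p" "x < y"
  shows "signed_powr x p < signed_powr y p"
proof -
  consider "0 \<le> x" | "x < 0" "0 \<le> y" | "y < 0" by linarith
  then show ?thesis
  proof cases
    case 1
    then show ?thesis using assms by (auto simp: signed_powr_def sgn_if intro: powr_less_mono2)
  next
    case 2
    then have "signed_powr x p < 0" "0 \<le> signed_powr y p" by (auto simp: signed_powr_def sgn_if)
    then show ?thesis by simp
  next
    case 3
    then show ?thesis using assms by (auto simp: signed_powr_def sgn_if intro: powr_less_mono2)
  qed
qed

lemma signed_powr_mono:
  assumes "0 \<le> p" "x \<le> y"
  shows "signed_powr x p \<le> signed_powr y p"
proof (cases "p = 0")
  case True
  then show ?thesis using assms by (auto simp: signed_powr_def sgn_if)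
next
  case False
  then show ?thesis using signed_powr_strict_mono[of p x y] assms by (cases "x = y") auto
qed

lemma continuous_on_signed_powr:
  assumes "0 < p"
  shows "continuous_on UNIV (\<lambda>z. signed_powr z p)"
proof -
  have "continuous_on ({0..} \<union> {..0}) (\<lambda>z. if 0 \<le> z then z powr p else - ((- z) powr p))"
    using assms by (intro continuous_on_cases continuous_intros continuous_on_powr') auto
  moreover have "{0..} \<union> {..0} = (UNIV :: real set)" by auto
  moreover have "(\<lambda>z. if 0 \<le> z then z powr p else - ((- z) powr p)) = (\<lambda>z. signed_powr z p)"
    using assms by (auto simp: signed_powr_def sgn_if fun_eq_iff)
  ultimately show ?thesis by (simp only:)
qed

text \<open>Homogeneity reduces the claim to \<open>s = 1\<close>; there the increment over
  \<open>b\<close> is continuous and positive on a compact interval, so it has a positive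
  minimum.\<close>

lemma signed_powr_increment:
  assumes "0 < p" "0 < a" "0 < b"
  shows "\<exists>c>0. \<forall>s>0. \<forall>v. \<bar>v\<bar> \<le> a * s \<longrightarrow> signed_powr v p + c * s powr p \<le> signed_powr (v + b * s) p"
proof -
  have "continuous_on {-a..a} (\<lambda>v. signed_powr (v + b) p - signed_powr v p)"
    by (intro continuous_intros continuous_on_compose2[OF continuous_on_signed_powr[OF assms(1)]]) auto
  then obtain w where w: "w \<in> {-a..a}"
    "\<And>v. v \<in> {-a..a} \<Longrightarrow> signed_powr (w + b) p - signed_powr w p \<le> signed_powr (v + b) p - signed_powr v p"
    using continuous_attains_inf[of "{-a..a}" "\<lambda>v. signed_powr (v + b) p - signed_powr v p"] assms by force
  define c where "c = signed_powr (w + b) p - signed_powr w p"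
  have "c > 0" using signed_powr_strict_mono[of p w "w + b"] assms by (simp add: c_def)
  moreover have "signed_powr v p + c * s powr p \<le> signed_powr (v + b * s) p"
    if "0 < s" "\<bar>v\<bar> \<le> a * s" for s v
  proof -
    have "v / s \<in> {-a..a}" using that by (auto simp: field_simps)
    from w(2)[OF this] have "s powr p * c \<le> s powr p * (signed_powr (v / s + b) p - signed_powr (v / s) p)"
      unfolding c_def by (intro mult_left_mono) auto
    also have "\<dots> = signed_powr (s * (v / s + b)) p - signed_powr (s * (v / s)) p"
      unfolding signed_powr_mult[OF that(1)] by (rule right_diff_distrib)
    also have "\<dots> = signed_powr (v + b * s) p - signed_powr v p"
    proof -
      have "s * (v / s + b) = v + b * s" "s * (v / s) = v" using that by (auto simp: field_simps)
      then show ?thesis by (simp only:)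
    qed
    finally show ?thesis by (simp add: mult.commute)
  qed
  ultimately show ?thesis by blast
qed

definition two_power :: "real \<Rightarrow> real \<Rightarrow> real \<Rightarrow> real \<Rightarrow> real \<Rightarrow> real" where
  "two_power a b p q s = a * signed_powr s p + b * signed_powr s q"

lemma two_power_pos_eq: "0 < s \<Longrightarrow> two_power a b p q s = a * s powr p + b * s powr q"
  by (simp add: two_power_def signed_powr_pos_eq)

lemma two_power_minus: "two_power a b p q (- s) = - two_power a b p q s"
  by (simp add: two_power_def signed_powr_minus)

lemma two_power_strict_mono:
  assumes "0 < a" "0 < b" "0 < p" "0 < q"
  shows "strict_mono (two_power a b p q)"
  unfolding two_power_def using assms
  by (intro strict_monoI add_strict_mono mult_strict_left_mono signed_powr_strict_mono)

lemma two_power_mono: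
  assumes "0 < a" "0 < b" "0 \<le> p" "0 \<le> q"
  shows "mono (two_power a b p q)"
  unfolding two_power_def using assms
  by (intro monoI add_mono mult_left_mono signed_powr_mono) auto

lemma continuous_on_two_power:
  assumes "0 < p" "0 < q"
  shows "continuous_on UNIV (two_power a b p q)"
  unfolding two_power_def using assms by (intro continuous_intros continuous_on_signed_powr)

lemma two_power_doubling:
  assumes "0 < a" "0 < b" "0 < m"
  shows "\<exists>C>0. \<forall>s>0. two_power a b p q (m * s) \<le> C * two_power a b p q s"
proof (intro exI conjI allI impI)
  show "0 < max (m powr p) (m powr q)" using assms by (simp add: less_max_iff_disj)
  fix s :: real assume s: "0 < s"
  have "two_power a b p q (m * s) = m powr p * (a * s powr p) + m powr q * (b * s powr q)"
    using assms s by (simp add: two_power_pos_eq powr_mult)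
  also have "\<dots> \<le> max (m powr p) (m powr q) * (a * s powr p) + max (m powr p) (m powr q) * (b * s powr q)"
    using assms s by (intro add_mono mult_right_mono) auto
  also have "\<dots> = max (m powr p) (m powr q) * two_power a b p q s"
    using s by (simp add: two_power_pos_eq distrib_left)
  finally show "two_power a b p q (m * s) \<le> max (m powr p) (m powr q) * two_power a b p q s" .
qed

lemma two_power_increment:
  assumes "0 < a" "0 < b" "0 < p" "0 < q" "0 < m" "0 < h"
  shows "\<exists>c>0. \<forall>s>0. \<forall>v. \<bar>v\<bar> \<le> m * s \<longrightarrow>
    two_power a b p q v + c * two_power a b p q s \<le> two_power a b p q (v + h * s)"
proof -
  obtain c where c: "c > 0"
    "\<And>s v. 0 < s \<Longrightarrow> \<bar>v\<bar> \<le> m * s \<Longrightarrow> signed_powr v p + c * s powr p \<le> signed_powr (v + h * s) p"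
    using signed_powr_increment[of p m h] assms by metis
  obtain d where d: "d > 0"
    "\<And>s v. 0 < s \<Longrightarrow> \<bar>v\<bar> \<le> m * s \<Longrightarrow> signed_powr v q + d * s powr q \<le> signed_powr (v + h * s) q"
    using signed_powr_increment[of q m h] assms by metis
  show ?thesis
  proof (intro exI conjI allI impI)
    show "0 < min c d" using c d by simp
    fix s v :: real assume s: "0 < s" "\<bar>v\<bar> \<le> m * s"
    have "two_power a b p q v + min c d * two_power a b p q s
        = a * (signed_powr v p + min c d * s powr p) + b * (signed_powr v q + min c d * s powr q)"
      using s by (simp add: two_power_pos_eq) (simp add: two_power_def algebra_simps)
    also have "\<dots> \<le> a * (signed_powr v p + c * s powr p) + b * (signed_powr v q + d * s powr q)"
      using assms by (intro add_mono mult_left_mono mult_right_mono) auto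
    also have "\<dots> \<le> a * signed_powr (v + h * s) p + b * signed_powr (v + h * s) q"
      using assms s c(2) d(2) by (intro add_mono mult_left_mono) auto
    finally show "two_power a b p q v + min c d * two_power a b p q s \<le> two_power a b p q (v + h * s)"
      by (simp add: two_power_def)
  qed
qed

lemma surj_two_power:
  assumes "0 < a" "0 < b" "0 < p" "0 < q"
  shows "surj (two_power a b p q)"
proof -
  have pos: "\<exists>x. two_power a b p q x = y" if "0 \<le> y" for y
  proof -
    \<comment> \<open>At this point the first summand alone equals \<open>y\<close>, so the
      intermediate value theorem applies on \<open>[0, s]\<close>.\<close>
    define s where "s = (y / a) powr (1 / p)"
    have "s \<ge> 0" by (simp add: s_def)
    have "y \<le> two_power a b p q s"
    proof (cases "y = 0")
      case True
      then show ?thesis by (simp add: s_def two_power_def)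
    next
      case False
      then have "s > 0" using that assms by (simp add: s_def)
      moreover have "a * s powr p = y" using False that assms by (simp add: s_def powr_powr)
      ultimately show ?thesis using assms by (simp add: two_power_pos_eq)
    qed
    then show ?thesis
      using IVT'[of "two_power a b p q" 0 y s] \<open>s \<ge> 0\<close> that
        continuous_on_subset[OF continuous_on_two_power[OF assms(3,4)]]
      by (auto simp: two_power_def)
  qed
  show ?thesis
    unfolding surj_def
  proof
    fix y :: real
    have "\<exists>x. two_power a b p q x = y"
    proof (cases "0 \<le> y")
      case False
      then obtain x where "two_power a b p q x = - y" using pos[of "- y"] by auto
      then have "two_power a b p q (- x) = y" by (simp add: two_power_minus)
      then show ?thesis ..
    qed (rule pos)
    then show "\<exists>x. y = two_power a b p q x" by metis
  qed
qed

text \<open>Two-sided growth: order \<open>P\<close> at 0 and order \<open>Q\<close> at infinity. It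
  is the quantitative form of bi-homogeneity that composition preserves.\<close>

definition powerlike :: "real \<Rightarrow> real \<Rightarrow> (real \<Rightarrow> real) \<Rightarrow> bool" where
  "powerlike P Q f \<longleftrightarrow> (\<exists>c>0. \<exists>C>0. \<forall>s>0.
     (s \<le> 1 \<longrightarrow> c * s powr P \<le> f s \<and> f s \<le> C * s powr P) \<and>
     (1 \<le> s \<longrightarrow> c * s powr Q \<le> f s \<and> f s \<le> C * s powr Q))"

text \<open>Because of \<open>p \<le> q\<close>, the \<open>p\<close> term governs small arguments
  and the \<open>q\<close> term large ones, so orders multiply by \<open>p\<close> at 0 and by
  \<open>q\<close> at infinity.\<close>

lemma powerlike_two_power_comp:
  assumes ab: "0 < a" "0 < b" and pq: "0 \<le> p" "p \<le> q" and PQ: "0 \<le> P" "0 \<le> Q" and f: "powerlike P Q f"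
  shows "powerlike (P * p) (Q * q) (\<lambda>s. two_power a b p q (f s))"
proof -
  obtain c C where cC: "0 < c" "0 < C" and
    small: "\<And>s. 0 < s \<Longrightarrow> s \<le> 1 \<Longrightarrow> c * s powr P \<le> f s \<and> f s \<le> C * s powr P" and
    large: "\<And>s. 0 < s \<Longrightarrow> 1 \<le> s \<Longrightarrow> c * s powr Q \<le> f s \<and> f s \<le> C * s powr Q"
    using f unfolding powerlike_def by metis
  define c' where "c' = min (a * c powr p) (b * c powr q)"
  define C' where "C' = a * C powr p + b * C powr q"
  have powers: "c powr r * s powr (R * r) \<le> f s powr r" "f s powr r \<le> C powr r * s powr (R * r)"
    if "0 \<le> r" "0 < s" "c * s powr R \<le> f s" "f s \<le> C * s powr R" for r s R
  proof -
    have "(c * s powr R) powr r \<le> f s powr r" using that cC by (intro powr_mono2) auto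
    then show "c powr r * s powr (R * r) \<le> f s powr r" using that cC by (simp add: powr_mult powr_powr)
    have "0 \<le> c * s powr R" using cC that by auto
    then have "0 \<le> f s" using that(3) by linarith
    then have "f s powr r \<le> (C * s powr R) powr r" using that by (intro powr_mono2) auto
    then show "f s powr r \<le> C powr r * s powr (R * r)" using that cC by (simp add: powr_mult powr_powr)
  qed
  have fpos: "0 < f s" if "0 < s" for s
  proof (cases "s \<le> 1")
    case True
    have "0 < c * s powr P" using cC that by simp
    then show ?thesis using small[OF that True] by linarith
  next
    case False
    have "0 < c * s powr Q" using cC that by simp
    then show ?thesis using large[OF that] False by linarith
  qed
  show ?thesis
    unfolding powerlike_def
  proof (intro exI conjI allI impI)
    show "0 < c'" using ab cC by (simp add: c'_def)
    show "0 < C'" using ab cC by (simp add: C'_def add_pos_pos)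
    fix s :: real assume s: "0 < s"
    note eq = two_power_pos_eq[OF fpos[OF s], of a b p q]
    {
      assume s1: "s \<le> 1"
      note pp = powers[OF pq(1) s, of P] small[OF s s1]
      note qq = powers[OF order_trans[OF pq] s, of P] small[OF s s1]
      have "c' * s powr (P * p) \<le> a * (c powr p * s powr (P * p))"
        unfolding mult.assoc[symmetric] by (intro mult_right_mono) (auto simp: c'_def)
      also have "\<dots> \<le> a * f s powr p" using pp ab by (intro mult_left_mono) auto
      also have "\<dots> \<le> two_power a b p q (f s)" using eq ab by simp
      finally show "c' * s powr (P * p) \<le> two_power a b p q (f s)" .
      have "s powr (P * q) \<le> s powr (P * p)"
        using s s1 pq PQ by (intro powr_mono') (auto intro: mult_left_mono)
      then have "f s powr q \<le> C powr q * s powr (P * p)"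
        using qq cC by (meson mult_left_mono order_trans powr_ge_zero)
      then have "a * f s powr p + b * f s powr q \<le> a * (C powr p * s powr (P * p)) + b * (C powr q * s powr (P * p))"
        using pp ab by (intro add_mono mult_left_mono) auto
      then show "two_power a b p q (f s) \<le> C' * s powr (P * p)"
        using eq by (simp add: C'_def algebra_simps)
    next
      assume s1: "1 \<le> s"
      note pp = powers[OF pq(1) s, of Q] large[OF s s1]
      note qq = powers[OF order_trans[OF pq] s, of Q] large[OF s s1]
      have "c' * s powr (Q * q) \<le> b * (c powr q * s powr (Q * q))"
        unfolding mult.assoc[symmetric] by (intro mult_right_mono) (auto simp: c'_def)
      also have "\<dots> \<le> b * f s powr q" using qq ab by (intro mult_left_mono) auto
      also have "\<dots> \<le> two_power a b p q (f s)" using eq ab by simp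
      finally show "c' * s powr (Q * q) \<le> two_power a b p q (f s)" .
      have "s powr (Q * p) \<le> s powr (Q * q)"
        using s s1 pq PQ by (intro powr_mono) (auto intro: mult_left_mono)
      then have "f s powr p \<le> C powr p * s powr (Q * q)"
        using pp cC by (meson mult_left_mono order_trans powr_ge_zero)
      then have "a * f s powr p + b * f s powr q \<le> a * (C powr p * s powr (Q * q)) + b * (C powr q * s powr (Q * q))"
        using qq ab by (intro add_mono mult_left_mono) auto
      then show "two_power a b p q (f s) \<le> C' * s powr (Q * q)"
        using eq by (simp add: C'_def algebra_simps)
    }
  qed
qed

lemma powerlike_ratio:
  assumes "powerlike P Q f" "powerlike P' Q' g"
  shows "\<exists>B>0. \<forall>s>0. (s \<le> 1 \<longrightarrow> f s / g s \<le> B * s powr (P - P')) \<and> (1 \<le> s \<longrightarrow> f s / g s \<le> B * s powr (Q - Q'))"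
proof -
  obtain c C where f: "0 < c" "0 < C" 
    "\<And>s. 0 < s \<Longrightarrow> s \<le> 1 \<Longrightarrow> c * s powr P \<le> f s \<and> f s \<le> C * s powr P"
    "\<And>s. 0 < s \<Longrightarrow> 1 \<le> s \<Longrightarrow> c * s powr Q \<le> f s \<and> f s \<le> C * s powr Q"
    using assms(1) unfolding powerlike_def by metis
  obtain c' C' where g: "0 < c'" "0 < C'" 
    "\<And>s. 0 < s \<Longrightarrow> s \<le> 1 \<Longrightarrow> c' * s powr P' \<le> g s \<and> g s \<le> C' * s powr P'"
    "\<And>s. 0 < s \<Longrightarrow> 1 \<le> s \<Longrightarrow> c' * s powr Q' \<le> g s \<and> g s \<le> C' * s powr Q'"
    using assms(2) unfolding powerlike_def by metis
  have main: "f s / g s \<le> C / c' * s powr (R - R')"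
    if s: "0 < s" and fs: "c * s powr R \<le> f s \<and> f s \<le> C * s powr R"
      and gs: "c' * s powr R' \<le> g s \<and> g s \<le> C' * s powr R'" for s R R'
  proof -
    have "0 \<le> c * s powr R" "0 < c' * s powr R'" using f g s by auto
    then have "f s / g s \<le> (C * s powr R) / (c' * s powr R')"
      using fs gs by (intro frac_le) auto
    then show ?thesis by (simp add: powr_diff)
  qed
  show ?thesis
  proof (intro exI conjI allI impI)
    show "0 < C / c'" using f g by simp
    show "f s / g s \<le> C / c' * s powr (P - P')" if "0 < s" "s \<le> 1" for s
      by (rule main[OF that(1) f(3)[OF that] g(3)[OF that]])
    show "f s / g s \<le> C / c' * s powr (Q - Q')" if "0 < s" "1 \<le> s" for s
      by (rule main[OF that(1) f(4)[OF that] g(4)[OF that]])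
  qed
qed

text \<open>If the orders of \<open>f\<close>, \<open>g\<close>, \<open>h\<close> are in arithmetic
  progression, the powers in \<open>f / g\<close> and \<open>h / g\<close> cancel, both at 0 and at
  infinity.\<close>

lemma powerlike_log_concave:
  assumes f: "powerlike P Q f" and g: "powerlike P' Q' g" and h: "powerlike P'' Q'' h"
    and PQ: "P + P'' = 2 * P'" "Q + Q'' = 2 * Q'"
    and pos: "\<And>s. 0 < s \<Longrightarrow> 0 < f s \<and> 0 < g s \<and> 0 < h s"
  shows "\<exists>D>0. \<forall>s>0. f s * h s \<le> D * (g s)\<^sup>2"
proof -
  obtain B where B: "0 < B" "\<And>s. 0 < s \<Longrightarrow> s \<le> 1 \<Longrightarrow> f s / g s \<le> B * s powr (P - P')"
    "\<And>s. 0 < s \<Longrightarrow> 1 \<le> s \<Longrightarrow> f s / g s \<le> B * s powr (Q - Q')"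
    using powerlike_ratio[OF f g] by blast
  obtain B' where B': "0 < B'" "\<And>s. 0 < s \<Longrightarrow> s \<le> 1 \<Longrightarrow> h s / g s \<le> B' * s powr (P'' - P')"
    "\<And>s. 0 < s \<Longrightarrow> 1 \<le> s \<Longrightarrow> h s / g s \<le> B' * s powr (Q'' - Q')"
    using powerlike_ratio[OF h g] by blast
  have "f s * h s \<le> (B * B') * (g s)\<^sup>2" if s: "0 < s" for s
  proof -
    have main: "f s / g s * (h s / g s) \<le> B * B'"
      if "f s / g s \<le> B * s powr r" "h s / g s \<le> B' * s powr r'" "r + r' = 0" for r r'
    proof -
      have "f s / g s * (h s / g s) \<le> (B * s powr r) * (B' * s powr r')"
        using that pos[OF s] B(1) by (intro mult_mono) auto
      also have "\<dots> = B * B' * s powr (r + r')" by (simp add: powr_add)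
      finally show ?thesis using that(3) s by simp
    qed
    have "f s / g s * (h s / g s) \<le> B * B'"
    proof (cases "s \<le> 1")
      case True
      show ?thesis by (rule main[OF B(2)[OF s True] B'(2)[OF s True]]) (use PQ in simp)
    next
      case False
      then have "1 \<le> s" by simp
      show ?thesis by (rule main[OF B(3)[OF s \<open>1 \<le> s\<close>] B'(3)[OF s \<open>1 \<le> s\<close>]]) (use PQ in simp)
    qed
    then show ?thesis using pos[OF s] by (simp add: field_simps power2_eq_square)
  qed
  then show ?thesis using B(1) B'(1) by (intro exI[of _ "B * B'"]) auto
qed

section \<open>The injection terms of the differentiator\<close>

lemma nderiv_has_vector_derivative:
  assumes "n_times_differentiable n f" "j < n" "0 \<le> t"
  shows "(nderiv j f has_vector_derivative nderiv (Suc j) f t) (at t within {0..})"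
  using assms by (simp add: n_times_differentiable_def differentiable_on_def flip: vector_derivative_works)

lemma nderiv_has_real_derivative:
  assumes "n_times_differentiable n f" "j < n" "0 < t"
  shows "(nderiv j f has_real_derivative nderiv (Suc j) f t) (at t)"
proof -
  have "at t within {0..} = at t"
    using assms(3) by (intro at_within_interior) (simp add: interior_real_atLeast)
  then show ?thesis
    using nderiv_has_vector_derivative[OF assms(1,2), of t] assms(3)
    by (simp add: has_real_derivative_iff_has_vector_derivative)
qed

lemma nderiv_continuous_on:
  assumes "n_times_differentiable n f" "j < n"
  shows "continuous_on {0..} (nderiv j f)"
  using assms by (simp add: n_times_differentiable_def differentiable_imp_continuous_on)

text \<open>Derivatives of order below \<open>n\<close> are continuous, hence bounded on compact
  intervals. The one of order \<open>n\<close> need not be continuous; there the hypothesis supplies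
  the bound.\<close>

lemma nderiv_lipschitz:
  assumes f: "n_times_differentiable n f" and j: "j < n" and bd: "\<And>t. 0 \<le> t \<Longrightarrow> \<bar>nderiv n f t\<bar> \<le> \<Delta>"
  shows "\<exists>L. \<forall>u\<in>{0..b}. \<forall>v\<in>{0..b}. \<bar>nderiv j f v - nderiv j f u\<bar> \<le> L * \<bar>v - u\<bar>"
proof -
  have "\<exists>L. \<forall>t\<in>{0..b}. \<bar>nderiv (Suc j) f t\<bar> \<le> L"
  proof (cases "Suc j = n")
    case True
    then show ?thesis using bd by (intro exI[of _ \<Delta>]) (simp del: nderiv.simps)
  next
    case False
    then have "continuous_on {0..b} (nderiv (Suc j) f)"
      using j by (intro continuous_on_subset[OF nderiv_continuous_on[OF f]]) auto
    then have "bounded (nderiv (Suc j) f ` {0..b})"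
      by (intro compact_imp_bounded compact_continuous_image) auto
    then show ?thesis unfolding bounded_iff by auto
  qed
  then obtain L where L: "\<And>t. t \<in> {0..b} \<Longrightarrow> \<bar>nderiv (Suc j) f t\<bar> \<le> L" by blast
  have "\<bar>nderiv j f v - nderiv j f u\<bar> \<le> L * \<bar>v - u\<bar>" if "u \<in> {0..b}" "v \<in> {0..b}" for u v
  proof -
    have "(nderiv j f has_field_derivative nderiv (Suc j) f t) (at t within {0..b})" if "t \<in> {0..b}" for t
      using nderiv_has_vector_derivative[OF f j, of t] that
      by (auto simp: has_real_derivative_iff_has_vector_derivative intro: has_vector_derivative_within_subset)
    from field_differentiable_bound[OF _ this, of L v u] show ?thesis
      using that L by (auto simp: real_norm_def)
  qed
  then show ?thesis by blast
qed

section \<open>Set-valued powers and homogeneity weights\<close>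

lemma spow_eq: "z \<noteq> 0 \<or> p \<noteq> 0 \<Longrightarrow> spow z p = {signed_powr z p}"
  by (auto simp: spow_def signed_powr_def)

lemma spow_abs_le:
  assumes "a \<in> spow z p" "\<bar>z\<bar> \<le> B" "0 < B" "0 \<le> p"
  shows "\<bar>a\<bar> \<le> signed_powr B p"
proof (cases "z = 0 \<and> p = 0")
  case True
  then show ?thesis using assms by (auto simp: spow_def signed_powr_def)
next
  case False
  then have "a = signed_powr z p" using assms(1) spow_eq by blast
  then show ?thesis
    using signed_powr_mono[OF assms(4), of z B] signed_powr_mono[OF assms(4), of "- B" z] assms(2)
    unfolding \<open>a = _\<close> signed_powr_minus abs_le_iff by linarith
qed

lemma hweight_pos:
  assumes "2 \<le> n" "d < 1 / (real n - 1)" "1 \<le> i" "i \<le> n"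
  shows "0 < hweight n d i"
proof (cases "0 < d")
  case True
  have "(real n - real i) * d \<le> (real n - 1) * d" using True assms by (intro mult_right_mono) auto
  also have "\<dots> < 1" using assms by (simp add: field_simps)
  finally show ?thesis by (simp add: hweight_def)
next
  case False
  then have "(real n - real i) * d \<le> 0" using assms by (intro mult_nonneg_nonpos) auto
  then show ?thesis by (simp add: hweight_def)
qed

lemma hweight_Suc: "hweight n d (Suc i) = hweight n d i + d"
  by (simp add: hweight_def algebra_simps)

lemma hweight_self [simp]: "hweight n d n = 1"
  by (simp add: hweight_def)

text \<open>The weight beyond the last index is \<open>1 + d\<close>, which is 0 for
  \<open>d = -1\<close>: this is where the exponent 0 of the last term comes from.\<close>

lemma hweight_Suc_nonneg:
  assumes "2 \<le> n" "-1 \<le> d" "d < 1 / (real n - 1)" "1 \<le> i" "i \<le> n"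
  shows "0 \<le> hweight n d (Suc i)"
  using hweight_pos[OF assms(1,3), of "Suc i"] assms(2,4,5) hweight_Suc[of n d n] by (cases "i = n") auto

text \<open>The ratio is 1 plus \<open>d / hweight n d i\<close>; cross-multiplying two such
  quotients cancels the mixed product of \<open>d\<close> and \<open>d'\<close>.\<close>

lemma hweight_ratio_mono:
  assumes "2 \<le> n" "d \<le> d'" "d' < 1 / (real n - 1)" "1 \<le> i" "i \<le> n"
  shows "hweight n d (Suc i) / hweight n d i \<le> hweight n d' (Suc i) / hweight n d' i"
proof -
  have pos: "0 < hweight n d i" "0 < hweight n d' i" using assms by (auto intro!: hweight_pos)
  have "d * hweight n d' i \<le> d' * hweight n d i"
    using assms(2) by (simp add: hweight_def algebra_simps)
  then have "d / hweight n d i \<le> d' / hweight n d' i" using pos by (simp add: field_simps)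
  then show ?thesis using pos by (simp add: hweight_Suc add_divide_distrib)
qed

locale differentiator =
  fixes n :: nat and d0 dinf \<Delta> :: real and \<kappa> \<theta> :: "nat \<Rightarrow> real"
  assumes n_ge: "n \<ge> 2"
    and d0_ge: "-1 \<le> d0" and d0_le: "d0 \<le> dinf" and dinf_less: "dinf < 1 / (real n - 1)"
    and \<kappa>_pos: "\<And>i. i \<in> {1..n} \<Longrightarrow> \<kappa> i > 0"
    and \<theta>_pos: "\<And>i. i \<in> {1..n} \<Longrightarrow> \<theta> i > 0"
    and \<Delta>_nonneg: "\<Delta> \<ge> 0" and \<Delta>_zero: "d0 > -1 \<Longrightarrow> \<Delta> = 0"
begin

section \<open>The composed terms form an injection chain\<close>

definition p0 :: "nat \<Rightarrow> real" where "p0 i = hweight n d0 (i + 1) / hweight n d0 i"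
definition pinf :: "nat \<Rightarrow> real" where "pinf i = hweight n dinf (i + 1) / hweight n dinf i"

text \<open>Composition of the selections, so \<open>Phi n\<close> vanishes at 0 also when it jumps
  there; the full Filippov set is compared with it in \<open>inj_comp_last\<close> and
  \<open>inj_comp_nonzero\<close>.\<close>

primrec Phi :: "nat \<Rightarrow> real \<Rightarrow> real" where
  "Phi 0 s = s"
| "Phi (Suc i) s = two_power (\<kappa> (Suc i)) (\<theta> (Suc i)) (p0 (Suc i)) (pinf (Suc i)) (Phi i s)"

lemma Phi_Suc: "Phi (Suc i) = (\<lambda>s. two_power (\<kappa> (Suc i)) (\<theta> (Suc i)) (p0 (Suc i)) (pinf (Suc i)) (Phi i s))"
  by (simp add: fun_eq_iff)

lemma p0_pos: "1 \<le> i \<Longrightarrow> i < n \<Longrightarrow> 0 < p0 i"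
  using hweight_pos[of n d0 i] hweight_pos[of n d0 "i + 1"] n_ge d0_le dinf_less by (simp add: p0_def)

lemma p0_nonneg: "1 \<le> i \<Longrightarrow> i \<le> n \<Longrightarrow> 0 \<le> p0 i"
  using hweight_pos[of n d0 i] hweight_Suc_nonneg[of n d0 i] n_ge d0_ge d0_le dinf_less by (simp add: p0_def)

lemma p0_le_pinf: "1 \<le> i \<Longrightarrow> i \<le> n \<Longrightarrow> p0 i \<le> pinf i"
  using hweight_ratio_mono[of n d0 dinf i] n_ge d0_le dinf_less by (simp add: p0_def pinf_def)

lemma pinf_pos: "1 \<le> i \<Longrightarrow> i < n \<Longrightarrow> 0 < pinf i"
  using p0_pos[of i] p0_le_pinf[of i] by simp

lemma pinf_nonneg: "1 \<le> i \<Longrightarrow> i \<le> n \<Longrightarrow> 0 \<le> pinf i"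
  using p0_nonneg[of i] p0_le_pinf[of i] by simp

lemma p0_last: "p0 n = 1 + d0"
  by (simp add: p0_def hweight_Suc)

lemma Phi_strict_mono: "i < n \<Longrightarrow> strict_mono (Phi i)"
proof (induction i)
  case (Suc i)
  then have "strict_mono (two_power (\<kappa> (Suc i)) (\<theta> (Suc i)) (p0 (Suc i)) (pinf (Suc i)))"
    using \<kappa>_pos \<theta>_pos p0_pos pinf_pos by (intro two_power_strict_mono) auto
  then show ?case using Suc by (auto simp: strict_mono_def)
qed (simp add: strict_mono_def)

lemma Phi_surj: "i < n \<Longrightarrow> surj (Phi i)"
proof (induction i)
  case (Suc i)
  then have "surj (two_power (\<kappa> (Suc i)) (\<theta> (Suc i)) (p0 (Suc i)) (pinf (Suc i)))"
    using \<kappa>_pos \<theta>_pos p0_pos pinf_pos by (intro surj_two_power) auto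
  then show ?case using Suc by (auto simp: surj_def) metis
qed (simp add: surj_def)

lemma Phi_continuous: "i < n \<Longrightarrow> continuous_on UNIV (Phi i)"
proof (induction i)
  case (Suc i)
  then have "continuous_on UNIV (two_power (\<kappa> (Suc i)) (\<theta> (Suc i)) (p0 (Suc i)) (pinf (Suc i)))"
    using p0_pos pinf_pos by (intro continuous_on_two_power) auto
  then have "continuous_on UNIV (\<lambda>s. two_power (\<kappa> (Suc i)) (\<theta> (Suc i)) (p0 (Suc i)) (pinf (Suc i)) (Phi i s))"
    by (rule continuous_on_compose2[OF _ Suc.IH]) (use Suc.prems in auto)
  then show ?case by (simp only: Phi_Suc)
qed simp

lemma Phi_minus: "Phi i (- s) = - Phi i s"
  by (induction i) (auto simp: two_power_minus)

lemma Phi_last: "Phi n s = two_power (\<kappa> n) (\<theta> n) (p0 n) (pinf n) (Phi (n - 1) s)"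
proof -
  have "n = Suc (n - 1)" using n_ge by simp
  then show ?thesis by (metis Phi.simps(2))
qed

lemma Phi_mono: "i \<le> n \<Longrightarrow> mono (Phi i)"
proof (cases "i = n")
  case True
  have "mono (two_power (\<kappa> n) (\<theta> n) (p0 n) (pinf n))"
    using n_ge \<kappa>_pos \<theta>_pos p0_nonneg pinf_nonneg by (intro two_power_mono) auto
  moreover have "mono (Phi (n - 1))" using n_ge Phi_strict_mono[of "n - 1"] by (simp add: strict_mono_mono)
  ultimately have "mono (\<lambda>s. two_power (\<kappa> n) (\<theta> n) (p0 n) (pinf n) (Phi (n - 1) s))"
    by (auto simp: mono_def)
  then show ?thesis using True Phi_last by (auto simp: mono_def)
qed (use Phi_strict_mono[of i] in \<open>auto intro: strict_mono_mono\<close>)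

lemma Phi_pos: "i \<le> n \<Longrightarrow> 0 < s \<Longrightarrow> 0 < Phi i s"
proof (induction i)
  case (Suc i)
  then have "0 < Phi i s" by simp
  then show ?case using Suc.prems \<kappa>_pos[of "Suc i"] \<theta>_pos[of "Suc i"]
    by (simp add: two_power_pos_eq add_pos_pos)
qed simp

lemma Phi_doubling:
  assumes "0 < a"
  shows "i \<le> n \<Longrightarrow> \<exists>C>0. \<forall>s>0. Phi i (a * s) \<le> C * Phi i s"
proof (induction i)
  case 0
  then show ?case using assms by auto
next
  case (Suc i)
  then obtain C where C: "C > 0" "\<And>s. s > 0 \<Longrightarrow> Phi i (a * s) \<le> C * Phi i s" by auto
  let ?f = "two_power (\<kappa> (Suc i)) (\<theta> (Suc i)) (p0 (Suc i)) (pinf (Suc i))"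
  obtain C' where C': "C' > 0" "\<And>s. s > 0 \<Longrightarrow> ?f (C * s) \<le> C' * ?f s"
    using two_power_doubling[of "\<kappa> (Suc i)" "\<theta> (Suc i)" C "p0 (Suc i)" "pinf (Suc i)"]
      Suc.prems \<kappa>_pos \<theta>_pos C(1) by auto
  have m: "mono ?f" using Suc.prems \<kappa>_pos \<theta>_pos p0_nonneg pinf_nonneg by (intro two_power_mono) auto
  have "?f (Phi i (a * s)) \<le> C' * ?f (Phi i s)" if "0 < s" for s
    using monoD[OF m C(2)[OF that]] C'(2)[of "Phi i s"] Phi_pos[of i s] that Suc.prems by simp
  then show ?case using C'(1) by auto
qed

text \<open>By doubling, the range \<open>\<bar>v\<bar> \<le> a * s\<close> is mapped into a
  multiple of \<open>Phi i s\<close>. The increment of the inner map is therefore one that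
  \<open>two_power_increment\<close> can process, at the scale \<open>Phi i s\<close>.\<close>

lemma Phi_increment:
  assumes "0 < a" "0 < b"
  shows "i < n \<Longrightarrow> \<exists>c>0. \<forall>s>0. \<forall>v. \<bar>v\<bar> \<le> a * s \<longrightarrow> Phi i v + c * Phi i s \<le> Phi i (v + b * s)"
proof (induction i)
  case 0
  then show ?case using assms by auto
next
  case (Suc i)
  then obtain c where c: "c > 0"
    "\<And>s v. s > 0 \<Longrightarrow> \<bar>v\<bar> \<le> a * s \<Longrightarrow> Phi i v + c * Phi i s \<le> Phi i (v + b * s)" by auto
  obtain C where C: "C > 0" "\<And>s. s > 0 \<Longrightarrow> Phi i (a * s) \<le> C * Phi i s"
    using Phi_doubling[OF assms(1), of i] Suc.prems by auto
  let ?f = "two_power (\<kappa> (Suc i)) (\<theta> (Suc i)) (p0 (Suc i)) (pinf (Suc i))"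
  obtain c' where c': "c' > 0"
    "\<And>s v. s > 0 \<Longrightarrow> \<bar>v\<bar> \<le> C * s \<Longrightarrow> ?f v + c' * ?f s \<le> ?f (v + c * s)"
    using two_power_increment[of "\<kappa> (Suc i)" "\<theta> (Suc i)" "p0 (Suc i)" "pinf (Suc i)" C c]
      Suc.prems \<kappa>_pos \<theta>_pos p0_pos pinf_pos C(1) c(1) by auto
  have m: "mono ?f" using Suc.prems \<kappa>_pos \<theta>_pos p0_nonneg pinf_nonneg by (intro two_power_mono) auto
  have "Phi (Suc i) v + c' * Phi (Suc i) s \<le> Phi (Suc i) (v + b * s)" if "0 < s" "\<bar>v\<bar> \<le> a * s" for s v
  proof -
    have "Phi i v \<le> Phi i (a * s)" "Phi i (- (a * s)) \<le> Phi i v"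
      using that Phi_mono[of i] Suc.prems by (auto intro: monoD)
    then have "\<bar>Phi i v\<bar> \<le> C * Phi i s" using C(2)[OF that(1)] by (simp add: Phi_minus)
    then have "?f (Phi i v) + c' * ?f (Phi i s) \<le> ?f (Phi i v + c * Phi i s)"
      using c'(2) Phi_pos[of i s] that Suc.prems by simp
    also have "\<dots> \<le> ?f (Phi i (v + b * s))" using c(2)[OF that] by (intro monoD[OF m])
    finally show ?thesis by simp
  qed
  then show ?case using c'(1) by auto
qed

text \<open>The exponents are quotients of consecutive weights, so their product telescopes.\<close>

lemma Phi_powerlike:
  "i \<le> n \<Longrightarrow> powerlike (hweight n d0 (i + 1) / hweight n d0 1) (hweight n dinf (i + 1) / hweight n dinf 1) (Phi i)"
proof (induction i)
  case 0
  have "hweight n d0 1 > 0" "hweight n dinf 1 > 0" using n_ge d0_le dinf_less by (auto intro!: hweight_pos)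
  then show ?case by (auto simp: powerlike_def intro!: exI[of _ 1])
next
  case (Suc i)
  let ?h = "hweight n d0" and ?g = "hweight n dinf"
  have pos: "?h 1 > 0" "?g 1 > 0" "?h (i + 1) > 0" "?g (i + 1) > 0"
    using n_ge d0_le dinf_less Suc.prems by (auto intro!: hweight_pos)
  have "powerlike (?h (i + 1) / ?h 1 * p0 (Suc i)) (?g (i + 1) / ?g 1 * pinf (Suc i)) (Phi (Suc i))"
    unfolding Phi_Suc
    using Suc pos \<kappa>_pos \<theta>_pos p0_nonneg p0_le_pinf by (intro powerlike_two_power_comp) auto
  then show ?case using pos by (simp add: p0_def pinf_def del: Phi.simps)
qed

lemma injection_chain_Phi: "injection_chain n Phi"
proof
  show "1 \<le> n" using n_ge by simp
  show "strict_mono (Phi i)" if "i < n" for i using Phi_strict_mono[OF that] .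
  show "mono (Phi n)" using Phi_mono by simp
  show "Phi i (- s) = - Phi i s" for i s by (rule Phi_minus)
  show "0 < Phi i s" if "i \<le> n" "0 < s" for i s using Phi_pos that .
  show "\<exists>C>0. \<forall>s>0. Phi i (a * s) \<le> C * Phi i s" if "i \<le> n" "0 < a" for i a
    using Phi_doubling that by blast
  show "\<exists>c>0. \<forall>s>0. \<forall>v. \<bar>v\<bar> \<le> a * s \<longrightarrow> Phi i v + c * Phi i s \<le> Phi i (v + b * s)"
    if "i < n" "0 < a" "0 < b" for i a b using Phi_increment that by blast
  have "\<exists>D>0. \<forall>s>0. Phi (i + 1) s * Phi (i - 1) s \<le> D * (Phi i s)\<^sup>2" if i: "i \<in> {1..<n}" for i
  proof (rule powerlike_log_concave[OF Phi_powerlike Phi_powerlike Phi_powerlike])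
    \<comment> \<open>The weights are affine in the index, hence in arithmetic progression.\<close>
    have *: "hweight n d (i + 1 + 1) / w + hweight n d (i - 1 + 1) / w = 2 * (hweight n d (i + 1) / w)" for d w
      using i by (cases i) (auto simp: hweight_Suc simp flip: add_divide_distrib)
    show "hweight n d0 (i + 1 + 1) / hweight n d0 1 + hweight n d0 (i - 1 + 1) / hweight n d0 1
      = 2 * (hweight n d0 (i + 1) / hweight n d0 1)" by (rule *)
    show "hweight n dinf (i + 1 + 1) / hweight n dinf 1 + hweight n dinf (i - 1 + 1) / hweight n dinf 1
      = 2 * (hweight n dinf (i + 1) / hweight n dinf 1)" by (rule *)
    show "0 < Phi (i + 1) s \<and> 0 < Phi i s \<and> 0 < Phi (i - 1) s" if "0 < s" for s
      using i that by (intro conjI Phi_pos) auto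
  qed (use i in auto)
  then obtain D where D: "\<And>i. i \<in> {1..<n} \<Longrightarrow> D i > 0"
    "\<And>i s. i \<in> {1..<n} \<Longrightarrow> s > 0 \<Longrightarrow> Phi (i + 1) s * Phi (i - 1) s \<le> D i * (Phi i s)\<^sup>2" by metis
  show "\<exists>D>0. \<forall>i\<in>{1..<n}. \<forall>s>0. Phi (i + 1) s * Phi (i - 1) s \<le> D * (Phi i s)\<^sup>2"
  proof (intro exI conjI ballI allI impI)
    show "0 < Max (insert 1 (D ` {1..<n}))" by (auto simp: Max_gr_iff)
    fix i s assume i: "i \<in> {1..<n}" and s: "0 < (s::real)"
    have "D i \<le> Max (insert 1 (D ` {1..<n}))" using i by (intro Max_ge) auto
    then have "D i * (Phi i s)\<^sup>2 \<le> Max (insert 1 (D ` {1..<n})) * (Phi i s)\<^sup>2" by (intro mult_right_mono) auto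
    then show "Phi (i + 1) s * Phi (i - 1) s \<le> Max (insert 1 (D ` {1..<n})) * (Phi i s)\<^sup>2"
      using D(2)[OF i s] by linarith
  qed
qed

end

section \<open>Limits of Euler polygons\<close>

text \<open>The length of the part of the cell from \<open>k * h\<close> to
  \<open>(k + 1) * h\<close> that lies to the left of \<open>t\<close>.\<close>

definition ramp :: "real \<Rightarrow> nat \<Rightarrow> real \<Rightarrow> real" where
  "ramp h k t = max 0 (min h (t - real k * h))"

lemma ramp_mono: "s \<le> t \<Longrightarrow> ramp h k s \<le> ramp h k t"
  by (auto simp: ramp_def)

lemma sum_ramp:
  assumes "0 \<le> h" "0 \<le> t"
  shows "(\<Sum>k<N. ramp h k t) = min t (real N * h)"
  by (induction N) (use assms in \<open>auto simp: ramp_def min_def max_def algebra_simps\<close>)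

lemma ramp_grid:
  assumes "0 \<le> h"
  shows "ramp h l (real k * h) = (if l < k then h else 0)"
proof (cases "l < k")
  case True
  then have "1 * h \<le> (real k - real l) * h" using assms by (intro mult_right_mono) auto
  then show ?thesis using True assms by (simp add: ramp_def algebra_simps)
next
  case False
  then have "real k * h \<le> real l * h" using assms by (intro mult_right_mono) auto
  then show ?thesis using False assms by (simp add: ramp_def)
qed

text \<open>Euler's polygons on \<open>[0, d]\<close>; written as a sum of ramps, the increments of a polygon are
  weighted means of the slopes.\<close>

primrec euler_node :: "(nat \<Rightarrow> real \<Rightarrow> (nat \<Rightarrow> real) \<Rightarrow> real) \<Rightarrow> (nat \<Rightarrow> real) \<Rightarrow> real \<Rightarrow> nat \<Rightarrow> nat \<Rightarrow> real" where
  "euler_node F x0 h 0 = x0"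
| "euler_node F x0 h (Suc k) =
     (\<lambda>i. euler_node F x0 h k i + F i (real k * h) (euler_node F x0 h k) * h)"

definition euler_slope where
  "euler_slope F x0 h i k = F i (real k * h) (euler_node F x0 h k)"

definition euler_polygon where
  "euler_polygon F x0 h N i t = x0 i + (\<Sum>k<N. euler_slope F x0 h i k * ramp h k t)"

lemma euler_node_eq: "euler_node F x0 h k i = x0 i + (\<Sum>l<k. euler_slope F x0 h i l * h)"
  by (induction k) (auto simp: euler_slope_def)

lemma euler_polygon_grid:
  assumes "0 \<le> h" "k \<le> N"
  shows "euler_polygon F x0 h N i (real k * h) = euler_node F x0 h k i"
proof -
  have "(\<Sum>l<N. euler_slope F x0 h i l * ramp h l (real k * h)) = (\<Sum>l<k. euler_slope F x0 h i l * h)"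
    using assms by (intro sum.mono_neutral_cong_right) (auto simp: ramp_grid)
  then show ?thesis by (simp add: euler_polygon_def euler_node_eq)
qed

text \<open>Only the slopes on cells that meet the interval count, and \<open>F\<close> need not be
  continuous. In this form the estimate passes to the limit of polygons.\<close>

lemma euler_polygon_increment:
  assumes "0 \<le> h" "0 \<le> s" "s \<le> t" "t \<le> real N * h"
    and "\<And>k. k < N \<Longrightarrow> s < real k * h + h \<Longrightarrow> real k * h < t \<Longrightarrow> \<bar>euler_slope F x0 h i k - v\<bar> \<le> e"
  shows "\<bar>euler_polygon F x0 h N i t - euler_polygon F x0 h N i s - v * (t - s)\<bar> \<le> e * (t - s)"
proof -
  let ?d = "\<lambda>k. ramp h k t - ramp h k s"
  have d: "(\<Sum>k<N. ?d k) = t - s"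
    using assms by (simp add: sum_subtractf sum_ramp)
  have "euler_polygon F x0 h N i t - euler_polygon F x0 h N i s - v * (t - s)
      = (\<Sum>k<N. (euler_slope F x0 h i k - v) * ?d k)"
    by (simp add: euler_polygon_def d[symmetric] sum_distrib_left algebra_simps sum_subtractf sum.distrib)
  also have "\<bar>\<dots>\<bar> \<le> (\<Sum>k<N. e * ?d k)"
  proof (rule order_trans[OF sum_abs], intro sum_mono)
    fix k assume k: "k \<in> {..<N}"
    show "\<bar>(euler_slope F x0 h i k - v) * ?d k\<bar> \<le> e * ?d k"
    proof (cases "s < real k * h + h \<and> real k * h < t")
      case True
      then have "\<bar>euler_slope F x0 h i k - v\<bar> \<le> e" using assms(5) k by auto
      moreover have "0 \<le> ?d k" using ramp_mono[OF assms(3)] by simp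
      ultimately show ?thesis by (simp add: abs_mult mult_right_mono)
    next
      case False
      then have "?d k = 0" using assms(1,3) by (auto simp: ramp_def min_def max_def)
      then show ?thesis by simp
    qed
  qed
  also have "\<dots> = e * (t - s)" by (simp add: d flip: sum_distrib_left)
  finally show ?thesis .
qed

lemma euler_polygon_lipschitz:
  assumes "0 \<le> h" "0 \<le> s" "s \<le> t" "t \<le> real N * h" "\<And>t y. \<bar>F i t y\<bar> \<le> L"
  shows "\<bar>euler_polygon F x0 h N i t - euler_polygon F x0 h N i s\<bar> \<le> L * (t - s)"
  using euler_polygon_increment[OF assms(1-4), of F x0 i 0 L] assms(5) by (simp add: euler_slope_def)

text \<open>The components of a vector are indexed by a second real variable, so that one application of
  the theorem of Arzela and Ascoli treats all of them.\<close>

lemma euler_limit: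
  fixes F :: "nat \<Rightarrow> real \<Rightarrow> (nat \<Rightarrow> real) \<Rightarrow> real" and x0 :: "nat \<Rightarrow> real" and n :: nat
  assumes d: "0 < d" and F: "\<And>i t y. i \<in> {1..n} \<Longrightarrow> \<bar>F i t y\<bar> \<le> L"
  obtains x where "\<And>i. i \<in> {1..n} \<Longrightarrow> x i 0 = x0 i"
    and "\<And>i s t. i \<in> {1..n} \<Longrightarrow> 0 \<le> s \<Longrightarrow> s \<le> t \<Longrightarrow> t \<le> d \<Longrightarrow> \<bar>x i t - x i s\<bar> \<le> L * (t - s)"
    and "\<And>i t v. i \<in> {1..n} \<Longrightarrow> 0 < t \<Longrightarrow> t < d \<Longrightarrow>
      (\<And>e. 0 < e \<Longrightarrow> \<exists>r>0. \<forall>s y. \<bar>s - t\<bar> < r \<longrightarrow> (\<forall>j\<in>{1..n}. \<bar>y j - x j t\<bar> < r) \<longrightarrow> \<bar>F i s y - v\<bar> \<le> e) \<Longrightarrow>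
      (x i has_real_derivative v) (at t)"
proof (cases "n = 0")
  case True
  show ?thesis by (rule that[of "\<lambda>i t. 0"]) (use True in auto)
next
  case False
  then have "0 \<le> L" using F[of 1] by (fastforce intro: order_trans[OF abs_ge_zero])
  define h where "h m = d / real (Suc m)" for m
  have h: "0 < h m" "real (Suc m) * h m = d" for m using d by (auto simp: h_def)
  define P where "P m = euler_polygon F x0 (h m) (Suc m)" for m
  have P_lip: "\<bar>P m i t - P m i s\<bar> \<le> L * (t - s)"
    if "i \<in> {1..n}" "0 \<le> s" "s \<le> t" "t \<le> d" for m i s t
    unfolding P_def using that h F[OF that(1)] less_imp_le[OF h(1)[of m]]
    by (intro euler_polygon_lipschitz) (auto simp del: of_nat_Suc)
  have P_lip': "\<bar>P m i t - P m i s\<bar> \<le> L * \<bar>t - s\<bar>"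
    if "i \<in> {1..n}" "s \<in> {0..d}" "t \<in> {0..d}" for m i s t
    using P_lip[OF that(1), of s t m] P_lip[OF that(1), of t s m] that
    by (cases "s \<le> t") (auto simp: abs_minus_commute)
  have P_0: "P m i 0 = x0 i" for m i
    unfolding P_def using euler_polygon_grid[of "h m" 0 "Suc m" F x0 i] less_imp_le[OF h(1)[of m]] by simp
  \<comment> \<open>Distinct component indices are at distance at least 1, so equicontinuity on this
    product only has to compare values of one component.\<close>
  define S where "S = {0..d} \<times> real ` {1..n}"
  define G where "G m p = P m (nat \<lfloor>snd p\<rfloor>) (fst p)" for m and p :: "real \<times> real"
  define M where "M = Max ((\<lambda>i. \<bar>x0 i\<bar>) ` {1..n}) + L * d"
  have S_compact: "compact S" unfolding S_def by (intro compact_Times compact_Icc finite_imp_compact) auto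
  have G_bound: "norm (G m p) \<le> M" if pS: "p \<in> S" for m p
  proof -
    obtain t i where p: "p = (t, real i)" "t \<in> {0..d}" "i \<in> {1..n}" using pS by (auto simp: S_def)
    have "\<bar>P m i t - x0 i\<bar> \<le> L * \<bar>t - 0\<bar>" using P_lip'[of i 0 t m] p d by (simp add: P_0)
    also have "\<dots> \<le> L * d" using p \<open>0 \<le> L\<close> by (intro mult_left_mono) auto
    finally have "\<bar>P m i t\<bar> \<le> \<bar>x0 i\<bar> + L * d" by linarith
    also have "\<bar>x0 i\<bar> \<le> Max ((\<lambda>i. \<bar>x0 i\<bar>) ` {1..n})" using p by (intro Max_ge) auto
    finally show ?thesis by (simp add: G_def p M_def)
  qed
  have G_equi: "\<exists>r>0. \<forall>m q. q \<in> S \<and> norm (p - q) < r \<longrightarrow> norm (G m p - G m q) < e"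
    if p: "p \<in> S" and e: "0 < e" for p e
  proof (intro exI conjI allI impI)
    show "0 < min 1 (e / (L + 1))" using e \<open>0 \<le> L\<close> by simp
    fix m q assume q: "q \<in> S \<and> norm (p - q) < min 1 (e / (L + 1))"
    obtain t i where p': "p = (t, real i)" "t \<in> {0..d}" "i \<in> {1..n}" using p by (auto simp: S_def)
    obtain s j where q': "q = (s, real j)" "s \<in> {0..d}" "j \<in> {1..n}" using q by (auto simp: S_def)
    have "\<bar>t - s\<bar> \<le> norm (p - q)" "\<bar>real i - real j\<bar> \<le> norm (p - q)"
      using norm_fst_le[of "t - s" "real i - real j"] norm_snd_le[of "real i - real j" "t - s"]
      by (auto simp: p' q')
    then have "\<bar>t - s\<bar> < e / (L + 1)" "\<bar>real i - real j\<bar> < 1" using q by auto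
    then have "i = j" by linarith
    have "\<bar>P m i t - P m i s\<bar> \<le> L * \<bar>t - s\<bar>" using P_lip' p' q' by blast
    also have "\<dots> \<le> L * (e / (L + 1))"
      using \<open>\<bar>t - s\<bar> < e / (L + 1)\<close> \<open>0 \<le> L\<close> by (intro mult_left_mono) auto
    also have "\<dots> < e" using e \<open>0 \<le> L\<close> by (simp add: field_simps)
    finally show "norm (G m p - G m q) < e" by (simp add: G_def p' q' \<open>i = j\<close>)
  qed
  obtain g r where "continuous_on S g" and g: "strict_mono (r :: nat \<Rightarrow> nat)"
    "\<And>e. 0 < e \<Longrightarrow> \<exists>N. \<forall>m p. m \<ge> N \<and> p \<in> S \<longrightarrow> norm (G (r m) p - g p) < e"
    using Arzela_Ascoli[OF S_compact G_bound G_equi] by (metis (no_types, lifting))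
  define x where "x i t = g (t, real i)" for i t
  have conv: "\<exists>N. \<forall>m\<ge>N. \<forall>i\<in>{1..n}. \<forall>t\<in>{0..d}. \<bar>P (r m) i t - x i t\<bar> < e" if e: "0 < e" for e
  proof -
    obtain N where N: "\<And>m p. m \<ge> N \<Longrightarrow> p \<in> S \<Longrightarrow> norm (G (r m) p - g p) < e" using g(2)[OF e] by blast
    have "\<bar>P (r m) i t - x i t\<bar> < e" if "m \<ge> N" "i \<in> {1..n}" "t \<in> {0..d}" for m i t
      using N[of m "(t, real i)"] that by (auto simp: S_def G_def x_def)
    then show ?thesis by blast
  qed
  have lim: "(\<lambda>m. P (r m) i t) \<longlonglongrightarrow> x i t" if "i \<in> {1..n}" "t \<in> {0..d}" for i t
    unfolding lim_sequentially dist_real_def using conv that by meson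
  have h_lim: "(\<lambda>m. h (r m)) \<longlonglongrightarrow> 0"
  proof -
    have "h \<longlonglongrightarrow> 0" unfolding h_def using LIMSEQ_Suc[OF lim_const_over_n[of d]] by simp
    then show ?thesis using LIMSEQ_subseq_LIMSEQ[OF _ g(1)] by (auto simp: o_def)
  qed
  have x_lip: "\<bar>x i t - x i s\<bar> \<le> L * (t - s)" if "i \<in> {1..n}" "0 \<le> s" "s \<le> t" "t \<le> d" for i s t
  proof (rule LIMSEQ_le_const2)
    show "(\<lambda>m. \<bar>P (r m) i t - P (r m) i s\<bar>) \<longlonglongrightarrow> \<bar>x i t - x i s\<bar>"
      using that by (intro tendsto_intros lim) auto
    show "\<exists>N. \<forall>m\<ge>N. \<bar>P (r m) i t - P (r m) i s\<bar> \<le> L * (t - s)" using P_lip that by blast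
  qed
  show ?thesis
  proof (rule that)
    show "x i 0 = x0 i" if "i \<in> {1..n}" for i
      using lim[OF that, of 0] d by (simp add: P_0 LIMSEQ_const_iff)
    show "\<bar>x i t - x i s\<bar> \<le> L * (t - s)" if "i \<in> {1..n}" "0 \<le> s" "s \<le> t" "t \<le> d" for i s t
      using x_lip that .
    fix i t v
    assume i: "i \<in> {1..n}" and t: "0 < t" "t < d"
      and cont: "\<And>e. 0 < e \<Longrightarrow> \<exists>r>0. \<forall>s y. \<bar>s - t\<bar> < r \<longrightarrow> (\<forall>j\<in>{1..n}. \<bar>y j - x j t\<bar> < r) \<longrightarrow> \<bar>F i s y - v\<bar> \<le> e"
    \<comment> \<open>Differentiability at \<open>t\<close> is read off from chords around
      \<open>t\<close>: polygons obey the chord estimate by \<open>euler_polygon_increment\<close>,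
      and a non-strict inequality survives the limit. Closeness of \<open>F i\<close> to
      \<open>v\<close> is needed near the limit point only, so \<open>F\<close> may jump
      elsewhere.\<close>
    have main: "\<exists>\<rho>>0. \<forall>a b. t - \<rho> < a \<longrightarrow> a \<le> b \<longrightarrow> b < t + \<rho> \<longrightarrow> \<bar>x i b - x i a - v * (b - a)\<bar> \<le> e * (b - a)"
      if e: "0 < e" for e
    proof -
      obtain w where w: "0 < w" "\<And>s y. \<bar>s - t\<bar> < w \<Longrightarrow> (\<forall>j\<in>{1..n}. \<bar>y j - x j t\<bar> < w) \<Longrightarrow> \<bar>F i s y - v\<bar> \<le> e"
        using cont[OF e] by blast
      \<comment> \<open>With steps below \<open>\<rho>\<close>, a cell that meets the chord starts
        within \<open>2 * \<rho>\<close> of \<open>t\<close>, and its node is within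
        \<open>w / 4 + 2 * L * \<rho>\<close> of the limit at \<open>t\<close>; both distances are
        below \<open>w\<close>. The minimum with \<open>t\<close> and \<open>d - t\<close> keeps the
        chord inside \<open>[0, d]\<close>.\<close>
      define \<rho> where "\<rho> = min (min t (d - t)) (w / (4 * (L + 1)))"
      have \<rho>: "0 < \<rho>" "\<rho> \<le> t" "\<rho> \<le> d - t" "\<rho> \<le> w / (4 * (L + 1))" using t w(1) \<open>0 \<le> L\<close> by (auto simp: \<rho>_def)
      have "\<rho> * (4 * (L + 1)) \<le> w" using \<rho>(4) \<open>0 \<le> L\<close> by (simp add: pos_le_divide_eq)
      then have L\<rho>: "4 * (L * \<rho>) + 4 * \<rho> \<le> w" by (simp add: algebra_simps)
      have "\<bar>x i b - x i a - v * (b - a)\<bar> \<le> e * (b - a)" if ab: "t - \<rho> < a" "a \<le> b" "b < t + \<rho>" for a b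
      proof (rule LIMSEQ_le_const2)
        show "(\<lambda>m. \<bar>P (r m) i b - P (r m) i a - v * (b - a)\<bar>) \<longlonglongrightarrow> \<bar>x i b - x i a - v * (b - a)\<bar>"
          using ab \<rho> by (intro tendsto_intros lim i) auto
        obtain N1 where N1: "\<And>m j s. m \<ge> N1 \<Longrightarrow> j \<in> {1..n} \<Longrightarrow> s \<in> {0..d} \<Longrightarrow> \<bar>P (r m) j s - x j s\<bar> < w / 4"
        proof -
          have "0 < w / 4" using w(1) by simp
          from conv[OF this] show ?thesis using that by meson
        qed
        obtain N2 where N2: "\<And>m. m \<ge> N2 \<Longrightarrow> h (r m) < \<rho>"
          using order_tendstoD(2)[OF h_lim \<rho>(1)] by (auto simp: eventually_sequentially)
        have "\<bar>P (r m) i b - P (r m) i a - v * (b - a)\<bar> \<le> e * (b - a)" if m: "m \<ge> max N1 N2" for m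
          unfolding P_def
        proof (rule euler_polygon_increment)
          show "0 \<le> h (r m)" "0 \<le> a" "a \<le> b" "b \<le> real (Suc (r m)) * h (r m)"
            using h[of "r m"] ab \<rho> by (auto simp del: of_nat_Suc intro: less_imp_le)
          fix k assume k: "k < Suc (r m)" "a < real k * h (r m) + h (r m)" "real k * h (r m) < b"
          let ?s = "real k * h (r m)"
          have hm: "h (r m) < \<rho>" using N2 m by simp
          have s: "\<bar>?s - t\<bar> < 2 * \<rho>" using k ab hm by linarith
          have "0 \<le> ?s" using less_imp_le[OF h(1)] by simp
          moreover have "?s \<le> d" using k(3) ab \<rho> by linarith
          ultimately have sd: "?s \<in> {0..d}" by simp
          have "\<bar>euler_node F x0 (h (r m)) k j - x j t\<bar> < w" if j: "j \<in> {1..n}" for j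
          proof -
            have "euler_node F x0 (h (r m)) k j = P (r m) j ?s"
              unfolding P_def using k less_imp_le[OF h(1)] by (intro euler_polygon_grid[symmetric]) auto
            moreover have "\<bar>P (r m) j ?s - x j ?s\<bar> < w / 4" using N1 m j sd by simp
            moreover have "\<bar>x j ?s - x j t\<bar> \<le> L * \<bar>?s - t\<bar>"
              using x_lip[OF j, of ?s t] x_lip[OF j, of t ?s] sd t by (cases "?s \<le> t") (auto simp: abs_minus_commute)
            moreover have "L * \<bar>?s - t\<bar> \<le> L * (2 * \<rho>)" using s \<open>0 \<le> L\<close> by (intro mult_left_mono) auto
            ultimately show ?thesis using L\<rho> w(1) \<rho>(1) by linarith
          qed
          moreover have "\<bar>?s - t\<bar> < w"
          proof -
            have "0 \<le> L * \<rho>" using \<open>0 \<le> L\<close> \<rho>(1) by simp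
            then show ?thesis using s L\<rho> \<rho>(1) by linarith
          qed
          ultimately show "\<bar>euler_slope F x0 (h (r m)) i k - v\<bar> \<le> e"
            unfolding euler_slope_def using w(2) by blast
        qed
        then show "\<exists>N. \<forall>m\<ge>N. \<bar>P (r m) i b - P (r m) i a - v * (b - a)\<bar> \<le> e * (b - a)" by blast
      qed
      then show ?thesis using \<rho>(1) by blast
    qed
    show "(x i has_real_derivative v) (at t)"
      unfolding has_field_derivative_def has_derivative_at_alt
    proof (intro conjI allI impI)
      show "bounded_linear ((*) v)" by (rule bounded_linear_mult_right)
      fix e :: real assume "0 < e"
      from main[OF this] obtain \<rho> where \<rho>: "\<rho> > 0"
        "\<And>a b. t - \<rho> < a \<Longrightarrow> a \<le> b \<Longrightarrow> b < t + \<rho> \<Longrightarrow> \<bar>x i b - x i a - v * (b - a)\<bar> \<le> e * (b - a)" by blast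
      show "\<exists>d>0. \<forall>y. norm (y - t) < d \<longrightarrow> norm (x i y - x i t - v * (y - t)) \<le> e * norm (y - t)"
      proof (intro exI conjI allI impI)
        fix y assume y: "norm (y - t) < \<rho>"
        show "norm (x i y - x i t - v * (y - t)) \<le> e * norm (y - t)"
        proof (cases "t \<le> y")
          case True
          then show ?thesis using \<rho>(2)[of t y] y by simp
        next
          case False
          then have "\<bar>x i t - x i y - v * (t - y)\<bar> \<le> e * (t - y)" using \<rho>(2)[of y t] y by simp
          moreover have "x i y - x i t - v * (y - t) = - (x i t - x i y - v * (t - y))" by (simp add: algebra_simps)
          ultimately show ?thesis using False by simp
        qed
      qed (use \<rho> in auto)
    qed
  qed
qed

section \<open>The error coordinates\<close>

lemma filippov_solution_derivative:
  assumes "filippov_solution n d0 dinf \<kappa> \<theta> k f \<tau> x"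
  shows "\<exists>N. negligible N \<and> (\<forall>r. r \<notin> N \<longrightarrow> 0 < r \<longrightarrow> ereal r < \<tau> \<longrightarrow> (\<forall>i\<in>{1..n}.
      \<exists>v \<in> differentiator_rhs n d0 dinf \<kappa> \<theta> k (f r) (\<lambda>j. x j r) i. (x i has_real_derivative v) (at r)))"
proof -
  have "AE t in lebesgue. 0 < t \<and> ereal t < \<tau> \<longrightarrow> (\<forall>i\<in>{1..n}.
      \<exists>v \<in> differentiator_rhs n d0 dinf \<kappa> \<theta> k (f t) (\<lambda>j. x j t) i. (x i has_real_derivative v) (at t))"
    using assms unfolding filippov_solution_def by (elim conjE)
  from AE_E[OF this] obtain N where sub: "{r \<in> space lebesgue. \<not> (0 < r \<and> ereal r < \<tau> \<longrightarrow> (\<forall>i\<in>{1..n}.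
      \<exists>v \<in> differentiator_rhs n d0 dinf \<kappa> \<theta> k (f r) (\<lambda>j. x j r) i. (x i has_real_derivative v) (at r)))} \<subseteq> N"
    and "emeasure lebesgue N = 0" "N \<in> sets lebesgue" .
  then have "negligible N" by (simp add: negligible_iff_emeasure0)
  moreover have "r \<in> N" if "0 < r" "ereal r < \<tau>" "\<not> (\<forall>i\<in>{1..n}.
      \<exists>v \<in> differentiator_rhs n d0 dinf \<kappa> \<theta> k (f r) (\<lambda>j. x j r) i. (x i has_real_derivative v) (at r))" for r
    by (rule subsetD[OF sub]) (use that in simp)
  ultimately show ?thesis by blast
qed

context differentiator
begin

section \<open>The set-valued compositions compared with \<open>Phi\<close>\<close>

lemma inj_comp_eq: "i < n \<Longrightarrow> inj_comp n d0 dinf \<kappa> \<theta> i s = {Phi i s}"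
proof (induction i)
  case (Suc i)
  then have "p0 (Suc i) \<noteq> 0" "pinf (Suc i) \<noteq> 0"
    using p0_pos[of "Suc i"] pinf_pos[of "Suc i"] by auto
  then have "inj_term n d0 dinf \<kappa> \<theta> (Suc i) u = {two_power (\<kappa> (Suc i)) (\<theta> (Suc i)) (p0 (Suc i)) (pinf (Suc i)) u}" for u
    unfolding inj_term_def p0_def[symmetric] pinf_def[symmetric] by (simp add: spow_eq two_power_def)
  then show ?case using Suc by simp
qed simp

lemma inj_comp_last:
  "inj_comp n d0 dinf \<kappa> \<theta> n s =
    {\<kappa> n * a + \<theta> n * b | a b. a \<in> spow (Phi (n - 1) s) (p0 n) \<and> b \<in> spow (Phi (n - 1) s) (pinf n)}"
proof -
  have n: "n = Suc (n - 1)" using n_ge by simp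
  have "inj_comp n d0 dinf \<kappa> \<theta> (Suc (n - 1)) s = inj_term n d0 dinf \<kappa> \<theta> (Suc (n - 1)) (Phi (n - 1) s)"
    using inj_comp_eq[of "n - 1" s] n_ge by (simp only: inj_comp.simps) simp
  then show ?thesis unfolding n[symmetric] inj_term_def p0_def pinf_def .
qed

lemma Phi_0 [simp]: "Phi i 0 = 0"
  using Phi_minus[of i 0] by simp

lemma Phi_neq_0: "i \<le> n \<Longrightarrow> s \<noteq> 0 \<Longrightarrow> Phi i s \<noteq> 0"
  using Phi_pos[of i s] Phi_pos[of i "- s"] by (cases "0 < s") (auto simp: Phi_minus)

lemma inj_comp_nonzero:
  assumes "i \<le> n" "s \<noteq> 0"
  shows "inj_comp n d0 dinf \<kappa> \<theta> i s = {Phi i s}"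
proof (cases "i = n")
  case True
  have "Phi (n - 1) s \<noteq> 0" using Phi_neq_0[of "n - 1" s] assms by simp
  then show ?thesis unfolding True inj_comp_last Phi_last two_power_def by (simp add: spow_eq)
qed (use assms inj_comp_eq in auto)

lemma inj_comp_abs_le:
  assumes "i \<le> n" "p \<in> inj_comp n d0 dinf \<kappa> \<theta> i s" "\<bar>s\<bar> \<le> B" "0 < B"
  shows "\<bar>p\<bar> \<le> Phi i B"
proof -
  have mono: "\<bar>Phi j s\<bar> \<le> Phi j B" if "j \<le> n" for j
    using monoD[OF Phi_mono[OF that], of s B] monoD[OF Phi_mono[OF that], of "- B" s] assms(3)
    unfolding Phi_minus abs_le_iff by linarith
  show ?thesis
  proof (cases "i = n")
    case True
    obtain a b where ab: "p = \<kappa> n * a + \<theta> n * b" "a \<in> spow (Phi (n - 1) s) (p0 n)" "b \<in> spow (Phi (n - 1) s) (pinf n)"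
      using assms(2) unfolding True inj_comp_last by blast
    have B: "\<bar>Phi (n - 1) s\<bar> \<le> Phi (n - 1) B" "0 < Phi (n - 1) B"
      using mono[of "n - 1"] Phi_pos[of "n - 1" B] assms(4) by auto
    have "\<bar>a\<bar> \<le> signed_powr (Phi (n - 1) B) (p0 n)" "\<bar>b\<bar> \<le> signed_powr (Phi (n - 1) B) (pinf n)"
      using spow_abs_le[OF ab(2) B] spow_abs_le[OF ab(3) B] p0_nonneg[of n] pinf_nonneg[of n] n_ge by auto
    moreover have "\<kappa> n > 0" "\<theta> n > 0" using \<kappa>_pos[of n] \<theta>_pos[of n] n_ge by auto
    moreover have "\<bar>p\<bar> \<le> \<kappa> n * \<bar>a\<bar> + \<theta> n * \<bar>b\<bar>"
      using calculation(3,4) unfolding ab(1) by (intro order_trans[OF abs_triangle_ineq]) (simp add: abs_mult)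
    ultimately show ?thesis
      unfolding True Phi_last two_power_def
      by (meson add_mono less_imp_le mult_left_mono order_trans)
  next
    case False
    then show ?thesis using assms inj_comp_eq[of i s] mono[of i] by auto
  qed
qed

lemma zero_in_inj_comp: "i \<le> n \<Longrightarrow> 0 \<in> inj_comp n d0 dinf \<kappa> \<theta> i 0"
proof (cases "i = n")
  case True
  have "0 \<in> spow 0 p" for p by (simp add: spow_def)
  then have "\<exists>a b. 0 = \<kappa> n * a + \<theta> n * b \<and> a \<in> spow 0 (p0 n) \<and> b \<in> spow 0 (pinf n)"
    by (intro exI[of _ 0]) auto
  then show ?thesis unfolding True inj_comp_last by simp
qed (use inj_comp_eq[of i 0] in auto)

text \<open>At zero error the sign term can take any value up to \<open>\<kappa> n\<close>, which is
  enough to follow a signal with bounded derivative of order \<open>n\<close>.\<close>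

lemma interval_subset_inj_comp:
  assumes "d0 = -1" "\<bar>w\<bar> \<le> 1"
  shows "\<kappa> n * w \<in> inj_comp n d0 dinf \<kappa> \<theta> n 0"
proof -
  have "p0 n = 0" unfolding p0_last using assms(1) by simp
  then have "\<kappa> n * w = \<kappa> n * w + \<theta> n * 0" "w \<in> spow 0 (p0 n)" "0 \<in> spow 0 (pinf n)"
    using assms(2) by (auto simp: spow_def)
  then show ?thesis unfolding inj_comp_last Phi_0 by blast
qed

lemma Phi_last_ge:
  assumes "d0 = -1" "0 < s"
  shows "\<kappa> n \<le> Phi n s"
proof -
  have pos: "0 < Phi (n - 1) s" using Phi_pos[of "n - 1" s] assms by simp
  have "0 \<le> \<theta> n * Phi (n - 1) s powr pinf n" using \<theta>_pos[of n] n_ge by simp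
  moreover have "p0 n = 0" unfolding p0_last using assms(1) by simp
  ultimately show ?thesis unfolding Phi_last using pos by (simp add: two_power_pos_eq)
qed

end

locale differentiator_gains = differentiator +
  fixes k K :: "nat \<Rightarrow> real"
  assumes K_pos: "\<And>i. i \<in> {1..n} \<Longrightarrow> 0 < K i"
    and k_0: "k 0 = 1" and k_Suc: "\<And>i. k (Suc i) = k i * K (Suc i)"
    and k_last: "d0 = -1 \<Longrightarrow> 2 * \<Delta> \<le> k n * \<kappa> n"
begin

lemma k_pos: "i \<le> n \<Longrightarrow> 0 < k i"
  by (induction i) (auto simp: k_0 k_Suc K_pos)

lemma k_eq: "1 \<le> i \<Longrightarrow> k i = k (i - 1) * K i"
  using k_Suc[of "i - 1"] by simp

text \<open>For \<open>d0 = -1\<close> the jump makes \<open>Phi n s\<close> at least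
  \<open>\<kappa> n\<close> however small \<open>s\<close> is, and the factor 2 in
  \<open>k_last\<close> leaves half of it for the descent. Otherwise there is no disturbance. This
  half is the factor 1/2 in \<open>trajectory\<close>.\<close>

lemma disturbance_le:
  assumes "\<bar>w\<bar> * k n \<le> \<Delta>" "0 < s"
  shows "\<bar>w\<bar> \<le> Phi n s / 2"
proof (cases "d0 = -1")
  case True
  have "2 * (\<bar>w\<bar> * k n) \<le> k n * Phi n s"
    using assms(1) k_last[OF True] mult_left_mono[OF Phi_last_ge[OF True assms(2)], of "k n"] k_pos[of n] by linarith
  then have "(2 * \<bar>w\<bar>) * k n \<le> Phi n s * k n" by (simp add: algebra_simps)
  then show ?thesis using k_pos[of n] by simp
next
  case False
  then have "\<bar>w\<bar> * k n \<le> 0" using assms(1) d0_ge \<Delta>_zero by simp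
  then have "w = 0" using k_pos[of n] by (simp add: mult_le_0_iff)
  then show ?thesis using Phi_pos[of n s] assms(2) by simp
qed

end

locale differentiator_signal = differentiator_gains +
  fixes f f0 :: "real \<Rightarrow> real"
  assumes f_eq: "\<And>t. 0 \<le> t \<Longrightarrow> f t = f0 t" and f0_diff: "n_times_differentiable n f0"
    and f0_bound: "\<And>t. 0 \<le> t \<Longrightarrow> \<bar>nderiv n f0 t\<bar> \<le> \<Delta>"
begin

definition err :: "(nat \<Rightarrow> real \<Rightarrow> real) \<Rightarrow> nat \<Rightarrow> real \<Rightarrow> real" where
  "err x i t = x i t - nderiv (i - 1) f0 t"

text \<open>The value 0 beyond \<open>n\<close> gives the last error equation the same form as the
  others, since \<open>Phi n 0 = 0\<close>.\<close>

definition coord :: "(nat \<Rightarrow> real \<Rightarrow> real) \<Rightarrow> nat \<Rightarrow> real \<Rightarrow> real" where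
  "coord x i t = (if i \<le> n then inv (Phi (i - 1)) (err x i t / k (i - 1)) else 0)"

lemma Phi_coord: "i \<in> {1..n} \<Longrightarrow> Phi (i - 1) (coord x i t) = err x i t / k (i - 1)"
  using surj_f_inv_f[OF Phi_surj[of "i - 1"]] by (auto simp: coord_def)

lemma coord_1: "0 \<le> t \<Longrightarrow> coord x 1 t = x 1 t - f t"
  using Phi_coord[of 1 x t] n_ge by (simp add: k_0 err_def f_eq)

lemma err_eq: "i \<in> {1..n} \<Longrightarrow> err x i t = k (i - 1) * Phi (i - 1) (coord x i t)"
  using k_pos[of "i - 1"] by (subst Phi_coord) force+

text \<open>Admissible derivatives of \<open>Phi (i - 1) (coord x i)\<close>. Here \<open>w\<close>
  stands for the derivative of order \<open>n\<close> of the signal divided by \<open>k n\<close>,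
  so it appears in the last equation only.\<close>

definition velocity :: "(nat \<Rightarrow> real \<Rightarrow> real) \<Rightarrow> nat \<Rightarrow> real \<Rightarrow> real set" where
  "velocity x i t = {- K i * (p - Phi i (coord x (i + 1) t) + w) | p w.
     p \<in> inj_comp n d0 dinf \<kappa> \<theta> i (coord x 1 t) \<and> (i < n \<longrightarrow> w = 0) \<and> \<bar>w\<bar> * k n \<le> \<Delta>}"

lemma err_derivative:
  assumes i: "i \<in> {1..n}" and t: "0 < t"
    and v: "v \<in> differentiator_rhs n d0 dinf \<kappa> \<theta> k (f t) (\<lambda>j. x j t) i" "(x i has_real_derivative v) (at t)"
  shows "\<exists>v\<in>velocity x i t. (err x i has_real_derivative k (i - 1) * v) (at t)"
proof -
  obtain p where p: "p \<in> inj_comp n d0 dinf \<kappa> \<theta> i (x 1 t - f t)"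
    "v = - k i * p + (if i < n then x (i + 1) t else 0)"
    using v(1) by (auto simp: differentiator_rhs_def)
  define w where "w = (if i < n then 0 else nderiv n f0 t / k n)"
  have kn: "k n > 0" using k_pos by simp
  have "\<bar>w\<bar> * k n \<le> \<Delta>"
    using kn f0_bound[of t] t \<Delta>_nonneg by (simp add: w_def)
  have "(nderiv (i - 1) f0 has_real_derivative nderiv i f0 t) (at t)"
  proof -
    have "i - 1 < n" "Suc (i - 1) = i" using i by auto
    then show ?thesis using nderiv_has_real_derivative[OF f0_diff, of "i - 1" t] t by (simp only:)
  qed
  then have "(err x i has_real_derivative v - nderiv i f0 t) (at t)"
    unfolding err_def using v(2) by (intro DERIV_diff)
  moreover have "v - nderiv i f0 t = k (i - 1) * (- K i * (p - Phi i (coord x (i + 1) t) + w))"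
  proof (cases "i < n")
    case True
    have "x (i + 1) t - nderiv i f0 t = k i * Phi i (coord x (i + 1) t)"
      using err_eq[of "i + 1" x t] True by (simp add: err_def)
    then have "v - nderiv i f0 t = - k i * (p - Phi i (coord x (i + 1) t) + w)"
      using True by (simp add: p w_def algebra_simps)
    then show ?thesis using i by (simp add: k_eq[of i])
  next
    case False
    then have "i = n" using i by simp
    have "v - nderiv n f0 t = - k n * (p + w)" using kn by (simp add: p w_def \<open>i = n\<close> distrib_left)
    then show ?thesis using i by (simp add: \<open>i = n\<close> coord_def k_eq[of n])
  qed
  ultimately have "(err x i has_real_derivative k (i - 1) * (- K i * (p - Phi i (coord x (i + 1) t) + w))) (at t)"
    by simp
  moreover have "- K i * (p - Phi i (coord x (i + 1) t) + w) \<in> velocity x i t"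
  proof -
    have "p \<in> inj_comp n d0 dinf \<kappa> \<theta> i (coord x 1 t)" using p(1) coord_1[of t x] t by simp
    moreover have "i < n \<longrightarrow> w = 0" by (simp add: w_def)
    ultimately show ?thesis unfolding velocity_def using \<open>\<bar>w\<bar> * k n \<le> \<Delta>\<close> by blast
  qed
  ultimately show ?thesis by blast
qed

lemma err_abs_continuous:
  assumes "filippov_solution n d0 dinf \<kappa> \<theta> k f \<tau> x" "i \<in> {1..n}" "0 \<le> t" "ereal t < \<tau>"
  shows "abs_continuous_on 0 t (err x i)"
  unfolding err_def
proof (rule abs_continuous_on_diff)
  show "abs_continuous_on 0 t (x i)" using assms by (auto simp: filippov_solution_def)
  have "i - 1 < n" using assms by auto
  then obtain L where L: "\<forall>u\<in>{0..t}. \<forall>v\<in>{0..t}. \<bar>nderiv (i - 1) f0 v - nderiv (i - 1) f0 u\<bar> \<le> L * \<bar>v - u\<bar>"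
    using nderiv_lipschitz[OF f0_diff _ f0_bound] by blast
  show "abs_continuous_on 0 t (nderiv (i - 1) f0)"
  proof (rule abs_continuous_on_lipschitz)
    fix u v assume "0 \<le> u" "u \<le> v" "v \<le> t"
    moreover from this have "u \<in> {0..t}" "v \<in> {0..t}" by auto
    with L have "\<bar>nderiv (i - 1) f0 v - nderiv (i - 1) f0 u\<bar> \<le> L * \<bar>v - u\<bar>" by blast
    ultimately show "\<bar>nderiv (i - 1) f0 v - nderiv (i - 1) f0 u\<bar> \<le> L * (v - u)" by simp
  qed
qed

lemma solution_err_derivative:
  assumes sol: "filippov_solution n d0 dinf \<kappa> \<theta> k f \<tau> x" and i: "i \<in> {1..n}" and st: "0 \<le> s" "ereal t < \<tau>"
  shows "\<exists>N. negligible N \<and>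
    (\<forall>r\<in>{s<..<t} - N. \<exists>v\<in>velocity x i r. (err x i has_real_derivative k (i - 1) * v) (at r))"
proof -
  obtain N where N: "negligible N" "\<And>r. r \<notin> N \<Longrightarrow> 0 < r \<Longrightarrow> ereal r < \<tau> \<Longrightarrow> \<forall>i\<in>{1..n}.
      \<exists>v \<in> differentiator_rhs n d0 dinf \<kappa> \<theta> k (f r) (\<lambda>j. x j r) i. (x i has_real_derivative v) (at r)"
    using filippov_solution_derivative[OF sol] by blast
  have "\<exists>v\<in>velocity x i r. (err x i has_real_derivative k (i - 1) * v) (at r)" if r: "r \<in> {s<..<t} - N" for r
  proof -
    have rr: "0 < r" "ereal r < \<tau>" "r \<notin> N" using r st(1) by (auto intro: le_less_trans[OF _ st(2)])
    obtain v where "v \<in> differentiator_rhs n d0 dinf \<kappa> \<theta> k (f r) (\<lambda>j. x j r) i" "(x i has_real_derivative v) (at r)"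
      using N(2)[OF rr(3,1,2)] i by blast
    then show ?thesis by (rule err_derivative[OF i rr(1)])
  qed
  then show ?thesis using N(1) by blast
qed

text \<open>Passage from the inclusion, valid almost everywhere, to the integrated form in
  \<open>trajectory\<close>. It is applied to the error, which is absolutely continuous, and
  rescaled by \<open>k (i - 1)\<close> afterwards.\<close>

lemma
  assumes sol: "filippov_solution n d0 dinf \<kappa> \<theta> k f \<tau> x" and i: "i \<in> {1..n}" and st: "0 \<le> s" "s \<le> t" "ereal t < \<tau>"
  shows coord_increment_le: "(\<And>r v. s \<le> r \<Longrightarrow> r \<le> t \<Longrightarrow> v \<in> velocity x i r \<Longrightarrow> v \<le> c) \<Longrightarrow>
      Phi (i - 1) (coord x i t) - Phi (i - 1) (coord x i s) \<le> c * (t - s)"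
    and coord_increment_ge: "(\<And>r v. s \<le> r \<Longrightarrow> r \<le> t \<Longrightarrow> v \<in> velocity x i r \<Longrightarrow> c \<le> v) \<Longrightarrow>
      c * (t - s) \<le> Phi (i - 1) (coord x i t) - Phi (i - 1) (coord x i s)"
proof -
  obtain N where N: "negligible N"
    "\<And>r. r \<in> {s<..<t} - N \<Longrightarrow> \<exists>v\<in>velocity x i r. (err x i has_real_derivative k (i - 1) * v) (at r)"
    using solution_err_derivative[OF sol i st(1,3)] by blast
  have ki: "k (i - 1) > 0" using k_pos[of "i - 1"] i by auto
  have ac: "abs_continuous_on s t (err x i)"
    by (rule abs_continuous_on_subinterval[OF err_abs_continuous[OF sol i _ st(3)]]) (use st in auto)
  have eq: "err x i t - err x i s = k (i - 1) * (Phi (i - 1) (coord x i t) - Phi (i - 1) (coord x i s))"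
    using i by (simp add: err_eq algebra_simps)
  {
    assume bound: "\<And>r v. s \<le> r \<Longrightarrow> r \<le> t \<Longrightarrow> v \<in> velocity x i r \<Longrightarrow> v \<le> c"
    have "err x i t - err x i s \<le> (k (i - 1) * c) * (t - s)"
    proof (rule abs_continuous_on_increment_le[OF st(2) ac N(1)])
      fix r assume r: "r \<in> {s<..<t} - N"
      from N(2)[OF r] obtain v where v: "v \<in> velocity x i r" "(err x i has_real_derivative k (i - 1) * v) (at r)" ..
      have "v \<le> c" using bound[OF _ _ v(1)] r by auto
      then have "k (i - 1) * v \<le> k (i - 1) * c" using ki by simp
      then show "\<exists>v\<le>k (i - 1) * c. (err x i has_real_derivative v) (at r)" using v(2) by blast
    qed
    then show "Phi (i - 1) (coord x i t) - Phi (i - 1) (coord x i s) \<le> c * (t - s)"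
      unfolding eq mult.assoc using ki by simp
  next
    assume bound: "\<And>r v. s \<le> r \<Longrightarrow> r \<le> t \<Longrightarrow> v \<in> velocity x i r \<Longrightarrow> c \<le> v"
    have "(k (i - 1) * c) * (t - s) \<le> err x i t - err x i s"
    proof (rule abs_continuous_on_increment_ge[OF st(2) ac N(1)])
      fix r assume r: "r \<in> {s<..<t} - N"
      from N(2)[OF r] obtain v where v: "v \<in> velocity x i r" "(err x i has_real_derivative k (i - 1) * v) (at r)" ..
      have "c \<le> v" using bound[OF _ _ v(1)] r by auto
      then have "k (i - 1) * c \<le> k (i - 1) * v" using ki by simp
      then show "\<exists>v\<ge>k (i - 1) * c. (err x i has_real_derivative v) (at r)" using v(2) by blast
    qed
    then show "c * (t - s) \<le> Phi (i - 1) (coord x i t) - Phi (i - 1) (coord x i s)"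
      unfolding eq mult.assoc using ki by simp
  }
qed

lemma coord_continuous:
  assumes "filippov_solution n d0 dinf \<kappa> \<theta> k f \<tau> x" "i \<in> {1..n}" "ereal t < \<tau>"
  shows "continuous_on {0..t} (coord x i)"
proof (cases "0 \<le> t")
  case True
  have i: "i - 1 < n" using assms(2) by auto
  \<comment> \<open>A monotone function with open range is continuous.\<close>
  have "continuous_on UNIV (inv (Phi (i - 1)))"
  proof (rule continuous_onI_mono)
    have "range (inv (Phi (i - 1))) = UNIV"
      using inv_f_f[OF strict_mono_imp_inj_on[OF Phi_strict_mono[OF i]]] by (metis surjI)
    then show "open (range (inv (Phi (i - 1))))" by simp
    fix x y :: real assume "x \<le> y"
    then have "Phi (i - 1) (inv (Phi (i - 1)) x) \<le> Phi (i - 1) (inv (Phi (i - 1)) y)"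
      by (simp only: surj_f_inv_f[OF Phi_surj[OF i]])
    then show "inv (Phi (i - 1)) x \<le> inv (Phi (i - 1)) y"
      using strict_mono_less_eq[OF Phi_strict_mono[OF i]] by simp
  qed
  moreover have "continuous_on {0..t} (\<lambda>t. err x i t / k (i - 1))"
    using abs_continuous_on_imp_continuous_on[OF err_abs_continuous[OF assms(1,2) True assms(3)]] k_pos[of "i - 1"] i
    by (intro continuous_intros) auto
  ultimately have "continuous_on {0..t} (\<lambda>t. inv (Phi (i - 1)) (err x i t / k (i - 1)))"
    by (rule continuous_on_compose2) auto
  then show ?thesis using assms(2) by (simp add: coord_def)
qed auto

sublocale injection_chain n Phi by (rule injection_chain_Phi)

text \<open>The strict inequality between \<open>coord x 1\<close> and
  \<open>coord x (i + 1)\<close> excludes the multi-valued point: for \<open>i = n\<close> it says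
  that \<open>coord x 1\<close> is not 0, and below \<open>n\<close> the terms are single-valued
  everywhere.\<close>

lemma solution_trajectory:
  assumes sol: "filippov_solution n d0 dinf \<kappa> \<theta> k f \<tau> x"
  shows "trajectory K \<tau> (coord x)"
  unfolding trajectory_def
proof (intro conjI ballI allI impI)
  fix i t assume "i \<in> {1..n}" "ereal t < \<tau>"
  then show "continuous_on {0..t} (coord x i)" by (rule coord_continuous[OF sol])
next
  show "coord x (n + 1) t = 0" for t by (simp add: coord_def)
next
  fix i s t m assume *: "i \<in> {1..n}" "0 \<le> s" "s \<le> t" "ereal t < \<tau>"
    and m: "\<forall>r\<in>{s..t}. coord x (i + 1) r < coord x 1 r \<and> m \<le> Phi i (coord x 1 r) - Phi i (coord x (i + 1) r)"
  have "Phi (i - 1) (coord x i t) - Phi (i - 1) (coord x i s) \<le> (- (K i / 2 * m)) * (t - s)"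
  proof (rule coord_increment_le[OF sol *])
    fix r v assume r: "s \<le> r" "r \<le> t" and "v \<in> velocity x i r"
    then obtain p w where v: "v = - K i * (p - Phi i (coord x (i + 1) r) + w)"
      and p: "p \<in> inj_comp n d0 dinf \<kappa> \<theta> i (coord x 1 r)" and w: "i < n \<longrightarrow> w = 0" "\<bar>w\<bar> * k n \<le> \<Delta>"
      by (auto simp: velocity_def)
    let ?D = "Phi i (coord x 1 r) - Phi i (coord x (i + 1) r)"
    have lt: "coord x (i + 1) r < coord x 1 r" "m \<le> ?D" using m r by auto
    \<comment> \<open>Below \<open>n\<close> the drift equals \<open>?D\<close>, which is positive;
      at \<open>n\<close> the disturbance takes at most half of
      \<open>?D = Phi n (coord x 1 r)\<close>.\<close>
    have "?D / 2 \<le> p - Phi i (coord x (i + 1) r) + w"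
    proof (cases "i < n")
      case True
      then have "0 < ?D" using strict_monoD[OF Phi_strict_mono lt(1)] by simp
      then show ?thesis using True w p inj_comp_eq[OF True] by simp
    next
      case False
      then have "i = n" using * by simp
      then have "0 < coord x 1 r" using lt(1) by (simp add: coord_def)
      then show ?thesis
        using disturbance_le[OF w(2) \<open>0 < coord x 1 r\<close>] p inj_comp_nonzero[of n "coord x 1 r"]
        by (simp add: \<open>i = n\<close>) (simp add: coord_def abs_le_iff)
    qed
    then have "K i * (m / 2) \<le> K i * (p - Phi i (coord x (i + 1) r) + w)"
      using lt K_pos[OF *(1)] by (intro mult_left_mono) auto
    then show "v \<le> - (K i / 2 * m)" by (simp add: v)
  qed
  then show "Phi (i - 1) (coord x i t) + K i / 2 * m * (t - s) \<le> Phi (i - 1) (coord x i s)" by simp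
next
  fix i s t m assume *: "i \<in> {1..n}" "0 \<le> s" "s \<le> t" "ereal t < \<tau>"
    and m: "\<forall>r\<in>{s..t}. coord x 1 r < coord x (i + 1) r \<and> m \<le> Phi i (coord x (i + 1) r) - Phi i (coord x 1 r)"
  have "(K i / 2 * m) * (t - s) \<le> Phi (i - 1) (coord x i t) - Phi (i - 1) (coord x i s)"
  proof (rule coord_increment_ge[OF sol *])
    fix r v assume r: "s \<le> r" "r \<le> t" and "v \<in> velocity x i r"
    then obtain p w where v: "v = - K i * (p - Phi i (coord x (i + 1) r) + w)"
      and p: "p \<in> inj_comp n d0 dinf \<kappa> \<theta> i (coord x 1 r)" and w: "i < n \<longrightarrow> w = 0" "\<bar>w\<bar> * k n \<le> \<Delta>"
      by (auto simp: velocity_def)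
    let ?D = "Phi i (coord x (i + 1) r) - Phi i (coord x 1 r)"
    have lt: "coord x 1 r < coord x (i + 1) r" "m \<le> ?D" using m r by auto
    have "?D / 2 \<le> - (p - Phi i (coord x (i + 1) r) + w)"
    proof (cases "i < n")
      case True
      then have "0 < ?D" using strict_monoD[OF Phi_strict_mono lt(1)] by simp
      then show ?thesis using True w p inj_comp_eq[OF True] by simp
    next
      case False
      then have "i = n" using * by simp
      then have "0 < - coord x 1 r" using lt(1) by (simp add: coord_def)
      then show ?thesis
        using disturbance_le[OF w(2) \<open>0 < - coord x 1 r\<close>] p inj_comp_nonzero[of n "coord x 1 r"]
        by (simp add: \<open>i = n\<close>) (simp add: coord_def abs_le_iff Phi_minus)
    qed
    then have "K i * (m / 2) \<le> K i * (- (p - Phi i (coord x (i + 1) r) + w))"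
      using lt K_pos[OF *(1)] by (intro mult_left_mono) auto
    then show "K i / 2 * m \<le> v" by (simp add: v algebra_simps)
  qed
  then show "Phi (i - 1) (coord x i s) + K i / 2 * m * (t - s) \<le> Phi (i - 1) (coord x i t)" by simp
next
  fix i s t B assume *: "i \<in> {1..n}" "0 \<le> s" "s \<le> t" "ereal t < \<tau>" and "0 < B"
    and B: "\<forall>r\<in>{s..t}. \<bar>coord x 1 r\<bar> \<le> B \<and> \<bar>coord x (i + 1) r\<bar> \<le> B"
  have bound: "\<bar>v\<bar> \<le> 4 * K i * Phi i B" if "s \<le> r" "r \<le> t" and vel: "v \<in> velocity x i r" for r v
  proof -
    obtain p w where v: "v = - K i * (p - Phi i (coord x (i + 1) r) + w)"
      and p: "p \<in> inj_comp n d0 dinf \<kappa> \<theta> i (coord x 1 r)" and w: "i < n \<longrightarrow> w = 0" "\<bar>w\<bar> * k n \<le> \<Delta>"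
      using vel by (auto simp: velocity_def)
    have "\<bar>p\<bar> \<le> Phi i B" using inj_comp_abs_le[OF _ p, of B] B that * \<open>0 < B\<close> by auto
    moreover have "\<bar>Phi i (coord x (i + 1) r)\<bar> \<le> Phi i B"
    proof -
      have "\<bar>coord x (i + 1) r\<bar> \<le> B" using B that(1,2) by simp
      then have "coord x (i + 1) r \<le> B" "- B \<le> coord x (i + 1) r" by linarith+
      then have "Phi i (coord x (i + 1) r) \<le> Phi i B" "Phi i (- B) \<le> Phi i (coord x (i + 1) r)"
        using *(1) by (auto intro!: monoD)
      then show ?thesis by (simp add: Phi_minus abs_le_iff)
    qed
    moreover have "\<bar>w\<bar> \<le> Phi i B"
    proof (cases "i < n")
      case False
      then show ?thesis using disturbance_le[OF w(2) \<open>0 < B\<close>] * Phi_pos[of n B] \<open>0 < B\<close> by simp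
    qed (use w Phi_pos[of i B] \<open>0 < B\<close> in simp)
    moreover have "0 < Phi i B" using Phi_pos[of i B] * \<open>0 < B\<close> by simp
    \<comment> \<open>Three terms, each at most \<open>Phi i B\<close>.\<close>
    ultimately have "\<bar>p - Phi i (coord x (i + 1) r) + w\<bar> \<le> 4 * Phi i B" by linarith
    then have "K i * \<bar>p - Phi i (coord x (i + 1) r) + w\<bar> \<le> K i * (4 * Phi i B)"
      using K_pos[OF *(1)] by (intro mult_left_mono) auto
    then show ?thesis using K_pos[OF *(1)] by (simp add: v abs_mult)
  qed
  have "Phi (i - 1) (coord x i t) - Phi (i - 1) (coord x i s) \<le> (4 * K i * Phi i B) * (t - s)"
    by (rule coord_increment_le[OF sol *]) (use bound in \<open>meson abs_le_D1\<close>)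
  moreover have "(- (4 * K i * Phi i B)) * (t - s) \<le> Phi (i - 1) (coord x i t) - Phi (i - 1) (coord x i s)"
    by (rule coord_increment_ge[OF sol *]) (use bound in \<open>meson abs_le_D2 minus_le_iff\<close>)
  ultimately show "\<bar>Phi (i - 1) (coord x i t) - Phi (i - 1) (coord x i s)\<bar> \<le> 4 * K i * Phi i B * (t - s)"
    by (simp add: abs_le_iff)
qed

end

section \<open>Continuation of solutions\<close>

text \<open>Rational endpoints around each point, within its isolation radius, inject
  \<open>A\<close> into pairs of rationals. Isolation is meant in the larger set \<open>B\<close>,
  as the zeros that are removed at each stage are isolated among those of the previous one.\<close>

lemma countable_isolated_points:
  fixes A :: "real set"
  assumes "A \<subseteq> B" and "\<And>s. s \<in> A \<Longrightarrow> \<exists>r>0. \<forall>t\<in>B. \<bar>t - s\<bar> < r \<longrightarrow> t = s"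
  shows "countable A"
proof -
  obtain r where r: "\<And>s. s \<in> A \<Longrightarrow> 0 < r s" "\<And>s t. s \<in> A \<Longrightarrow> t \<in> B \<Longrightarrow> \<bar>t - s\<bar> < r s \<Longrightarrow> t = s"
    using assms(2) by metis
  have "\<exists>q. q \<in> \<rat> \<and> s < q \<and> q < s + r s / 2" if "s \<in> A" for s
    using Rats_dense_in_real[of s "s + r s / 2"] r(1)[OF that] by auto
  then obtain q where q: "\<And>s. s \<in> A \<Longrightarrow> q s \<in> \<rat> \<and> s < q s \<and> q s < s + r s / 2" by metis
  have "\<exists>p. p \<in> \<rat> \<and> s - r s / 2 < p \<and> p < s" if "s \<in> A" for s
    using Rats_dense_in_real[of "s - r s / 2" s] r(1)[OF that] by auto
  then obtain p where p: "\<And>s. s \<in> A \<Longrightarrow> p s \<in> \<rat> \<and> s - r s / 2 < p s \<and> p s < s" by metis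
  have "inj_on (\<lambda>s. (p s, q s)) A"
  proof (rule inj_onI)
    fix s t assume st: "s \<in> A" "t \<in> A" "(p s, q s) = (p t, q t)"
    then have "\<bar>t - s\<bar> < r s" using p[of s] q[of s] p[of t] q[of t] by auto
    then show "s = t" using r(2)[of s t] st assms(1) by auto
  qed
  moreover have "(\<lambda>s. (p s, q s)) ` A \<subseteq> \<rat> \<times> \<rat>" using p q by auto
  then have "countable ((\<lambda>s. (p s, q s)) ` A)"
    by (rule countable_subset) (intro countable_SIGMA countable_rat)
  ultimately show ?thesis by (rule countable_image_inj_on[rotated])
qed

lemma nonzero_derivative_isolated:
  fixes g :: "real \<Rightarrow> real"
  assumes "(g has_real_derivative v) (at s)" "v \<noteq> 0"
  shows "\<exists>r>0. \<forall>t. \<bar>t - s\<bar> < r \<longrightarrow> g t = g s \<longrightarrow> t = s"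
proof -
  have "((\<lambda>t. (g t - g s) / (t - s)) \<longlongrightarrow> v) (at s)"
    using assms(1) by (simp add: has_field_derivative_iff)
  then have "\<forall>\<^sub>F t in at s. (g t - g s) / (t - s) \<noteq> 0"
    using assms(2) by (rule tendsto_imp_eventually_ne)
  then obtain r where "r > 0" "\<And>t. t \<noteq> s \<Longrightarrow> dist t s < r \<Longrightarrow> (g t - g s) / (t - s) \<noteq> 0"
    unfolding eventually_at by auto
  then show ?thesis by (intro exI[of _ r]) (force simp: dist_real_def)
qed

lemma isCont_signed_powr:
  assumes "z \<noteq> 0"
  shows "isCont (\<lambda>z. signed_powr z p) z"
proof -
  have "((\<lambda>z. \<bar>z\<bar> powr p * sgn z) \<longlongrightarrow> \<bar>z\<bar> powr p * sgn z) (at z)"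
    using assms by (intro tendsto_intros tendsto_powr tendsto_sgn) auto
  then show ?thesis by (simp add: isCont_def signed_powr_def)
qed

context differentiator
begin

lemma isCont_Phi:
  assumes "i \<le> n" "i < n \<or> z \<noteq> 0"
  shows "isCont (Phi i) z"
proof (cases "i < n")
  case True
  then show ?thesis using Phi_continuous[OF True] by (simp add: continuous_on_eq_continuous_at)
next
  case False
  then have n: "i = n" "z \<noteq> 0" using assms by auto
  have nz: "Phi (n - 1) z \<noteq> 0" using Phi_neq_0[of "n - 1" z] n by simp
  have "isCont (Phi (n - 1)) z"
    using Phi_continuous[of "n - 1"] n_ge by (simp add: continuous_on_eq_continuous_at)
  moreover have "isCont (two_power (\<kappa> n) (\<theta> n) (p0 n) (pinf n)) (Phi (n - 1) z)"
    unfolding two_power_def using nz by (intro continuous_intros isCont_signed_powr)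
  ultimately have "isCont (\<lambda>z. two_power (\<kappa> n) (\<theta> n) (p0 n) (pinf n) (Phi (n - 1) z)) z"
    by (rule isCont_o2)
  then show ?thesis unfolding n(1) by (simp only: Phi_last[symmetric])
qed

end

section \<open>Local extension from an arbitrary state at a positive time\<close>

context differentiator_signal
begin

text \<open>Lipschitz rather than absolutely continuous, so that pieces can be joined by adding
  increments; the exceptional set is named so that those of two pieces can be united.\<close>

definition solution_piece ::
    "real \<Rightarrow> (nat \<Rightarrow> real) \<Rightarrow> (nat \<Rightarrow> real \<Rightarrow> real) \<Rightarrow> real \<Rightarrow> real \<Rightarrow> real set \<Rightarrow> bool" where
  "solution_piece a x0 y d L N \<longleftrightarrow> 0 < d \<and> negligible N \<and> (\<forall>i\<in>{1..n}. y i a = x0 i) \<and>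
    (\<forall>i\<in>{1..n}. \<forall>u v. a \<le> u \<longrightarrow> u \<le> v \<longrightarrow> v \<le> a + d \<longrightarrow> \<bar>y i v - y i u\<bar> \<le> L * (v - u)) \<and>
    (\<forall>i\<in>{1..n}. \<forall>t. a < t \<longrightarrow> t < a + d \<longrightarrow> t \<notin> N \<longrightarrow>
      (\<exists>v\<in>differentiator_rhs n d0 dinf \<kappa> \<theta> k (f t) (\<lambda>j. y j t) i. (y i has_real_derivative v) (at t)))"

lemma solution_pieceD:
  assumes "solution_piece a x0 y d L N"
  shows "0 < d" "negligible N" "\<And>i. i \<in> {1..n} \<Longrightarrow> y i a = x0 i"
    "\<And>i u v. i \<in> {1..n} \<Longrightarrow> a \<le> u \<Longrightarrow> u \<le> v \<Longrightarrow> v \<le> a + d \<Longrightarrow> \<bar>y i v - y i u\<bar> \<le> L * (v - u)"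
    "\<And>i t. i \<in> {1..n} \<Longrightarrow> a < t \<Longrightarrow> t < a + d \<Longrightarrow> t \<notin> N \<Longrightarrow>
      \<exists>v\<in>differentiator_rhs n d0 dinf \<kappa> \<theta> k (f t) (\<lambda>j. y j t) i. (y i has_real_derivative v) (at t)"
  using assms unfolding solution_piece_def by blast+

text \<open>With zero error the signal and its derivatives form a solution: the last equation only
  requires a value in the Filippov set at 0 that reproduces the derivative of order
  \<open>n\<close>.\<close>

lemma zero_error_extension:
  assumes "0 < a"
  shows "\<exists>L. \<forall>i\<in>{1..n}. \<forall>u v. a \<le> u \<longrightarrow> u \<le> v \<longrightarrow> v \<le> a + 1 \<longrightarrow>
      \<bar>nderiv (i - 1) f0 v - nderiv (i - 1) f0 u\<bar> \<le> L * (v - u)"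
    and "\<And>t i. 0 < t \<Longrightarrow> i \<in> {1..n} \<Longrightarrow>
      \<exists>v\<in>differentiator_rhs n d0 dinf \<kappa> \<theta> k (f t) (\<lambda>j. nderiv (j - 1) f0 t) i.
        (nderiv (i - 1) f0 has_real_derivative v) (at t)"
proof -
  have "\<exists>L. \<forall>u\<in>{0..a + 1}. \<forall>v\<in>{0..a + 1}. \<bar>nderiv (i - 1) f0 v - nderiv (i - 1) f0 u\<bar> \<le> L * \<bar>v - u\<bar>"
    if "i \<in> {1..n}" for i
    using nderiv_lipschitz[OF f0_diff _ f0_bound] that by auto
  then obtain L where L: "\<And>i u v. i \<in> {1..n} \<Longrightarrow> u \<in> {0..a + 1} \<Longrightarrow> v \<in> {0..a + 1} \<Longrightarrow>
    \<bar>nderiv (i - 1) f0 v - nderiv (i - 1) f0 u\<bar> \<le> L i * \<bar>v - u\<bar>" by metis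
  show "\<exists>L. \<forall>i\<in>{1..n}. \<forall>u v. a \<le> u \<longrightarrow> u \<le> v \<longrightarrow> v \<le> a + 1 \<longrightarrow>
      \<bar>nderiv (i - 1) f0 v - nderiv (i - 1) f0 u\<bar> \<le> L * (v - u)"
  proof (intro exI ballI allI impI)
    fix i u v assume i: "i \<in> {1..n}" and uv: "a \<le> u" "u \<le> v" "v \<le> a + 1"
    have "\<bar>nderiv (i - 1) f0 v - nderiv (i - 1) f0 u\<bar> \<le> L i * \<bar>v - u\<bar>"
      using uv assms by (intro L[OF i]) auto
    also have "\<dots> \<le> Max (L ` {1..n}) * \<bar>v - u\<bar>" using i by (intro mult_right_mono Max_ge) auto
    finally show "\<bar>nderiv (i - 1) f0 v - nderiv (i - 1) f0 u\<bar> \<le> Max (L ` {1..n}) * (v - u)" using uv by simp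
  qed
  fix t :: real and i assume t: "0 < t" and i: "i \<in> {1..n}"
  have s0: "nderiv (1 - 1) f0 t - f t = 0" using t f_eq[of t] by simp
  have "Suc (i - 1) = i" "i - 1 < n" using i by auto
  then have der: "(nderiv (i - 1) f0 has_real_derivative nderiv i f0 t) (at t)"
    using nderiv_has_real_derivative[OF f0_diff, of "i - 1" t] t by (simp only:)
  have "nderiv i f0 t \<in> differentiator_rhs n d0 dinf \<kappa> \<theta> k (f t) (\<lambda>j. nderiv (j - 1) f0 t) i"
  proof (cases "i < n")
    case True
    then show ?thesis unfolding differentiator_rhs_def s0
      using zero_in_inj_comp[of i] i by (intro image_eqI[of _ _ 0]) auto
  next
    case False
    then have "i = n" using i by simp
    have kn: "k n > 0" "\<kappa> n > 0" using k_pos \<kappa>_pos n_ge by auto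
    \<comment> \<open>The equivalent control of the sliding motion. It lies in the Filippov set
      because \<open>\<Delta> \<le> k n * \<kappa> n\<close>.\<close>
    define p where "p = - nderiv n f0 t / k n"
    have "p \<in> inj_comp n d0 dinf \<kappa> \<theta> n 0"
    proof (cases "d0 = -1")
      case True
      have "\<bar>nderiv n f0 t\<bar> \<le> k n * \<kappa> n" using f0_bound[of t] t k_last[OF True] \<Delta>_nonneg by simp
      then have "\<bar>p / \<kappa> n\<bar> \<le> 1" using kn by (simp add: p_def field_simps)
      from interval_subset_inj_comp[OF True this] show ?thesis using kn by simp
    next
      case False
      then have "nderiv n f0 t = 0" using f0_bound[of t] t \<Delta>_zero d0_ge by simp
      then show ?thesis using zero_in_inj_comp[of n] by (simp add: p_def)
    qed
    then show ?thesis unfolding differentiator_rhs_def s0 \<open>i = n\<close>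
      using kn by (intro image_eqI[of _ _ p]) (auto simp: p_def)
  qed
  with der show "\<exists>v\<in>differentiator_rhs n d0 dinf \<kappa> \<theta> k (f t) (\<lambda>j. nderiv (j - 1) f0 t) i.
        (nderiv (i - 1) f0 has_real_derivative v) (at t)" by blast
qed

lemma f_continuous: "continuous_on {0..} f"
proof -
  have "continuous_on {0..} (nderiv 0 f0)" using nderiv_continuous_on[OF f0_diff, of 0] n_ge by simp
  then show ?thesis by (rule continuous_on_eq) (simp add: f_eq)
qed

lemma nderiv_shift_derivative:
  assumes "j < n" "0 < a + s"
  shows "((\<lambda>s. nderiv j f0 (a + s)) has_real_derivative nderiv (Suc j) f0 (a + s)) (at s)"
  using nderiv_has_real_derivative[OF f0_diff assms]
  by (subst add.commute, subst DERIV_shift[symmetric]) (simp add: add.commute del: nderiv.simps)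

text \<open>Peano's argument, in time \<open>s\<close> elapsed since \<open>a\<close>. The
  derivative of the last component is claimed only off the zeros of \<open>x 1 - f\<close>, where
  \<open>Phi n\<close> is continuous.\<close>

lemma euler_solution:
  fixes x0 :: "nat \<Rightarrow> real"
  assumes a: "0 < a"
  obtains x d L where "0 < d" "\<And>i. i \<in> {1..n} \<Longrightarrow> x i 0 = x0 i"
    and "\<And>i s t. i \<in> {1..n} \<Longrightarrow> 0 \<le> s \<Longrightarrow> s \<le> t \<Longrightarrow> t \<le> d \<Longrightarrow> \<bar>x i t - x i s\<bar> \<le> L * (t - s)"
    and "\<And>i s. i \<in> {1..n} \<Longrightarrow> 0 < s \<Longrightarrow> s < d \<Longrightarrow> i < n \<or> x 1 s - f (a + s) \<noteq> 0 \<Longrightarrow>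
      (x i has_real_derivative - k i * Phi i (x 1 s - f (a + s)) + (if i < n then x (i + 1) s else 0)) (at s)"
proof -
  \<comment> \<open>State and time are truncated so that the right-hand side becomes bounded
    globally; as long as the solution has moved by less than 1, the truncation is inactive.\<close>
  define cl where "cl j v = max (x0 j - 1) (min (x0 j + 1) v)" for j v
  define ct where "ct s = max 0 (min 1 s)" for s :: real
  define F where "F i s y = - k i * Phi i (cl 1 (y 1) - f (a + ct s)) + (if i < n then cl (i + 1) (y (i + 1)) else 0)"
    for i s and y :: "nat \<Rightarrow> real"
  have "continuous_on {a..a + 1} f" using a by (intro continuous_on_subset[OF f_continuous]) auto
  then have "bounded (f ` {a..a + 1})" by (intro compact_imp_bounded compact_continuous_image) auto
  then obtain Fb where "\<forall>t\<in>{a..a + 1}. \<bar>f t\<bar> \<le> Fb" unfolding bounded_iff by auto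
  then have Fb: "\<And>t. t \<in> {a..a + 1} \<Longrightarrow> \<bar>f t\<bar> \<le> Fb" by blast
  define B where "B = \<bar>x0 1\<bar> + 2 + Fb"
  have cl_le: "\<bar>cl j v\<bar> \<le> \<bar>x0 j\<bar> + 1" for j v by (auto simp: cl_def)
  have ct_in: "a + ct s \<in> {a..a + 1}" for s by (auto simp: ct_def)
  have "0 \<le> Fb" using Fb[of a] by force
  then have "0 < B" by (simp add: B_def)
  define L where "L = (\<Sum>i=1..n. k i * Phi i B + \<bar>x0 (i + 1)\<bar> + 1)"
  have term_nonneg: "0 \<le> k i * Phi i B + \<bar>x0 (i + 1)\<bar> + 1" if "i \<in> {1..n}" for i
    using k_pos[of i] Phi_pos[of i B] \<open>0 < B\<close> that by auto
  have "0 \<le> L" unfolding L_def by (intro sum_nonneg term_nonneg)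
  have F_le: "\<bar>F i s y\<bar> \<le> L" if i: "i \<in> {1..n}" for i s y
  proof -
    let ?z = "cl 1 (y 1) - f (a + ct s)"
    have "\<bar>?z\<bar> \<le> B" using cl_le[of 1 "y 1"] Fb[OF ct_in[of s]] by (auto simp: B_def)
    then have "?z \<le> B" "- B \<le> ?z" by linarith+
    then have "Phi i ?z \<le> Phi i B" "Phi i (- B) \<le> Phi i ?z" using i by (auto intro!: monoD)
    then have "\<bar>Phi i ?z\<bar> \<le> Phi i B" by (simp add: Phi_minus abs_le_iff)
    then have "\<bar>- k i * Phi i ?z\<bar> \<le> k i * Phi i B" using k_pos[of i] i by (simp add: abs_mult)
    moreover have "\<bar>if i < n then cl (i + 1) (y (i + 1)) else 0\<bar> \<le> \<bar>x0 (i + 1)\<bar> + 1" using cl_le by auto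
    ultimately have "\<bar>F i s y\<bar> \<le> k i * Phi i B + \<bar>x0 (i + 1)\<bar> + 1" unfolding F_def by linarith
    also have "\<dots> \<le> L" unfolding L_def by (rule member_le_sum[OF i]) (use term_nonneg in auto)
    finally show ?thesis .
  qed
  show ?thesis
  proof (rule euler_limit[of 1 n F L x0, OF zero_less_one F_le])
    fix x assume
      x_0: "\<And>i. i \<in> {1..n} \<Longrightarrow> x i 0 = x0 i"
      and x_lip: "\<And>i s t. i \<in> {1..n} \<Longrightarrow> 0 \<le> s \<Longrightarrow> s \<le> t \<Longrightarrow> t \<le> 1 \<Longrightarrow> \<bar>x i t - x i s\<bar> \<le> L * (t - s)"
      and x_der: "\<And>i t v. i \<in> {1..n} \<Longrightarrow> 0 < t \<Longrightarrow> t < 1 \<Longrightarrow>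
        (\<And>e. 0 < e \<Longrightarrow> \<exists>r>0. \<forall>s y. \<bar>s - t\<bar> < r \<longrightarrow> (\<forall>j\<in>{1..n}. \<bar>y j - x j t\<bar> < r) \<longrightarrow> \<bar>F i s y - v\<bar> \<le> e) \<Longrightarrow>
        (x i has_real_derivative v) (at t)"
    \<comment> \<open>At speed at most \<open>L\<close>, the displacement up to time
      \<open>d\<close> is below 1.\<close>
    define d where "d = 1 / (L + 1)"
    have d: "0 < d" "d \<le> 1" "L * d < 1" using \<open>0 \<le> L\<close> by (auto simp: d_def field_simps)
    show ?thesis
    proof (rule that[of d x L])
      show "0 < d" by (rule d(1))
      show "x i 0 = x0 i" if "i \<in> {1..n}" for i using x_0 that .
      show "\<bar>x i t - x i s\<bar> \<le> L * (t - s)" if "i \<in> {1..n}" "0 \<le> s" "s \<le> t" "t \<le> d" for i s t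
        using x_lip[of i s t] that d by simp
      fix i s assume i: "i \<in> {1..n}" and s: "0 < s" "s < d" and nz: "i < n \<or> x 1 s - f (a + s) \<noteq> 0"
      let ?z = "x 1 s - f (a + s)"
      have ki: "0 < k i" using k_pos[of i] i by auto
      have "L * s \<le> L * d" using s \<open>0 \<le> L\<close> by (intro mult_left_mono) auto
      then have Ls: "L * s < 1" using d by linarith
      have x_near: "\<bar>x j s - x0 j\<bar> \<le> L * s" if "j \<in> {1..n}" for j
        using x_lip[OF that, of 0 s] x_0[OF that] s d by simp
      show "(x i has_real_derivative - k i * Phi i ?z + (if i < n then x (i + 1) s else 0)) (at s)"
      proof (rule x_der[OF i s(1)])
        show "s < 1" using s d by simp
        fix e :: real assume e: "0 < e"
        have "isCont (Phi i) ?z" using isCont_Phi[of i ?z] nz i by simp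
        moreover have "0 < e / (2 * k i)" using e ki by simp
        ultimately obtain h where h: "0 < h" "\<And>z. \<bar>z - ?z\<bar> < h \<Longrightarrow> \<bar>Phi i z - Phi i ?z\<bar> < e / (2 * k i)"
          unfolding continuous_at_eps_delta dist_real_def by metis
        have "a + s \<in> {0..}" "0 < h / 2" using a s h by auto
        then obtain \<rho> where \<rho>: "0 < \<rho>" "\<And>t. 0 \<le> t \<Longrightarrow> \<bar>t - (a + s)\<bar> < \<rho> \<Longrightarrow> \<bar>f t - f (a + s)\<bar> < h / 2"
          using f_continuous unfolding continuous_on_iff dist_real_def by (metis atLeast_iff)
        \<comment> \<open>\<open>h / 2\<close> and \<open>\<rho>\<close> control the argument of
          \<open>Phi i\<close>, \<open>e / 2\<close> the linear term, \<open>1 - L * s\<close> the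
          truncation of the state, and \<open>s\<close>, \<open>1 - s\<close> that of time.\<close>
        define r where "r = min (h / 2) (min (e / 2) (min \<rho> (min (1 - L * s) (min s (1 - s)))))"
        have r: "0 < r" "r \<le> h / 2" "r \<le> e / 2" "r \<le> \<rho>" "r \<le> 1 - L * s" "r \<le> s" "r \<le> 1 - s"
          unfolding r_def using h(1) e \<rho>(1) Ls s d by linarith+
        have "\<bar>F i s' y - (- k i * Phi i ?z + (if i < n then x (i + 1) s else 0))\<bar> \<le> e"
          if s': "\<bar>s' - s\<bar> < r" and y: "\<forall>j\<in>{1..n}. \<bar>y j - x j s\<bar> < r" for s' y
        proof -
          have ct: "ct s' = s'" using s' r unfolding ct_def by (auto simp: abs_less_iff)
          have cl: "cl j (y j) = y j" if "j \<in> {1..n}" for j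
          proof -
            have "\<bar>y j - x0 j\<bar> \<le> 1" using y x_near[OF that] that r(5) by force
            then show ?thesis by (auto simp: cl_def abs_le_iff min_def max_def)
          qed
          have "1 \<in> {1..n}" using n_ge by simp
          have "0 \<le> a + s'" using s' r(6) a by linarith
          have "\<bar>f (a + s') - f (a + s)\<bar> < h / 2"
            using \<rho>(2)[OF \<open>0 \<le> a + s'\<close>] s' r(4) by simp
          moreover have "\<bar>y 1 - x 1 s\<bar> < h / 2" using y \<open>1 \<in> {1..n}\<close> r(2) by force
          ultimately have "\<bar>(y 1 - f (a + s')) - ?z\<bar> < h" by linarith
          then have "\<bar>Phi i (y 1 - f (a + s')) - Phi i ?z\<bar> < e / (2 * k i)" by (rule h(2))
          then have "k i * \<bar>Phi i (y 1 - f (a + s')) - Phi i ?z\<bar> < e / 2" using ki by (simp add: field_simps)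
          then have 1: "\<bar>k i * Phi i (y 1 - f (a + s')) - k i * Phi i ?z\<bar> < e / 2"
            using ki by (simp add: abs_mult flip: right_diff_distrib)
          have 2: "\<bar>(if i < n then y (i + 1) else 0) - (if i < n then x (i + 1) s else 0)\<bar> \<le> e / 2"
          proof (cases "i < n")
            case True
            then have "\<bar>y (i + 1) - x (i + 1) s\<bar> < r" using y i by auto
            then show ?thesis using True r(3) by simp
          qed (use e in simp)
          have "F i s' y = - k i * Phi i (y 1 - f (a + s')) + (if i < n then y (i + 1) else 0)"
            unfolding F_def ct using cl[OF \<open>1 \<in> {1..n}\<close>] cl[of "i + 1"] i by simp
          then show ?thesis using 1 2 by linarith
        qed
        then show "\<exists>r>0. \<forall>s' y. \<bar>s' - s\<bar> < r \<longrightarrow> (\<forall>j\<in>{1..n}. \<bar>y j - x j s\<bar> < r) \<longrightarrow>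
            \<bar>F i s' y - (- k i * Phi i ?z + (if i < n then x (i + 1) s else 0))\<bar> \<le> e"
          using r(1) by blast
      qed
    qed
  qed
qed

text \<open>Where the error does not vanish, \<open>x 1 - f\<close> has only countably many zeros: a zero that is not
  isolated is a zero of the next error component as well, by the differential equations of index
  below \<open>n\<close>. Hence the value of the discontinuous term at \<open>0\<close> does not matter.\<close>

lemma nonzero_error_extension:
  fixes x0 :: "nat \<Rightarrow> real"
  assumes a: "0 < a" and j0: "j0 \<in> {1..n}" "x0 j0 \<noteq> nderiv (j0 - 1) f0 a"
  shows "\<exists>y d L N. solution_piece a x0 y d L N"
proof (rule euler_solution[OF a, of x0])
  fix x d L assume d: "0 < d"
    and x_0: "\<And>i. i \<in> {1..n} \<Longrightarrow> x i 0 = x0 i"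
    and x_lip: "\<And>i s t. i \<in> {1..n} \<Longrightarrow> 0 \<le> s \<Longrightarrow> s \<le> t \<Longrightarrow> t \<le> d \<Longrightarrow> \<bar>x i t - x i s\<bar> \<le> L * (t - s)"
    and x_der: "\<And>i s. i \<in> {1..n} \<Longrightarrow> 0 < s \<Longrightarrow> s < d \<Longrightarrow> i < n \<or> x 1 s - f (a + s) \<noteq> 0 \<Longrightarrow>
      (x i has_real_derivative - k i * Phi i (x 1 s - f (a + s)) + (if i < n then x (i + 1) s else 0)) (at s)"
  define z where "z i s = x i s - nderiv (i - 1) f0 (a + s)" for i s
  have z1: "z 1 s = x 1 s - f (a + s)" if "0 \<le> s" for s using that a by (simp add: z_def f_eq)
  have "\<exists>d'>0. \<forall>s. 0 \<le> s \<longrightarrow> s < d' \<longrightarrow> s < d \<longrightarrow> z j0 s \<noteq> 0"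
  proof -
    have "abs_continuous_on 0 d (x j0)"
      by (rule abs_continuous_on_lipschitz[of 0 d "x j0" L]) (rule x_lip[OF j0(1)])
    then have "continuous_on {0..d} (x j0)" by (rule abs_continuous_on_imp_continuous_on)
    moreover have "continuous_on {0..d} (\<lambda>s. nderiv (j0 - 1) f0 (a + s))"
    proof (rule continuous_on_compose2[of "{0..}" "nderiv (j0 - 1) f0"])
      show "continuous_on {0..} (nderiv (j0 - 1) f0)"
        using nderiv_continuous_on[OF f0_diff, of "j0 - 1"] j0(1) by auto
    qed (use a in \<open>auto intro!: continuous_intros\<close>)
    ultimately have "continuous_on {0..d} (z j0)" unfolding z_def by (rule continuous_on_diff)
    moreover have "0 < \<bar>z j0 0\<bar>" using j0 x_0 by (simp add: z_def)
    moreover have "0 \<in> {0..d}" using d by simp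
    ultimately obtain d' where d': "0 < d'" "\<And>s. s \<in> {0..d} \<Longrightarrow> \<bar>s - 0\<bar> < d' \<Longrightarrow> \<bar>z j0 s - z j0 0\<bar> < \<bar>z j0 0\<bar>"
      unfolding continuous_on_iff dist_real_def by metis
    have "z j0 s \<noteq> 0" if "0 \<le> s" "s < d'" "s < d" for s
      using d'(2)[of s] that by auto
    then show ?thesis using d'(1) by blast
  qed
  then obtain d' where d': "0 < d'" "\<And>s. 0 \<le> s \<Longrightarrow> s < d' \<Longrightarrow> s < d \<Longrightarrow> z j0 s \<noteq> 0" by blast
  define D where "D = min d d'"
  \<comment> \<open>A decreasing chain of zero sets that ends in the empty set, since the error
    \<open>j0\<close> does not vanish. At a point of \<open>Z m\<close> the derivative of
    \<open>z m\<close> is \<open>z (Suc m)\<close>, as \<open>Phi m 0 = 0\<close>; if it is not 0,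
    the point is isolated in \<open>Z m\<close>. So \<open>Z 1\<close> is a finite union of
    countable sets.\<close>
  define Z where "Z m = {s. 0 < s \<and> s < D \<and> (\<forall>i\<in>{1..m}. z i s = 0)}" for m :: nat
  have step: "countable (Z m - Z (Suc m))" if m: "1 \<le> m" "m < n" for m
  proof (rule countable_isolated_points[of _ "Z m"])
    fix s assume s: "s \<in> Z m - Z (Suc m)"
    then have s': "0 < s" "s < D" "z m s = 0" "z 1 s = 0" using m by (auto simp: Z_def)
    have "z (Suc m) s \<noteq> 0" using s by (auto simp: Z_def le_Suc_eq)
    have "((\<lambda>s. nderiv (m - 1) f0 (a + s)) has_real_derivative nderiv (Suc (m - 1)) f0 (a + s)) (at s)"
      using m s' a by (intro nderiv_shift_derivative) auto
    moreover have "Suc (m - 1) = m" using m by simp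
    moreover have "(x m has_real_derivative x (m + 1) s) (at s)"
      using x_der[of m s] m s' z1[of s] D_def by simp
    ultimately have "(z m has_real_derivative x (m + 1) s - nderiv m f0 (a + s)) (at s)"
      unfolding z_def by (metis DERIV_diff)
    then have "(z m has_real_derivative z (Suc m) s) (at s)" by (simp add: z_def)
    from nonzero_derivative_isolated[OF this \<open>z (Suc m) s \<noteq> 0\<close>]
    obtain r where "r > 0" "\<And>t. \<bar>t - s\<bar> < r \<Longrightarrow> z m t = z m s \<Longrightarrow> t = s" by blast
    moreover have "z m t = z m s" if "t \<in> Z m" for t using that m s'(3) by (auto simp: Z_def)
    ultimately show "\<exists>r>0. \<forall>t\<in>Z m. \<bar>t - s\<bar> < r \<longrightarrow> t = s" by blast
  qed auto
  have Zn: "Z n = {}"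
  proof (rule equals0I)
    fix s assume "s \<in> Z n"
    then have "0 < s" "s < d'" "s < d" "z j0 s = 0" using j0(1) by (auto simp: Z_def D_def)
    then show False using d'(2)[of s] by simp
  qed
  have "1 \<le> n" using n_ge by simp
  then have "countable (Z 1)"
  proof (induction rule: inc_induct)
    case base
    then show ?case by (simp add: Zn)
  next
    case (step m)
    have "Z m \<subseteq> (Z m - Z (Suc m)) \<union> Z (Suc m)" by auto
    moreover have "countable (Z m - Z (Suc m))" using \<open>\<And>m. _ \<Longrightarrow> _ \<Longrightarrow> countable (Z m - Z (Suc m))\<close> step by simp
    ultimately show ?case using step.IH by (meson countable_Un countable_subset)
  qed
  have null: "negligible (Z 1)"
    using countable_imp_null_set_lborel[OF \<open>countable (Z 1)\<close>] null_sets_completionI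
    by (auto simp: negligible_iff_null_sets)
  have "solution_piece a x0 (\<lambda>i t. x i (t - a)) D L ((+) a ` Z 1)"
    unfolding solution_piece_def
  proof (intro conjI ballI allI impI)
    show "0 < D" using d d' by (simp add: D_def)
    show "negligible ((+) a ` Z 1)" using null by (rule negligible_translation)
    show "x i (a - a) = x0 i" if "i \<in> {1..n}" for i using x_0[OF that] by simp
    show "\<bar>x i (v - a) - x i (u - a)\<bar> \<le> L * (v - u)" if "i \<in> {1..n}" "a \<le> u" "u \<le> v" "v \<le> a + D" for i u v
      using x_lip[of i "u - a" "v - a"] that by (simp add: D_def)
    fix i t assume i: "i \<in> {1..n}" and t: "a < t" "t < a + D" "t \<notin> (+) a ` Z 1"
    define s where "s = t - a"
    have s: "0 < s" "s < D" "s \<notin> Z 1" "a + s = t"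
      using t by (auto simp: s_def image_iff)
    then have nz: "x 1 s - f (a + s) \<noteq> 0" using z1[of s] by (auto simp: Z_def)
    have "s < d" using s by (simp add: D_def)
    define v where "v = - k i * Phi i (x 1 s - f (a + s)) + (if i < n then x (i + 1) s else 0)"
    have "v \<in> differentiator_rhs n d0 dinf \<kappa> \<theta> k (f t) (\<lambda>j. x j (t - a)) i"
      unfolding differentiator_rhs_def v_def using inj_comp_nonzero[OF _ nz, of i] i s(4) by (simp add: s_def)
    moreover have "(x i has_real_derivative v) (at (t + (- a)))"
      using x_der[OF i s(1) \<open>s < d\<close>] nz by (simp add: v_def s_def)
    then have "((\<lambda>t. x i (t - a)) has_real_derivative v) (at t)" unfolding DERIV_shift by simp
    ultimately show "\<exists>v\<in>differentiator_rhs n d0 dinf \<kappa> \<theta> k (f t) (\<lambda>j. x j (t - a)) i.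
        ((\<lambda>t. x i (t - a)) has_real_derivative v) (at t)" by blast
  qed
  then show ?thesis by blast
qed

lemma local_extension:
  assumes a: "0 < a"
  shows "\<exists>y d L N. solution_piece a x0 y d L N"
proof (cases "\<forall>j\<in>{1..n}. x0 j = nderiv (j - 1) f0 a")
  case True
  obtain L where L: "\<forall>i\<in>{1..n}. \<forall>u v. a \<le> u \<longrightarrow> u \<le> v \<longrightarrow> v \<le> a + 1 \<longrightarrow>
      \<bar>nderiv (i - 1) f0 v - nderiv (i - 1) f0 u\<bar> \<le> L * (v - u)" using zero_error_extension(1)[OF a] by blast
  have "solution_piece a x0 (\<lambda>i. nderiv (i - 1) f0) 1 L {}"
    unfolding solution_piece_def using True L zero_error_extension(2)[OF a] a by simp
  then show ?thesis by blast
next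
  case False
  then show ?thesis using nonzero_error_extension[OF a] by blast
qed

end

section \<open>Convergence\<close>

context differentiator_signal
begin

text \<open>The Lipschitz bound provides a limit state at \<open>T\<close>, from which a local piece
  continues.\<close>

lemma solution_extends:
  assumes sol: "filippov_solution n d0 dinf \<kappa> \<theta> k f (ereal T) x" and T: "0 < T"
    and lip: "\<And>i s t. i \<in> {1..n} \<Longrightarrow> 0 \<le> s \<Longrightarrow> s \<le> t \<Longrightarrow> t < T \<Longrightarrow> \<bar>x i t - x i s\<bar> \<le> L * (t - s)"
  shows "\<exists>\<tau>' y. ereal T < \<tau>' \<and> filippov_solution n d0 dinf \<kappa> \<theta> k f \<tau>' y \<and>
    (\<forall>i\<in>{1..n}. \<forall>t\<ge>0. ereal t < ereal T \<longrightarrow> y i t = x i t)"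
proof -
  have "\<forall>i\<in>{1..n}. \<exists>g. \<bar>L\<bar>-lipschitz_on (closure {0..<T}) g \<and> (\<forall>t\<in>{0..<T}. g t = x i t)"
  proof (intro ballI lipschitz_extend_closure lipschitz_onI)
    fix i s t assume i: "i \<in> {1..n}" and "s \<in> {0..<T}" "t \<in> {0..<T}"
    then have "\<bar>x i t - x i s\<bar> \<le> L * \<bar>t - s\<bar>"
      using lip[OF i, of s t] lip[OF i, of t s] by (cases "s \<le> t") (auto simp: abs_minus_commute)
    also have "\<dots> \<le> \<bar>L\<bar> * \<bar>t - s\<bar>" by (intro mult_right_mono) auto
    finally show "dist (x i s) (x i t) \<le> \<bar>L\<bar> * dist s t" by (simp add: dist_real_def abs_minus_commute)
  qed simp
  from bchoice[OF this] obtain g where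
    g': "\<forall>i\<in>{1..n}. \<bar>L\<bar>-lipschitz_on (closure {0..<T}) (g i) \<and> (\<forall>t\<in>{0..<T}. g i t = x i t)" ..
  have "closure {0..<T} = {0..T}" using T by (simp add: closure_atLeastLessThan)
  with g' have g: "\<And>i. i \<in> {1..n} \<Longrightarrow> \<bar>L\<bar>-lipschitz_on {0..T} (g i)"
    "\<And>i t. i \<in> {1..n} \<Longrightarrow> 0 \<le> t \<Longrightarrow> t < T \<Longrightarrow> g i t = x i t" by auto
  have g_lip: "\<bar>g i t - g i s\<bar> \<le> \<bar>L\<bar> * (t - s)" if "i \<in> {1..n}" "0 \<le> s" "s \<le> t" "t \<le> T" for i s t
    using lipschitz_onD[OF g(1)[OF that(1)], of t s] that by (simp add: dist_real_def)
  obtain y d M N where "solution_piece T (\<lambda>i. g i T) y d M N" using local_extension[OF T] by blast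
  note y = solution_pieceD[OF this]
  note d = y(1) and N = y(2) and y_T = y(3) and y_lip = y(4) and y_der = y(5)
  define X where "X i t = (if t < T then x i t else y i t)" for i t
  define C where "C = \<bar>L\<bar> + \<bar>M\<bar>"
  have X_lip: "\<bar>X i v - X i u\<bar> \<le> C * (v - u)" if i: "i \<in> {1..n}" and uv: "0 \<le> u" "u \<le> v" "v \<le> T + d" for i u v
  proof -
    have L: "\<bar>L\<bar> * h \<le> C * h" "\<bar>M\<bar> * h \<le> C * h" "M * h \<le> \<bar>M\<bar> * h" if "0 \<le> h" for h
      using that by (auto intro!: mult_right_mono simp: C_def)
    consider "v < T" | "u < T" "T \<le> v" | "T \<le> u" using uv by linarith
    then show ?thesis
    proof cases
      case 1
      then have "\<bar>g i v - g i u\<bar> \<le> \<bar>L\<bar> * (v - u)" using g_lip[OF i, of u v] uv by simp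
      then show ?thesis using 1 uv g(2)[OF i, of u] g(2)[OF i, of v] L(1)[of "v - u"] by (simp add: X_def)
    next
      case 2
      have "\<bar>g i T - g i u\<bar> \<le> \<bar>L\<bar> * (T - u)" using g_lip[OF i, of u T] uv 2 by simp
      moreover have "\<bar>y i v - y i T\<bar> \<le> M * (v - T)" using y_lip[OF i, of T v] uv 2 by simp
      moreover have "X i v - X i u = (y i v - y i T) + (g i T - g i u)"
        using 2 uv g(2)[OF i, of u] y_T[OF i] by (simp add: X_def)
      moreover have "\<bar>L\<bar> * (T - u) \<le> C * (T - u)" "M * (v - T) \<le> C * (v - T)"
        using 2 L(1)[of "T - u"] L(2,3)[of "v - T"] by auto
      moreover have "C * (v - u) = C * (T - u) + C * (v - T)" by (simp add: algebra_simps)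
      ultimately show ?thesis by linarith
    next
      case 3
      then have "\<bar>y i v - y i u\<bar> \<le> M * (v - u)" using y_lip[OF i, of u v] uv by simp
      then show ?thesis using 3 uv L(2,3)[of "v - u"] by (simp add: X_def)
    qed
  qed
  obtain N' where N': "negligible N'" "\<And>r. r \<notin> N' \<Longrightarrow> 0 < r \<Longrightarrow> ereal r < ereal T \<Longrightarrow> \<forall>i\<in>{1..n}.
      \<exists>v \<in> differentiator_rhs n d0 dinf \<kappa> \<theta> k (f r) (\<lambda>j. x j r) i. (x i has_real_derivative v) (at r)"
    using filippov_solution_derivative[OF sol] by blast
  have X_der: "\<exists>v\<in>differentiator_rhs n d0 dinf \<kappa> \<theta> k (f t) (\<lambda>j. X j t) i. (X i has_real_derivative v) (at t)"
    if t: "0 < t" "t < T + d" "t \<notin> N \<union> N' \<union> {T}" and i: "i \<in> {1..n}" for t i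
  proof (cases "t < T")
    case True
    then obtain v where v: "v \<in> differentiator_rhs n d0 dinf \<kappa> \<theta> k (f t) (\<lambda>j. x j t) i" "(x i has_real_derivative v) (at t)"
    proof -
      have "t \<notin> N'" "ereal t < ereal T" using t(3) True by auto
      from N'(2)[OF this(1) t(1) this(2)] show ?thesis using i that by blast
    qed
    have "(X i has_real_derivative v) (at t)"
      by (rule has_field_derivative_transform_within_open[OF v(2), of "{..<T}"]) (use True in \<open>auto simp: X_def\<close>)
    moreover have "(\<lambda>j. X j t) = (\<lambda>j. x j t)" using True by (simp add: X_def)
    ultimately show ?thesis using v(1) by auto
  next
    case False
    then have "T < t" using t by auto
    then obtain v where v: "v \<in> differentiator_rhs n d0 dinf \<kappa> \<theta> k (f t) (\<lambda>j. y j t) i" "(y i has_real_derivative v) (at t)"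
    proof -
      have "t \<notin> N" using t(3) by auto
      from y_der[OF i \<open>T < t\<close> t(2) this] show ?thesis using that by blast
    qed
    have "(X i has_real_derivative v) (at t)"
      by (rule has_field_derivative_transform_within_open[OF v(2), of "{T<..}"]) (use \<open>T < t\<close> in \<open>auto simp: X_def\<close>)
    moreover have "(\<lambda>j. X j t) = (\<lambda>j. y j t)" using \<open>T < t\<close> by (simp add: X_def)
    ultimately show ?thesis using v(1) by auto
  qed
  have "filippov_solution n d0 dinf \<kappa> \<theta> k f (ereal (T + d)) X"
    unfolding filippov_solution_def
  proof (intro conjI ballI allI impI)
    show "0 < ereal (T + d)" using T d by simp
    show "abs_continuous_on 0 b (X i)" if "i \<in> {1..n}" "0 \<le> b" "ereal b < ereal (T + d)" for i b
      by (rule abs_continuous_on_lipschitz[of _ _ _ C], rule X_lip) (use that in auto)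
    \<comment> \<open>The junction \<open>T\<close> is exceptional, as the one-sided slopes may
      disagree there.\<close>
    have null: "N \<union> N' \<union> {T} \<in> null_sets lebesgue"
      using N N'(1) by (auto simp flip: negligible_iff_null_sets)
    show "AE t in lebesgue. 0 < t \<and> ereal t < ereal (T + d) \<longrightarrow> (\<forall>i\<in>{1..n}.
        \<exists>v\<in>differentiator_rhs n d0 dinf \<kappa> \<theta> k (f t) (\<lambda>j. X j t) i. (X i has_real_derivative v) (at t))"
    proof (rule AE_I'[OF null], rule subsetI, rule ccontr)
      fix t assume *: "t \<in> {t \<in> space lebesgue. \<not> (0 < t \<and> ereal t < ereal (T + d) \<longrightarrow> (\<forall>i\<in>{1..n}.
        \<exists>v\<in>differentiator_rhs n d0 dinf \<kappa> \<theta> k (f t) (\<lambda>j. X j t) i. (X i has_real_derivative v) (at t)))}"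
        and "t \<notin> N \<union> N' \<union> {T}"
      then have "0 < t" "t < T + d" by auto
      then show False using X_der[OF _ _ \<open>t \<notin> N \<union> N' \<union> {T}\<close>] * by blast
    qed
  qed
  moreover have "ereal T < ereal (T + d)" using d by simp
  ultimately show ?thesis by (intro exI[of _ "ereal (T + d)"] exI[of _ X]) (auto simp: X_def)
qed

end

section \<open>Global existence and convergence for gains with the required ratios\<close>

locale tuned_differentiator = differentiator_signal +
  fixes c C D :: real
  assumes constants: "injection_chain_constants n Phi c C D"
    and K_ge_1: "\<And>i. i \<in> {1..n} \<Longrightarrow> 1 \<le> K i"
    and K_ratio: "\<And>i. i \<in> {1..<n} \<Longrightarrow> injection_chain_constants.gain_ratio c C D * K (i + 1) \<le> K i"
begin

sublocale injection_chain_constants n Phi c C D by (rule constants)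

lemma solution_in_box:
  assumes "filippov_solution n d0 dinf \<kappa> \<theta> k f \<tau> x" "0 < l" "in_box (coord x) (l / 2) 0"
    and "ereal t < \<tau>" "time_factor * (\<Sum>m<j. scale_time (l / 2 ^ m)) \<le> t"
  shows "in_box (coord x) (l / 2 ^ j) t"
  by (rule box_iterate[OF K_ge_1 K_ratio solution_trajectory[OF assms(1)] assms(2-5)])

lemma initial_box: "\<exists>l0. \<forall>l\<ge>l0. in_box u l 0"
proof (intro exI allI impI)
  fix l assume l: "(\<Sum>i=1..n. \<bar>u i 0 - u (i + 1) 0\<bar>) \<le> l"
  show "in_box u l 0"
    unfolding in_box_def
  proof
    fix i assume i: "i \<in> {1..n}"
    have "\<bar>u i 0 - u (i + 1) 0\<bar> \<le> (\<Sum>i=1..n. \<bar>u i 0 - u (i + 1) 0\<bar>)" by (rule member_le_sum[OF i]) auto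
    then have "\<bar>u i 0 - u (i + 1) 0\<bar> \<le> l" "0 \<le> l" using l by linarith+
    moreover have "1 * l \<le> 32 ^ i * l" using \<open>0 \<le> l\<close> by (intro mult_right_mono) auto
    ultimately show "\<bar>u i 0 - u (i + 1) 0\<bar> \<le> 32 ^ i * l" by linarith
  qed
qed

lemma coord_le:
  assumes "in_box (coord x) l t" "0 \<le> l" "i \<in> {1..n + 1}"
  shows "\<bar>coord x i t\<bar> \<le> radius * l"
  by (rule in_box_bound[OF assms]) (simp add: coord_def)

lemma err_le:
  assumes "in_box (coord x) l t" "0 \<le> l" "i \<in> {1..n}"
  shows "\<bar>err x i t\<bar> \<le> k (i - 1) * Phi (i - 1) (radius * l)"
proof -
  have "\<bar>coord x i t\<bar> \<le> radius * l" using coord_le[OF assms(1,2), of i] assms(3) by simp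
  then have "coord x i t \<le> radius * l" "- (radius * l) \<le> coord x i t" by linarith+
  then have "Phi (i - 1) (coord x i t) \<le> Phi (i - 1) (radius * l)"
    "Phi (i - 1) (- (radius * l)) \<le> Phi (i - 1) (coord x i t)"
    using assms(3) by (auto intro!: monoD)
  then have "\<bar>Phi (i - 1) (coord x i t)\<bar> \<le> Phi (i - 1) (radius * l)" by (simp add: Phi_minus abs_le_iff)
  moreover have "0 < k (i - 1)" using k_pos[of "i - 1"] assms(3) by auto
  ultimately show ?thesis unfolding err_eq[OF assms(3)] by (simp add: abs_mult)
qed

text \<open>Excludes finite escape: on a bounded interval the coordinates stay in the box fixed by
  the initial state, so all velocities are bounded.\<close>

lemma solution_lipschitz:
  assumes sol: "filippov_solution n d0 dinf \<kappa> \<theta> k f (ereal T) x"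
  shows "\<exists>L. \<forall>i\<in>{1..n}. \<forall>s t. 0 \<le> s \<longrightarrow> s \<le> t \<longrightarrow> t < T \<longrightarrow> \<bar>x i t - x i s\<bar> \<le> L * (t - s)"
proof -
  obtain l0 where l0: "\<And>l. l0 \<le> l \<Longrightarrow> in_box (coord x) l 0" using initial_box by blast
  define l where "l = 2 * (\<bar>l0\<bar> + 1)"
  have l: "0 < l" "in_box (coord x) (l / 2) 0" using l0[of "l / 2"] by (auto simp: l_def)
  \<comment> \<open>The instance \<open>j = 0\<close>: no waiting time, and no contraction
    yet.\<close>
  have box: "in_box (coord x) l t" if "0 \<le> t" "t < T" for t
    using solution_in_box[OF sol l, of t 0] that by simp
  let ?B = "radius * l"
  have B: "0 < ?B" using radius_pos l by simp
  have "\<exists>L. \<forall>s t. 0 \<le> s \<longrightarrow> s \<le> t \<longrightarrow> t < T \<longrightarrow> \<bar>x i t - x i s\<bar> \<le> L * (t - s)" if i: "i \<in> {1..n}" for i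
  proof -
    obtain L where L: "\<forall>u\<in>{0..T}. \<forall>v\<in>{0..T}. \<bar>nderiv (i - 1) f0 v - nderiv (i - 1) f0 u\<bar> \<le> L * \<bar>v - u\<bar>"
    proof -
      have "i - 1 < n" using i by auto
      then show ?thesis using nderiv_lipschitz[OF f0_diff _ f0_bound] that by blast
    qed
    have ki: "0 < k (i - 1)" using k_pos[of "i - 1"] i by auto
    have "\<bar>x i t - x i s\<bar> \<le> (k (i - 1) * (4 * K i * Phi i ?B) + L) * (t - s)" if st: "0 \<le> s" "s \<le> t" "t < T" for s t
    proof -
      have "\<bar>Phi (i - 1) (coord x i t) - Phi (i - 1) (coord x i s)\<bar> \<le> 4 * K i * Phi i ?B * (t - s)"
      proof (rule trajectory_speed[OF solution_trajectory[OF sol] i st(1,2) _ B])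
        show "ereal t < ereal T" using st by simp
        show "\<bar>coord x 1 r\<bar> \<le> ?B" "\<bar>coord x (i + 1) r\<bar> \<le> ?B" if "s \<le> r" "r \<le> t" for r
          using coord_le[OF box[of r], of 1] coord_le[OF box[of r], of "i + 1"] that st i l by auto
      qed
      then have "k (i - 1) * \<bar>Phi (i - 1) (coord x i t) - Phi (i - 1) (coord x i s)\<bar>
          \<le> k (i - 1) * (4 * K i * Phi i ?B * (t - s))" using ki by (intro mult_left_mono) auto
      then have "\<bar>err x i t - err x i s\<bar> \<le> k (i - 1) * (4 * K i * Phi i ?B * (t - s))"
        unfolding err_eq[OF i] using ki by (simp add: abs_mult flip: right_diff_distrib)
      moreover have "\<bar>nderiv (i - 1) f0 t - nderiv (i - 1) f0 s\<bar> \<le> L * (t - s)"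
      proof -
        have "s \<in> {0..T}" "t \<in> {0..T}" using st by auto
        with L have "\<bar>nderiv (i - 1) f0 t - nderiv (i - 1) f0 s\<bar> \<le> L * \<bar>t - s\<bar>" by blast
        then show ?thesis using st by simp
      qed
      moreover have "x i t - x i s = (err x i t - err x i s) + (nderiv (i - 1) f0 t - nderiv (i - 1) f0 s)"
        by (simp add: err_def)
      ultimately have "\<bar>x i t - x i s\<bar> \<le> k (i - 1) * (4 * K i * Phi i ?B * (t - s)) + L * (t - s)" by linarith
      then show ?thesis by (simp add: algebra_simps)
    qed
    then show ?thesis by blast
  qed
  then obtain L where L: "\<And>i s t. i \<in> {1..n} \<Longrightarrow> 0 \<le> s \<Longrightarrow> s \<le> t \<Longrightarrow> t < T \<Longrightarrow> \<bar>x i t - x i s\<bar> \<le> L i * (t - s)" by metis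
  have "\<bar>x i t - x i s\<bar> \<le> Max (L ` {1..n}) * (t - s)" if "i \<in> {1..n}" "0 \<le> s" "s \<le> t" "t < T" for i s t
  proof -
    have "L i * (t - s) \<le> Max (L ` {1..n}) * (t - s)" using that by (intro mult_right_mono Max_ge) auto
    then show ?thesis using L[OF that] by linarith
  qed
  then show ?thesis by blast
qed

lemma maximal_solution_global:
  assumes "maximal_filippov_solution n d0 dinf \<kappa> \<theta> k f \<tau> x"
  shows "\<tau> = \<infinity>"
proof (rule ccontr)
  assume neq: "\<tau> \<noteq> \<infinity>"
  have sol: "filippov_solution n d0 dinf \<kappa> \<theta> k f \<tau> x" "0 < \<tau>"
    and max: "\<not> (\<exists>\<tau>' y. \<tau> < \<tau>' \<and> filippov_solution n d0 dinf \<kappa> \<theta> k f \<tau>' y \<and>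
          (\<forall>i\<in>{1..n}. \<forall>t\<ge>0. ereal t < \<tau> \<longrightarrow> y i t = x i t))"
    using assms unfolding maximal_filippov_solution_def by (auto simp: filippov_solution_def)
  obtain T where T: "\<tau> = ereal T" "0 < T" using neq sol(2) by (cases \<tau>) auto
  obtain L where "\<And>i s t. i \<in> {1..n} \<Longrightarrow> 0 \<le> s \<Longrightarrow> s \<le> t \<Longrightarrow> t < T \<Longrightarrow> \<bar>x i t - x i s\<bar> \<le> L * (t - s)"
    using solution_lipschitz[of T x] sol(1) T(1) by blast
  from solution_extends[OF sol(1)[unfolded T(1)] T(2) this] max show False unfolding T(1) by blast
qed

text \<open>Every dyadic scale is reached in finite time and kept; the error bound at that scale
  tends to 0 because \<open>Phi (i - 1)\<close> is continuous at 0.\<close>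

lemma solution_converges:
  assumes sol: "filippov_solution n d0 dinf \<kappa> \<theta> k f \<infinity> x" and i: "i \<in> {1..n}"
  shows "((\<lambda>t. x i t - nderiv (i - 1) f0 t) \<longlongrightarrow> 0) at_top"
proof -
  obtain l0 where l0: "\<And>l. l0 \<le> l \<Longrightarrow> in_box (coord x) l 0" using initial_box by blast
  define l where "l = 2 * (\<bar>l0\<bar> + 1)"
  have l: "0 < l" "in_box (coord x) (l / 2) 0" using l0[of "l / 2"] by (auto simp: l_def)
  have "(\<lambda>j. k (i - 1) * Phi (i - 1) (radius * (l / 2 ^ j))) \<longlonglongrightarrow> k (i - 1) * Phi (i - 1) 0"
  proof (intro tendsto_intros isCont_tendsto_compose[of 0 "Phi (i - 1)"])
    show "isCont (Phi (i - 1)) 0" using isCont_Phi[of "i - 1" 0] i by auto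
    have "(\<lambda>j. (radius * l) * (1 / 2) ^ j) \<longlonglongrightarrow> (radius * l) * 0"
      by (intro tendsto_mult tendsto_const LIMSEQ_realpow_zero) auto
    then show "(\<lambda>j. radius * (l / 2 ^ j)) \<longlonglongrightarrow> 0" by (simp add: power_divide)
  qed
  then have lim: "(\<lambda>j. k (i - 1) * Phi (i - 1) (radius * (l / 2 ^ j))) \<longlonglongrightarrow> 0" by simp
  show ?thesis
  proof (rule tendstoI)
    fix e :: real assume "0 < e"
    from eventually_happens'[OF sequentially_bot order_tendstoD(2)[OF lim this]]
    obtain j where j: "k (i - 1) * Phi (i - 1) (radius * (l / 2 ^ j)) < e" by blast
    have "dist (x i t - nderiv (i - 1) f0 t) 0 < e" if t: "time_factor * (\<Sum>m<j. scale_time (l / 2 ^ m)) \<le> t" for t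
    proof -
      have "in_box (coord x) (l / 2 ^ j) t" using solution_in_box[OF sol l _ t] by simp
      then have "\<bar>err x i t\<bar> \<le> k (i - 1) * Phi (i - 1) (radius * (l / 2 ^ j))" using l i by (intro err_le) auto
      then show ?thesis using j by (simp add: err_def dist_real_def)
    qed
    then show "\<forall>\<^sub>F t in at_top. dist (x i t - nderiv (i - 1) f0 t) 0 < e"
      unfolding eventually_at_top_linorder by blast
  qed
qed

text \<open>Consecutive weights differ by \<open>d\<close>, so
  \<open>Phi (i - 1) s / Phi i s\<close> has order \<open>- d0 / hweight n d0 1\<close> at 0 and
  \<open>- dinf / hweight n dinf 1\<close> at infinity. The first is positive and the second
  negative, which gives geometric decay along both dyadic sequences.\<close>

lemma scale_time_le:
  assumes "d0 < 0" "0 < dinf"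
  shows "\<exists>B>0. \<exists>\<rho>. 0 < \<rho> \<and> \<rho> < 1 \<and> (\<forall>j. scale_time (2 ^ j) \<le> B * \<rho> ^ j \<and> scale_time (1 / 2 ^ j) \<le> B * \<rho> ^ j)"
proof -
  let ?h = "hweight n d0 1" and ?g = "hweight n dinf 1"
  have pos: "0 < ?h" "0 < ?g" using n_ge d0_le dinf_less by (auto intro!: hweight_pos)
  have "\<exists>B>0. \<forall>s>0. (s \<le> 1 \<longrightarrow> Phi (i - 1) s / Phi i s \<le> B * s powr (- (d0 / ?h))) \<and>
      (1 \<le> s \<longrightarrow> Phi (i - 1) s / Phi i s \<le> B * s powr (- (dinf / ?g)))" if i: "i \<in> {1..n}" for i
  proof -
    have *: "hweight n d (i - 1 + 1) / w - hweight n d (i + 1) / w = - (d / w)" for d w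
      using i by (simp add: hweight_Suc flip: diff_divide_distrib)
    show ?thesis
      using powerlike_ratio[OF Phi_powerlike[of "i - 1"] Phi_powerlike[of i]] i unfolding * by auto
  qed
  then obtain B where B: "\<And>i. i \<in> {1..n} \<Longrightarrow> 0 < B i"
    "\<And>i s. i \<in> {1..n} \<Longrightarrow> 0 < s \<Longrightarrow> s \<le> 1 \<Longrightarrow> Phi (i - 1) s / Phi i s \<le> B i * s powr (- (d0 / ?h))"
    "\<And>i s. i \<in> {1..n} \<Longrightarrow> 0 < s \<Longrightarrow> 1 \<le> s \<Longrightarrow> Phi (i - 1) s / Phi i s \<le> B i * s powr (- (dinf / ?g))"
    by metis
  define \<rho> where "\<rho> = max (2 powr (d0 / ?h)) (2 powr (- (dinf / ?g)))"
  have neg: "d0 / ?h < 0" "- (dinf / ?g) < 0" using assms pos by (auto simp: divide_neg_pos)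
  have \<rho>: "0 < \<rho>" "\<rho> < 1" using neg powr_less_mono[OF neg(1), of 2] powr_less_mono[OF neg(2), of 2]
    by (auto simp: \<rho>_def less_max_iff_disj)
  have sumB: "scale_time s \<le> (\<Sum>i=1..n. B i) * w" if "\<And>i. i \<in> {1..n} \<Longrightarrow> Phi (i - 1) s / Phi i s \<le> B i * w" for s w
    unfolding scale_time_def sum_distrib_right by (rule sum_mono) (rule that)
  have "0 < (\<Sum>i=1..n. B i)" using B(1) n_ge by (intro sum_pos) auto
  moreover have "scale_time (2 ^ j) \<le> (\<Sum>i=1..n. B i) * \<rho> ^ j" for j
  proof (rule sumB)
    fix i assume i: "i \<in> {1..n}"
    have "Phi (i - 1) (2 ^ j) / Phi i (2 ^ j) \<le> B i * (2 ^ j) powr (- (dinf / ?g))"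
      by (rule B(3)[OF i]) auto
    also have "(2 ^ j) powr (- (dinf / ?g)) = (2 powr (- (dinf / ?g))) ^ j"
      by (simp add: powr_powr mult.commute flip: powr_realpow)
    also have "B i * \<dots> \<le> B i * \<rho> ^ j"
      using less_imp_le[OF B(1)[OF i]] by (intro mult_left_mono power_mono) (auto simp: \<rho>_def)
    finally show "Phi (i - 1) (2 ^ j) / Phi i (2 ^ j) \<le> B i * \<rho> ^ j" .
  qed
  moreover have "scale_time (1 / 2 ^ j) \<le> (\<Sum>i=1..n. B i) * \<rho> ^ j" for j
  proof (rule sumB)
    fix i assume i: "i \<in> {1..n}"
    have "Phi (i - 1) (1 / 2 ^ j) / Phi i (1 / 2 ^ j) \<le> B i * (1 / 2 ^ j) powr (- (d0 / ?h))"
      by (rule B(2)[OF i]) auto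
    also have "(1 / 2 ^ j) powr (- (d0 / ?h)) = (2 powr (d0 / ?h)) ^ j"
      by (simp add: powr_divide powr_minus_divide powr_powr mult.commute flip: powr_realpow)
    also have "B i * \<dots> \<le> B i * \<rho> ^ j"
      using less_imp_le[OF B(1)[OF i]] by (intro mult_left_mono power_mono) (auto simp: \<rho>_def)
    finally show "Phi (i - 1) (1 / 2 ^ j) / Phi i (1 / 2 ^ j) \<le> B i * \<rho> ^ j" .
  qed
  ultimately show ?thesis using \<rho> by blast
qed

text \<open>The scales above 1 and those from 1 downwards form two geometric sums, bounded uniformly
  in the starting scale \<open>2 ^ N\<close>.\<close>

lemma total_time_bounded:
  assumes "d0 < 0" "0 < dinf"
  shows "\<exists>S. \<forall>N j. (\<Sum>m<j. scale_time (2 ^ N / 2 ^ m)) \<le> S"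
proof -
  obtain B \<rho> where B: "0 < B" "0 < \<rho>" "\<rho> < 1" "\<And>j. scale_time (2 ^ j) \<le> B * \<rho> ^ j"
    "\<And>j. scale_time (1 / 2 ^ j) \<le> B * \<rho> ^ j" using scale_time_le[OF assms] by blast
  have geo: "(\<Sum>m<j. B * \<rho> ^ m) \<le> B / (1 - \<rho>)" for j
  proof -
    have "(\<Sum>m<j. \<rho> ^ m) \<le> 1 / (1 - \<rho>)"
      using B(2,3) by (subst sum_gp_strict) (auto simp: divide_right_mono)
    then have "B * (\<Sum>m<j. \<rho> ^ m) \<le> B * (1 / (1 - \<rho>))" using B(1) by (intro mult_left_mono) auto
    then show ?thesis by (simp add: sum_distrib_left)
  qed
  have nn: "0 \<le> scale_time (2 ^ N / 2 ^ m)" for N m by (rule scale_time_nonneg) simp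
  have "(\<Sum>m<j. scale_time (2 ^ N / 2 ^ m)) \<le> B / (1 - \<rho>) + B / (1 - \<rho>)" for N j
  proof -
    \<comment> \<open>Lengthening the sum to \<open>N + j\<close> terms allows it to be split at
      scale 1 also when \<open>j < N\<close>.\<close>
    have "(\<Sum>m<j. scale_time (2 ^ N / 2 ^ m)) \<le> (\<Sum>m<N + j. scale_time (2 ^ N / 2 ^ m))"
      by (intro sum_mono2) (auto intro: nn)
    also have "\<dots> = (\<Sum>m<N. scale_time (2 ^ N / 2 ^ m)) + (\<Sum>m<j. scale_time (2 ^ N / 2 ^ (N + m)))"
      by (induction j) auto
    also have "(\<Sum>m<N. scale_time (2 ^ N / 2 ^ m)) = (\<Sum>m<N. scale_time (2 ^ Suc m))"
    proof (subst sum.nat_diff_reindex[symmetric], rule sum.cong)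
      fix m assume "m \<in> {..<N}"
      then have "N = (N - Suc m) + Suc m" by simp
      then have "(2::real) ^ N = 2 ^ (N - Suc m) * 2 ^ Suc m" by (metis power_add)
      then show "scale_time (2 ^ N / 2 ^ (N - Suc m)) = scale_time (2 ^ Suc m)" by simp
    qed simp
    also have "\<dots> \<le> (\<Sum>m<N. B * \<rho> ^ m)"
    proof (rule sum_mono)
      fix m
      have "B * \<rho> ^ Suc m \<le> B * \<rho> ^ m" using B by (intro mult_left_mono power_decreasing) auto
      then show "scale_time (2 ^ Suc m) \<le> B * \<rho> ^ m" using B(4)[of "Suc m"] by linarith
    qed
    also have "\<dots> \<le> B / (1 - \<rho>)" by (rule geo)
    also have "(\<Sum>m<j. scale_time (2 ^ N / 2 ^ (N + m))) \<le> (\<Sum>m<j. B * \<rho> ^ m)"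
      using B(5) by (intro sum_mono) (simp add: power_add)
    also have "\<dots> \<le> B / (1 - \<rho>)" by (rule geo)
    finally show ?thesis by simp
  qed
  then show ?thesis by blast
qed

text \<open>The initial state only selects \<open>N\<close>, and the total waiting time does not
  depend on \<open>N\<close>. At one fixed time the bounds for all scales hold at once, so the
  coordinates are 0.\<close>

lemma solution_fixed_time:
  assumes "d0 < 0" "0 < dinf"
  shows "\<exists>T>0. \<forall>x. filippov_solution n d0 dinf \<kappa> \<theta> k f \<infinity> x \<longrightarrow>
    (\<forall>i\<in>{1..n}. \<forall>t\<ge>T. x i t = nderiv (i - 1) f0 t)"
proof -
  obtain S where S: "\<And>N j. (\<Sum>m<j. scale_time (2 ^ N / 2 ^ m)) \<le> S" using total_time_bounded[OF assms] by blast
  have "0 \<le> S" using S[of 0 0] by simp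
  have "x i t = nderiv (i - 1) f0 t"
    if sol: "filippov_solution n d0 dinf \<kappa> \<theta> k f \<infinity> x" and i: "i \<in> {1..n}" and t: "time_factor * S + 1 \<le> t" for x i t
  proof -
    obtain l0 where l0: "\<And>l. l0 \<le> l \<Longrightarrow> in_box (coord x) l 0" using initial_box by blast
    obtain N where "2 * l0 < 2 ^ N" using real_arch_pow[of 2 "2 * l0"] by auto
    then have box0: "in_box (coord x) (2 ^ N / 2) 0" by (intro l0) simp
    have "\<bar>coord x i t\<bar> \<le> radius * (2 ^ N / 2 ^ j)" for j
    proof (rule coord_le[OF solution_in_box[OF sol _ box0]])
      have "time_factor * (\<Sum>m<j. scale_time (2 ^ N / 2 ^ m)) \<le> time_factor * S"
        using S time_factor_pos by (intro mult_left_mono) auto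
      then show "time_factor * (\<Sum>m<j. scale_time (2 ^ N / 2 ^ m)) \<le> t" using t by linarith
    qed (use i in auto)
    moreover have "(\<lambda>j. radius * (2 ^ N / 2 ^ j)) \<longlonglongrightarrow> 0"
    proof -
      have "(\<lambda>j. (radius * 2 ^ N) * (1 / 2) ^ j) \<longlonglongrightarrow> (radius * 2 ^ N) * 0"
        by (intro tendsto_mult tendsto_const LIMSEQ_realpow_zero) auto
      then show ?thesis by (simp add: power_divide)
    qed
    ultimately have "\<bar>coord x i t\<bar> \<le> 0" by (intro LIMSEQ_le_const) auto
    then have "err x i t = 0" using err_eq[OF i, of x t] by simp
    then show ?thesis by (simp add: err_def)
  qed
  moreover have "0 < time_factor * S + 1" using time_factor_pos \<open>0 \<le> S\<close> by (simp add: add_nonneg_pos)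
  ultimately show ?thesis by blast
qed

end

text \<open>The ratio condition is invariant under a common factor of the \<open>K i\<close>, so a
  geometric sequence can be scaled up until \<open>k n\<close> dominates the disturbance.\<close>

lemma (in differentiator) tuned_gains_exist:
  obtains k K c C D where "injection_chain_constants n Phi c C D" "k 0 = 1" "\<And>i. k (Suc i) = k i * K (Suc i)"
    "d0 = -1 \<Longrightarrow> 2 * \<Delta> \<le> k n * \<kappa> n" "\<And>i. i \<in> {1..n} \<Longrightarrow> 1 \<le> K i"
    "\<And>i. i \<in> {1..<n} \<Longrightarrow> injection_chain_constants.gain_ratio c C D * K (i + 1) \<le> K i"
proof (rule injection_chain.constants_exist[OF injection_chain_Phi])
  fix c C D assume const: "injection_chain_constants n Phi c C D"
  define R where "R = injection_chain_constants.gain_ratio c C D"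
  have R: "1 \<le> R"
    using injection_chain_constants.c_pos[OF const] injection_chain_constants.C_pos[OF const]
      injection_chain_constants.D_pos[OF const]
    by (simp add: R_def injection_chain_constants.gain_ratio_def[OF const])
  define b where "b = max 1 (2 * \<Delta> / \<kappa> n)"
  \<comment> \<open>Consecutive values have ratio exactly \<open>R\<close>, and
    \<open>K n = b\<close>. All factors are at least 1, so the product \<open>k n\<close> is at
    least \<open>b\<close>, hence at least \<open>2 * \<Delta> / \<kappa> n\<close>.\<close>
  define K where "K i = R ^ (n - i) * b" for i
  define k where "k i = (\<Prod>l=1..i. K l)" for i
  have b: "1 \<le> b" "2 * \<Delta> / \<kappa> n \<le> b" by (auto simp: b_def)
  have K1: "1 \<le> K i" for i
  proof -
    have "1 * 1 \<le> K i" unfolding K_def using R b by (intro mult_mono one_le_power) auto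
    then show ?thesis by simp
  qed
  have \<kappa>: "0 < \<kappa> n" using \<kappa>_pos n_ge by auto
  have "2 * \<Delta> \<le> b * \<kappa> n" using b(2) \<kappa> by (simp add: pos_divide_le_eq)
  moreover have "b \<le> k n"
  proof -
    have "k n = k (n - 1) * K n" using n_ge by (cases n) (auto simp: k_def)
    moreover have "1 \<le> k (n - 1)" unfolding k_def by (intro prod_ge_1) (rule K1)
    moreover have "K n = b" by (simp add: K_def)
    ultimately show ?thesis using b(1) mult_right_mono[of 1 "k (n - 1)" b] by simp
  qed
  then have "b * \<kappa> n \<le> k n * \<kappa> n" using \<kappa> by (intro mult_right_mono) auto
  ultimately have "2 * \<Delta> \<le> k n * \<kappa> n" by linarith
  moreover have "R * K (i + 1) \<le> K i" if "i \<in> {1..<n}" for i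
  proof -
    have "n - i = Suc (n - (i + 1))" using that by auto
    then show ?thesis by (simp add: K_def)
  qed
  ultimately show thesis
    using that[OF const, of k K] K1 by (auto simp: k_def R_def)
qed

theorem theorem1:
  fixes n :: nat and d0 dinf \<Delta> :: real and \<kappa> \<theta> :: "nat \<Rightarrow> real"
  assumes "n \<ge> 2"
    and "-1 \<le> d0" and "d0 \<le> dinf" and "dinf < 1 / (real n - 1)"
    and "\<And>i. i \<in> {1..n} \<Longrightarrow> \<kappa> i > 0"
    and "\<And>i. i \<in> {1..n} \<Longrightarrow> \<theta> i > 0"
    and "\<Delta> \<ge> 0" and "d0 > -1 \<Longrightarrow> \<Delta> = 0"
  shows "\<exists>k :: nat \<Rightarrow> real. (\<forall>i\<in>{1..n}. k i > 0) \<and>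
    (\<forall>f f0 \<nu> :: real \<Rightarrow> real.
       f \<in> borel_measurable (lebesgue_on {0..}) \<longrightarrow>
       (\<forall>t\<ge>0. f t = f0 t + \<nu> t) \<longrightarrow>
       n_times_differentiable n f0 \<longrightarrow>
       (\<forall>t\<ge>0. \<nu> t = 0) \<longrightarrow>
       (\<forall>t\<ge>0. \<bar>nderiv n f0 t\<bar> \<le> \<Delta>) \<longrightarrow>
         (\<forall>\<tau> x. maximal_filippov_solution n d0 dinf \<kappa> \<theta> k f \<tau> x \<longrightarrow>
            \<tau> = \<infinity> \<and>
            (\<forall>i\<in>{1..n}. ((\<lambda>t. x i t - nderiv (i - 1) f0 t) \<longlongrightarrow> 0) at_top)) \<and>
         ((-1 < d0 \<and> d0 < 0 \<and> 0 < dinf \<and> dinf < 1 / (real n - 1) \<and> f \<in> poly_signals n) \<or>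
          (-1 = d0 \<and> 0 < dinf \<and> dinf < 1 / (real n - 1) \<and> f \<in> lipschitz_signals n \<Delta>) \<longrightarrow>
            (\<exists>T>0. \<forall>\<tau> x. maximal_filippov_solution n d0 dinf \<kappa> \<theta> k f \<tau> x \<longrightarrow>
               \<tau> = \<infinity> \<and> (\<forall>i\<in>{1..n}. \<forall>t\<ge>T. x i t = nderiv (i - 1) f0 t))))"
proof -
  interpret differentiator n d0 dinf \<Delta> \<kappa> \<theta>
    using assms by unfold_locales auto
  show ?thesis
  \<comment> \<open>The gains are fixed before the signal: they depend on it only through the bound
    \<open>\<Delta>\<close>.\<close>
  proof (rule tuned_gains_exist)
    fix k K c C D
    assume const: "injection_chain_constants n Phi c C D" and k: "k 0 = 1" "\<And>i. k (Suc i) = k i * K (Suc i)"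
      and k_last: "d0 = -1 \<Longrightarrow> 2 * \<Delta> \<le> k n * \<kappa> n" and K: "\<And>i. i \<in> {1..n} \<Longrightarrow> 1 \<le> K i"
      and ratio: "\<And>i. i \<in> {1..<n} \<Longrightarrow> injection_chain_constants.gain_ratio c C D * K (i + 1) \<le> K i"
    interpret differentiator_gains n d0 dinf \<Delta> \<kappa> \<theta> k K
    proof
      show "0 < K i" if "i \<in> {1..n}" for i using K[OF that] by linarith
    qed (use k k_last in auto)
    show ?thesis
    proof (intro exI[of _ k] conjI ballI allI[where 'a = "real \<Rightarrow> real"] impI)
      show "0 < k i" if "i \<in> {1..n}" for i using k_pos that by simp
    next
      fix f f0 \<nu> :: "real \<Rightarrow> real"
      assume f: "\<forall>t\<ge>0. f t = f0 t + \<nu> t" "\<forall>t\<ge>0. \<nu> t = 0" and f0: "n_times_differentiable n f0"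
        and bound: "\<forall>t\<ge>0. \<bar>nderiv n f0 t\<bar> \<le> \<Delta>"
      interpret differentiator_signal n d0 dinf \<Delta> \<kappa> \<theta> k K f f0
        using f f0 bound by unfold_locales auto
      interpret tuned_differentiator n d0 dinf \<Delta> \<kappa> \<theta> k K f f0 c C D
        by (intro tuned_differentiator.intro differentiator_signal_axioms tuned_differentiator_axioms.intro
            const K ratio)
      have global: "\<tau> = \<infinity>" "filippov_solution n d0 dinf \<kappa> \<theta> k f \<infinity> x"
        if "maximal_filippov_solution n d0 dinf \<kappa> \<theta> k f \<tau> x" for \<tau> x
        using maximal_solution_global[OF that] that by (auto simp: maximal_filippov_solution_def)
      show "\<forall>\<tau> x. maximal_filippov_solution n d0 dinf \<kappa> \<theta> k f \<tau> x \<longrightarrow>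
          \<tau> = \<infinity> \<and> (\<forall>i\<in>{1..n}. ((\<lambda>t. x i t - nderiv (i - 1) f0 t) \<longlongrightarrow> 0) at_top)"
        using global solution_converges by blast
      assume "(-1 < d0 \<and> d0 < 0 \<and> 0 < dinf \<and> dinf < 1 / (real n - 1) \<and> f \<in> poly_signals n) \<or>
          (-1 = d0 \<and> 0 < dinf \<and> dinf < 1 / (real n - 1) \<and> f \<in> lipschitz_signals n \<Delta>)"
      then have "d0 < 0" "0 < dinf" by auto
      from solution_fixed_time[OF this] global
      show "\<exists>T>0. \<forall>\<tau> x. maximal_filippov_solution n d0 dinf \<kappa> \<theta> k f \<tau> x \<longrightarrow>
          \<tau> = \<infinity> \<and> (\<forall>i\<in>{1..n}. \<forall>t\<ge>T. x i t = nderiv (i - 1) f0 t)" by blast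
    qed
  qed
qed

end
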